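(* Let $\Omega$ be a bounded domain of $\mathbb{C}^{n+1}$ whose boundary is a real hypersurface of class $C^2$. Then for every defining function $f$ of class $C^2$ of $\Omega=\{f<0\}$ and for every $j=1,\dots,n$, \[ \int_\Omega\sigma_{j+1}(\partial\bar\partial f)\,dx=\binom{n+1}{j+1}\frac{1}{2(n+1)}\int_{\partial\Omega}K^{(j)}_{\partial\Omega}(z)\,|\partial f|^{j+1}\,d\sigma(x), \] where $K^{(j)}_{\partial\Omega}$ is the $j$-th Levi curvature of $\partial\Omega$.
   Context: Identify $\mathbb{C}^{n+1}$ with $\mathbb{R}^{2(n+1)}$; $dx$ is Lebesgue measure and $d\sigma$ the surface measure on $\partial\Omega$. A defining function is a real function $f$ on a neighborhood of $\overline\Omega$ with $\Omega=\{f<0\}$, $\partial\Omega=\{f=0\}$ and $\nabla f\neq0$ on $\partial\Omega$. Notation: $f_j=\partial f/\partial z_j$, $f_{\bar j}=\overline{f_j}$, $f_{j\bar\ell}=\partial^2 f/\partial z_j\partial\bar z_\ell$, $|\partial f|=\big(\sum_{j=1}^{n+1}|f_j|^2\big)^{1/2}$, $\partial\bar\partial f=[f_{\ell\bar k}]$ the complex Hessian, and $\sigma_m(A)$ the $m$-th elementary symmetric function of the eigenvalues of the Hermitian matrix $A$. The $j$-th Levi curvature of $\partial\Omega$ at $z\in\partial\Omega$ is \[ K^{(j)}_{\partial\Omega}(z)=-\frac{1}{\binom{n}{j}}\frac{1}{|\partial f|^{j+2}}\sum_{1\le i_1<\dots<i_{j+1}\le n+1}\det\begin{pmatrix} 0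 & f_{\bar i_1} & \cdots & f_{\bar i_{j+1}}\\ f_{i_1} & f_{i_1\bar i_1} & \cdots & f_{i_1\bar i_{j+1}}\\ \vdots & \vdots & \ddots & \vdots\\ f_{i_{j+1}} & f_{i_{j+1}\bar i_1} & \cdots & f_{i_{j+1}\bar i_{j+1}} \end{pmatrix}(z), \] for any defining function $f$ (the value is independent of the choice). *)

theory Defs
  imports "HOL-Analysis.Analysis"
begin

text \<open>Size-delta approximation of the s-dimensional Hausdorff measure, normalised by the
volume of the s-dimensional unit ball, so that it agrees with s-dimensional surface area.\<close>
definition hausdorff_pre :: "real \<Rightarrow> real \<Rightarrow> 'a::metric_space set \<Rightarrow> ennreal" where
  "hausdorff_pre s \<delta> A =
     (INF C \<in> {C :: nat \<Rightarrow> 'a set. A \<subseteq> (\<Union>i. C i) \<and> (\<forall>i. bounded (C i) \<and> diameter (C i) \<le> \<delta>)}.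
        (\<Sum>i. ennreal (unit_ball_vol s * (diameter (C i) / 2) powr s)))"

definition hausdorff_outer :: "real \<Rightarrow> 'a::metric_space set \<Rightarrow> ennreal" where
  "hausdorff_outer s A = (SUP \<delta> \<in> {0<..}. hausdorff_pre s \<delta> A)"

definition surface_measure :: "'a::euclidean_space measure" where
  "surface_measure = measure_of UNIV (sets borel) (hausdorff_outer (real DIM('a) - 1))"

definition C2_on :: "'a::real_normed_vector set \<Rightarrow> ('a \<Rightarrow> real) \<Rightarrow> bool" where
  "C2_on U f \<longleftrightarrow> (\<exists>(Df :: 'a \<Rightarrow> ('a \<Rightarrow>\<^sub>L real)) (D2f :: 'a \<Rightarrow> ('a \<Rightarrow>\<^sub>L ('a \<Rightarrow>\<^sub>L real))).
      (\<forall>x\<in>U. (f has_derivative blinfun_apply (Df x)) (at x)) \<and>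
      (\<forall>x\<in>U. (Df has_derivative blinfun_apply (D2f x)) (at x)) \<and>
      continuous_on U D2f)"

definition C2_hypersurface :: "'a::real_normed_vector set \<Rightarrow> bool" where
  "C2_hypersurface M \<longleftrightarrow> (\<forall>p\<in>M. \<exists>V g. open V \<and> p \<in> V \<and> C2_on V g \<and>
      (\<forall>z\<in>M \<inter> V. frechet_derivative g (at z) \<noteq> (\<lambda>_. 0)) \<and>
      M \<inter> V = {z\<in>V. g z = 0})"

definition defining_function :: "'a::real_normed_vector set \<Rightarrow> ('a \<Rightarrow> real) \<Rightarrow> bool" where
  "defining_function \<Omega> f \<longleftrightarrow> (\<exists>U. open U \<and> closure \<Omega> \<subseteq> U \<and> C2_on U f \<and>
      \<Omega> = {z\<in>U. f z < 0} \<and> frontier \<Omega> = {z\<in>U. f z = 0} \<and>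
      (\<forall>z\<in>frontier \<Omega>. frechet_derivative f (at z) \<noteq> (\<lambda>_. 0)))"

definition dpart :: "('a::real_normed_vector \<Rightarrow> complex) \<Rightarrow> 'a \<Rightarrow> 'a \<Rightarrow> complex" where
  "dpart g v z = frechet_derivative g (at z) v"

definition wz :: "'n::finite \<Rightarrow> (complex^'n \<Rightarrow> complex) \<Rightarrow> complex^'n \<Rightarrow> complex" where
  "wz k g z = (dpart g (axis k 1) z - \<i> * dpart g (axis k \<i>) z) / 2"

definition wzbar :: "'n::finite \<Rightarrow> (complex^'n \<Rightarrow> complex) \<Rightarrow> complex^'n \<Rightarrow> complex" where
  "wzbar k g z = (dpart g (axis k 1) z + \<i> * dpart g (axis k \<i>) z) / 2"

definition fz :: "(complex^'n::finite \<Rightarrow> real) \<Rightarrow> 'n \<Rightarrow> complex^'n \<Rightarrow> complex" where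
  "fz f k z = wz k (\<lambda>w. complex_of_real (f w)) z"

definition fzbar :: "(complex^'n::finite \<Rightarrow> real) \<Rightarrow> 'n \<Rightarrow> complex^'n \<Rightarrow> complex" where
  "fzbar f k z = wzbar k (\<lambda>w. complex_of_real (f w)) z"

definition fzzbar :: "(complex^'n::finite \<Rightarrow> real) \<Rightarrow> 'n \<Rightarrow> 'n \<Rightarrow> complex^'n \<Rightarrow> complex" where
  "fzzbar f k l z = wz k (\<lambda>w. wzbar l (\<lambda>u. complex_of_real (f u)) w) z"

definition cplx_hessian :: "(complex^'n::finite \<Rightarrow> real) \<Rightarrow> complex^'n \<Rightarrow> complex^'n^'n" where
  "cplx_hessian f z = (\<chi> l k. fzzbar f l k z)"

definition norm_partial :: "(complex^'n::finite \<Rightarrow> real) \<Rightarrow> complex^'n \<Rightarrow> real" where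
  "norm_partial f z = sqrt (\<Sum>k\<in>UNIV. (cmod (fz f k z))\<^sup>2)"

text \<open>The eigenvalues of A counted with (algebraic) multiplicity, i.e. a family lambda with
det(tI - A) = prod_i (t - lambda_i); sigma_m is the m-th elementary symmetric function of them
(independent of the enumeration).\<close>
definition sigma_eig :: "nat \<Rightarrow> complex^'n^'n::finite \<Rightarrow> complex" where
  "sigma_eig m A =
     (let ev = (SOME ev :: 'n \<Rightarrow> complex. \<forall>t. det (mat t - A) = (\<Prod>i\<in>UNIV. t - ev i))
      in \<Sum>S \<in> {S. card S = m}. \<Prod>i\<in>S. ev i)"

definition det_on :: "'i set \<Rightarrow> ('i \<Rightarrow> 'i \<Rightarrow> complex) \<Rightarrow> complex" where
  "det_on S M = (\<Sum>p \<in> {p. p permutes S}. of_int (sign p) * (\<Prod>i\<in>S. M i (p i)))"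

definition bordered :: "(complex^'n::finite \<Rightarrow> real) \<Rightarrow> complex^'n \<Rightarrow> 'n option \<Rightarrow> 'n option \<Rightarrow> complex" where
  "bordered f z a b = (case (a, b) of
      (None, None) \<Rightarrow> 0
    | (None, Some k) \<Rightarrow> fzbar f k z
    | (Some i, None) \<Rightarrow> fz f i z
    | (Some i, Some k) \<Rightarrow> fzzbar f i k z)"

text \<open>j-th Levi curvature; here n = CARD('n) - 1, i.e. the ambient space is C^(n+1).\<close>
definition levi_curv :: "nat \<Rightarrow> (complex^'n::finite \<Rightarrow> real) \<Rightarrow> complex^'n \<Rightarrow> complex" where
  "levi_curv j f z =
     - (1 / of_nat ((CARD('n) - 1) choose j)) * (1 / complex_of_real (norm_partial f z ^ (j + 2))) *
       (\<Sum>I \<in> {I :: 'n set. card I = j + 1}. det_on (insert None (Some ` I)) (bordered f z))"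

end

theory Submission
  imports Defs "HOL-Computational_Algebra.Fundamental_Theorem_Algebra"
begin

text \<open>Let m = j + 1 and let sigma be the sum over all index sets I with m
  elements of the principal minors det (f_{l kbar}), l, k in I, of the complex Hessian; this is the m-th
  elementary symmetric function of its eigenvalues. Multiply by a cutoff chi_delta(f) that is 1 for
  f <= -3 delta and 0 for f >= -delta. The rows of cofactors of the Hessian are divergence free (in the
  weak sense, f being only of class C^2, which is obtained by mollifying the first derivatives of f), so
  integrating by parts in each column of each minor gives
  m * INT chi_delta(f) sigma = INT chi_delta'(f) (SUM_I det B_I), where B_I is the bordered matrix of the
  Levi curvature. As delta tends to 0, the weights -chi_delta'(f) |grad f| dx converge to the surface
  measure of the boundary, and |grad f| = 2 |df|.

  For the last convergence, the boundary is nearly flat near each of its points: projection to the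
  tangent hyperplane is bi-Lipschitz with constants close to 1, so the normalised Hausdorff measure is
  close to Lebesgue measure of the projection, while along the normal direction the weights integrate
  to 1. This uses that the normalised Hausdorff measure of full dimension is Lebesgue measure, that is,
  the isodiametric inequality (from Brunn--Minkowski) and Vitali's covering theorem.\<close>

section \<open>The isodiametric inequality\<close>

text \<open>Three obstacles shape the argument. First, \<open>f\<close> is controlled only near the
  closure of the domain. The functions that are differentiated are therefore products of a cutoff
  with f_kbar, extended by zero. The cutoff stops at level -delta, strictly inside, so these
  extensions are C^1 with compact support in the whole space, where the integral of a derivative
  vanishes and no boundary term has to be discussed. Secondly, moving derivatives across a minor
  needs them to commute on its entries, where third derivatives of \<open>f\<close> would appear.
  Using one and the same kernel for all entries makes the mollified entries commute exactly, since
  one derivative can be shifted onto the kernel. Thirdly, the surface measure is given by arbitrary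
  coverings and not by a parametrisation, so a chart determines it only up to a factor 1 + epsilon.
  This error is relative to the integral itself, hence for nonnegative densities it adds up without
  loss over a partition of unity, and epsilon may tend to 0 at the very end. The binomial constant
  of the formula comes from (j+1) C(n+1, j+1) = (n+1) C(n, j), the factor j+1 being the number of
  columns of a minor.\<close>

definition box_family :: "'a::euclidean_space set set \<Rightarrow> bool" where
  "box_family D \<longleftrightarrow> finite D \<and> disjoint D \<and> (\<forall>B\<in>D. B \<noteq> {} \<and> (\<exists>a b. B = box a b))"

text \<open>Half the Minkowski sum. The inequality is used in its multiplicative form, with the
  geometric mean of the volumes: it suffices for two sets of equal volume and involves no roots
  depending on the dimension. It is stated for measurable supersets \<open>T\<close> of the
  midpoints, which can themselves be cut by a hyperplane.\<close>

definition midpoints :: "'a::real_vector set \<Rightarrow> 'a set \<Rightarrow> 'a set" where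
  "midpoints A B = {(1/2) *\<^sub>R (x + y) | x y. x \<in> A \<and> y \<in> B}"

lemma midpoints_commute: "midpoints A B = midpoints B A"
  unfolding midpoints_def by (auto simp: add.commute) (use add.commute in blast)+

lemma midpoints_mono: "A \<subseteq> A' \<Longrightarrow> B \<subseteq> B' \<Longrightarrow> midpoints A B \<subseteq> midpoints A' B'"
  unfolding midpoints_def by blast

section \<open>Cutting sets by coordinate hyperplanes\<close>

lemma box_Int_halfspace_lt:
  fixes a b i :: "'a::euclidean_space"
  assumes "i \<in> Basis"
  shows "box a b \<inter> {x. x \<bullet> i < c} = box a (\<Sum>k\<in>Basis. (if k = i then min (b \<bullet> i) c else b \<bullet> k) *\<^sub>R k)"
  using assms by (auto simp: box_def split: if_splits)

lemma box_Int_halfspace_gt: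
  fixes a b i :: "'a::euclidean_space"
  assumes "i \<in> Basis"
  shows "box a b \<inter> {x. x \<bullet> i > c} = box (\<Sum>k\<in>Basis. (if k = i then max (a \<bullet> i) c else a \<bullet> k) *\<^sub>R k) b"
  using assms by (auto simp: box_def split: if_splits)

text \<open>The last claim drives the induction: a box that misses the half-space leaves an empty
  piece, which is discarded, so \<open>card\<close> drops. Open boxes stay open when cut, and only
  points of the hyperplane, a null set, are lost.\<close>

lemma box_family_Int:
  assumes D: "box_family D" and "i \<in> Basis" and H: "H = {x. x \<bullet> i < c} \<or> H = {x. x \<bullet> i > c}"
  shows "box_family ((\<lambda>B. B \<inter> H) ` D - {{}})" "\<Union>((\<lambda>B. B \<inter> H) ` D - {{}}) = \<Union>D \<inter> H"
    "card ((\<lambda>B. B \<inter> H) ` D - {{}}) \<le> card D"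
    "B \<in> D \<Longrightarrow> B \<inter> H = {} \<Longrightarrow> card ((\<lambda>B. B \<inter> H) ` D - {{}}) < card D"
proof -
  let ?E = "(\<lambda>B. B \<inter> H) ` D - {{}}"
  have fin: "finite D" and disj: "disjoint D" using D by (auto simp: box_family_def)
  have "disjoint ?E"
    using disj unfolding disjoint_def by blast
  moreover have "\<exists>a b. B \<inter> H = box a b" if B: "B \<in> D" for B
  proof -
    obtain a b where "B = box a b" using D B unfolding box_family_def by blast
    then show ?thesis
      using H box_Int_halfspace_lt[OF \<open>i \<in> Basis\<close>, of a b c] box_Int_halfspace_gt[OF \<open>i \<in> Basis\<close>, of a b c]
      by blast
  qed
  ultimately show "box_family ?E" using fin by (auto simp: box_family_def)
  show "\<Union>?E = \<Union>D \<inter> H" by auto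
  have "card ?E \<le> card ((\<lambda>B. B \<inter> H) ` D)" by (intro card_mono) (use fin in auto)
  also have "\<dots> \<le> card D" by (rule card_image_le[OF fin])
  finally show "card ?E \<le> card D" .
  assume B: "B \<in> D" "B \<inter> H = {}"
  have "?E \<subseteq> (\<lambda>B. B \<inter> H) ` (D - {B})" using B by blast
  then have "card ?E \<le> card ((\<lambda>B. B \<inter> H) ` (D - {B}))" by (intro card_mono) (use fin in auto)
  also have "\<dots> \<le> card (D - {B})" by (rule card_image_le) (use fin in auto)
  also have "\<dots> < card D" using B(1) fin by (intro card_Diff1_less)
  finally show "card ?E < card D" .
qed

text \<open>The intersection of two boxes is a product of intervals, so if it is empty then one of
  the factors is, and the boxes lie on different sides of a hyperplane in that coordinate.
  \<open>B'\<close> and \<open>C'\<close> are the two given boxes in the order in which they occur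
  along the axis.\<close>

lemma disjoint_boxes_separated:
  fixes B C :: "'a::euclidean_space set"
  assumes "box_family D" "B \<in> D" "C \<in> D" "B \<noteq> C"
  obtains i c B' C' where "i \<in> Basis" "B' \<in> D" "C' \<in> D" "B' \<inter> {x. x \<bullet> i > c} = {}" "C' \<inter> {x. x \<bullet> i < c} = {}"
proof -
  obtain a b a' b' where ab: "B = box a b" "C = box a' b'" "B \<noteq> {}" "C \<noteq> {}" "B \<inter> C = {}"
    using assms unfolding box_family_def disjoint_def by metis
  then obtain i where i: "i \<in> Basis" "b \<bullet> i \<le> a' \<bullet> i \<or> b' \<bullet> i \<le> a \<bullet> i"
    using disjoint_interval(4)[of a b a' b'] by (metis box_ne_empty(2) not_less)
  have "B \<inter> {x. x \<bullet> i > b \<bullet> i} = {}" "C \<inter> {x. x \<bullet> i > b' \<bullet> i} = {}"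
       "B \<inter> {x. x \<bullet> i < a \<bullet> i} = {}" "C \<inter> {x. x \<bullet> i < a' \<bullet> i} = {}"
    using i by (auto simp: ab box_def)
  then show ?thesis
  proof (cases "b \<bullet> i \<le> a' \<bullet> i")
    case True
    have "C \<inter> {x. x \<bullet> i < b \<bullet> i} = {}" using \<open>C \<inter> {x. x \<bullet> i < a' \<bullet> i} = {}\<close> True by force
    with \<open>B \<inter> {x. x \<bullet> i > b \<bullet> i} = {}\<close> show ?thesis using that[OF i(1) assms(2,3)] by blast
  next
    case False
    with i have "b' \<bullet> i \<le> a \<bullet> i" by auto
    then have "B \<inter> {x. x \<bullet> i < b' \<bullet> i} = {}" using \<open>B \<inter> {x. x \<bullet> i < a \<bullet> i} = {}\<close> by force
    with \<open>C \<inter> {x. x \<bullet> i > b' \<bullet> i} = {}\<close> show ?thesis using that[OF i(1) assms(3,2)] by blast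
  qed
qed

lemma fmeasurable_bounded_open:
  fixes S :: "'a::euclidean_space set"
  shows "open S \<Longrightarrow> bounded S \<Longrightarrow> S \<in> fmeasurable lborel"
  by (intro fmeasurableI) (auto simp: emeasure_bounded_finite infinity_ennreal_def[symmetric] simp del: infinity_ennreal_def)

lemma null_sets_lborel_hyperplane:
  fixes i :: "'a::euclidean_space"
  assumes "i \<in> Basis"
  shows "{x. x \<bullet> i = c} \<in> null_sets lborel"
proof -
  have "negligible {x. x \<bullet> i = c}"
    using negligible_standard_hyperplane[OF assms, of c] by simp
  moreover have "{x. x \<bullet> i = c} \<in> sets borel" by measurable
  ultimately show ?thesis
    by (auto simp: negligible_iff_null_sets null_sets_completion_iff)
qed

lemma measure_halfspace_split:
  fixes S :: "'a::euclidean_space set"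
  assumes "S \<in> fmeasurable lborel" "i \<in> Basis"
  shows "measure lborel S = measure lborel (S \<inter> {x. x \<bullet> i < c}) + measure lborel (S \<inter> {x. x \<bullet> i > c})"
proof -
  let ?A = "S \<inter> {x. x \<bullet> i < c}" and ?B = "S \<inter> {x. x \<bullet> i > c}" and ?N = "S \<inter> {x. x \<bullet> i = c}"
  have S: "S \<in> sets lborel" using assms by auto
  have f: "?A \<in> fmeasurable lborel" "?B \<in> fmeasurable lborel" 
    using assms(1) by (auto intro!: fmeasurable_Int_fmeasurable)
  have N: "?N \<in> null_sets lborel" 
    using null_sets_lborel_hyperplane[OF assms(2)] S by (auto intro: null_set_Int1)
  have "measure lborel S = measure lborel ((?A \<union> ?B) \<union> ?N)"
    by (intro arg_cong[where f = "measure lborel"]) auto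
  also have "\<dots> = measure lborel (?A \<union> ?B)" using N S by (intro measure_Un_null_set) auto
  also have "\<dots> = measure lborel ?A + measure lborel ?B"
    using f by (intro measure_Union) (auto simp: fmeasurable_def)
  finally show ?thesis .
qed

text \<open>Moving the hyperplane from \<open>c\<close> to \<open>d\<close> gains at most a slab of
  \<open>S\<close>, which fits into a box of width \<open>d - c\<close> and side
  \<open>2 * R\<close> in the other directions. The function is thus Lipschitz with constant
  \<open>(2 * R) ^ (DIM('a) - 1)\<close>.\<close>

lemma continuous_measure_halfspace:
  fixes S :: "'a::euclidean_space set"
  assumes S: "S \<in> fmeasurable lborel" "bounded S" and i: "i \<in> Basis"
  shows "continuous_on UNIV (\<lambda>c. measure lborel (S \<inter> {x. x \<bullet> i < c}))"
proof -
  obtain R where R: "R > 0" "S \<subseteq> cball 0 R" using \<open>bounded S\<close> 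
    by (metis bounded_pos mem_cball_0 subsetI)
  define m where "m c = measure lborel (S \<inter> {x. x \<bullet> i < c})" for c
  define K where "K = (2 * R) ^ (DIM('a) - 1)"
  have K: "K \<ge> 0" using R by (simp add: K_def)
  have fm: "S \<inter> {x. x \<bullet> i < c} \<in> fmeasurable lborel" for c
    using S(1) by (auto intro!: fmeasurable_Int_fmeasurable)
  have step: "m c \<le> m d \<and> m d - m c \<le> K * (d - c)" if "c \<le> d" for c d
  proof
    show "m c \<le> m d" unfolding m_def 
      by (intro measure_mono_fmeasurable fm) (use that fmeasurableD[OF fm] in auto)
    define u v where "u = (\<Sum>k\<in>Basis. (if k = i then c else -R) *\<^sub>R k)"
      and "v = (\<Sum>k\<in>Basis. (if k = i then d else R) *\<^sub>R k)"
    have uv: "u \<bullet> k = (if k = i then c else -R)" "v \<bullet> k = (if k = i then d else R)" if "k \<in> Basis" for k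
      using that by (simp_all add: u_def v_def)
    have sub: "S \<inter> {x. x \<bullet> i < d} \<subseteq> (S \<inter> {x. x \<bullet> i < c}) \<union> cbox u v"
    proof
      fix x assume x: "x \<in> S \<inter> {x. x \<bullet> i < d}"
      have "- R \<le> x \<bullet> k \<and> x \<bullet> k \<le> R" if "k \<in> Basis" for k
        using x R Basis_le_norm[OF that, of x] by (auto simp: subset_iff)
      then show "x \<in> (S \<inter> {x. x \<bullet> i < c}) \<union> cbox u v"
        using x by (cases "x \<bullet> i < c") (auto simp: mem_box uv)
    qed
    have "m d \<le> measure lborel ((S \<inter> {x. x \<bullet> i < c}) \<union> cbox u v)" unfolding m_def
      by (intro measure_mono_fmeasurable sub fmeasurable.Un fm fmeasurable_cbox fmeasurableD[OF fm])
    also have "\<dots> \<le> m c + measure lborel (cbox u v)" unfolding m_def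
      by (intro measure_Un_le fmeasurableD fm fmeasurable_cbox)
    also have "measure lborel (cbox u v) = (\<Prod>k\<in>Basis. (v - u) \<bullet> k)"
      using that R by (subst measure_lborel_cbox_eq) (auto simp: uv)
    also have "\<dots> = ((v - u) \<bullet> i) * (\<Prod>k\<in>Basis - {i}. (v - u) \<bullet> k)"
      using i by (subst prod.remove[of _ i]) auto
    also have "(\<Prod>k\<in>Basis - {i}. (v - u) \<bullet> k) = (\<Prod>k\<in>Basis - {i}. 2 * R)"
      by (intro prod.cong) (auto simp: uv inner_diff_left)
    also have "\<dots> = K" using i by (simp add: K_def card_Diff_singleton)
    also have "(v - u) \<bullet> i = d - c" using i by (simp add: uv inner_diff_left)
    finally show "m d - m c \<le> K * (d - c)" by (simp add: mult.commute)
  qed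
  have "K-lipschitz_on UNIV m"
  proof (rule lipschitz_onI)
    fix c d :: real
    show "dist (m c) (m d) \<le> K * dist c d"
    proof (cases "c \<le> d")
      case True then show ?thesis using step[of c d] by (simp add: dist_real_def)
    next
      case False then show ?thesis using step[of d c] by (simp add: dist_real_def)
    qed
  qed (rule K)
  then show ?thesis unfolding m_def by (rule lipschitz_on_continuous_on)
qed

text \<open>Intermediate value theorem between two hyperplanes that have all of \<open>S\<close> on
  one side. It supplies the parallel cut of the second family in the ratio dictated by the
  first.\<close>

lemma measure_halfspace_ratio:
  fixes S :: "'a::euclidean_space set"
  assumes S: "S \<in> fmeasurable lborel" "bounded S" and i: "i \<in> Basis" and t: "0 \<le> t" "t \<le> 1"
  obtains c where "measure lborel (S \<inter> {x. x \<bullet> i < c}) = t * measure lborel S"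
    "measure lborel (S \<inter> {x. x \<bullet> i > c}) = (1 - t) * measure lborel S"
proof -
  obtain R where R: "R > 0" "S \<subseteq> ball 0 R" using \<open>bounded S\<close> 
    by (metis bounded_subset_ballD)
  define m where "m c = measure lborel (S \<inter> {x. x \<bullet> i < c})" for c
  have b: "\<bar>x \<bullet> i\<bar> < R" if "x \<in> S" for x
    using that R Basis_le_norm[OF i, of x] by (fastforce simp: subset_iff)
  have "S \<inter> {x. x \<bullet> i < -R} = {}" "S \<inter> {x. x \<bullet> i < R} = S"
    using b by force+
  then have "m (-R) = 0" "m R = measure lborel S" by (simp_all add: m_def)
  moreover have "t * measure lborel S \<le> measure lborel S"
    using t by (simp add: mult_left_le_one_le)
  moreover have "continuous_on {-R..R} m"
    using continuous_measure_halfspace[OF S i] unfolding m_def by (rule continuous_on_subset) auto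
  moreover have "0 \<le> t * measure lborel S" using t by simp
  ultimately obtain c where "m c = t * measure lborel S"
    using IVT'[of m "-R" "t * measure lborel S" R] R by force
  then have "measure lborel (S \<inter> {x. x \<bullet> i < c}) = t * measure lborel S" by (simp only: m_def)
  moreover then have "measure lborel (S \<inter> {x. x \<bullet> i > c}) = (1 - t) * measure lborel S"
    using measure_halfspace_split[OF S(1) i, of c] unfolding left_diff_distrib by linarith
  ultimately show ?thesis using that by blast
qed

section \<open>The Brunn--Minkowski inequality for finite unions of boxes\<close>

text \<open>The midpoints fill the box with averaged corners, whose side lengths are arithmetic
  means of those of the two boxes; the claim is the inequality of arithmetic and geometric means in
  each coordinate.\<close>

lemma brunn_minkowski_single_boxes:
  fixes a b c d :: "'a::euclidean_space"
  assumes ne: "box a b \<noteq> {}" "box c d \<noteq> {}"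
    and T: "T \<in> fmeasurable lborel" "midpoints (box a b) (box c d) \<subseteq> T"
  shows "sqrt (measure lborel (box a b) * measure lborel (box c d)) \<le> measure lborel T"
proof -
  have lt: "a \<bullet> k < b \<bullet> k" "c \<bullet> k < d \<bullet> k" if "k \<in> Basis" for k
    using ne that by (auto simp: box_ne_empty)
  let ?u = "(1/2) *\<^sub>R (a + c)" and ?v = "(1/2) *\<^sub>R (b + d)"
  have "box ?u ?v \<subseteq> midpoints (box a b) (box c d)"
  proof
    fix z assume z: "z \<in> box ?u ?v"
    \<comment> \<open>The relative position of \<open>z\<close> along axis \<open>k\<close>. The
      points at the same relative position in the two given boxes have \<open>z\<close> as their
      midpoint.\<close>
    define s where "s k = (z \<bullet> k - ?u \<bullet> k) / (?v \<bullet> k - ?u \<bullet> k)" for k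
    have den: "?v \<bullet> k - ?u \<bullet> k > 0" if "k \<in> Basis" for k
      using lt[OF that] by (simp add: inner_simps)
    have s: "0 < s k" "s k < 1" if "k \<in> Basis" for k
      using z that den[OF that] by (auto simp: s_def mem_box)
    define x where "x = (\<Sum>k\<in>Basis. (a \<bullet> k + s k * (b \<bullet> k - a \<bullet> k)) *\<^sub>R k)"
    define y where "y = (\<Sum>k\<in>Basis. (c \<bullet> k + s k * (d \<bullet> k - c \<bullet> k)) *\<^sub>R k)"
    have xk: "x \<bullet> k = a \<bullet> k + s k * (b \<bullet> k - a \<bullet> k)" and yk: "y \<bullet> k = c \<bullet> k + s k * (d \<bullet> k - c \<bullet> k)"
      if "k \<in> Basis" for k using that by (simp_all add: x_def y_def)
    have aux: "p < p + t * (q - p) \<and> p + t * (q - p) < q" if "0 < t" "t < 1" "p < q" for p q t :: real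
      using that mult_strict_right_mono[of t 1 "q - p"] by (auto simp: algebra_simps)
    have "x \<in> box a b" "y \<in> box c d"
      using aux s lt by (auto simp: mem_box xk yk)
    moreover have "z = (1/2) *\<^sub>R (x + y)"
    proof (rule euclidean_eqI)
      fix k :: 'a assume k: "k \<in> Basis"
      have "z \<bullet> k - ?u \<bullet> k = s k * (?v \<bullet> k - ?u \<bullet> k)" using den[OF k] by (simp add: s_def)
      then show "z \<bullet> k = (1/2) *\<^sub>R (x + y) \<bullet> k"
        by (simp add: inner_simps xk[OF k] yk[OF k] field_simps)
    qed
    ultimately show "z \<in> midpoints (box a b) (box c d)" by (auto simp: midpoints_def)
  qed
  then have sub: "box ?u ?v \<subseteq> T" using T by blast
  have "sqrt (measure lborel (box a b) * measure lborel (box c d))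
      = sqrt (\<Prod>k\<in>Basis. (b \<bullet> k - a \<bullet> k) * (d \<bullet> k - c \<bullet> k))"
    using lt by (simp add: measure_lborel_box_eq prod.distrib inner_diff_left less_imp_le)
  also have "\<dots> = (\<Prod>k\<in>Basis. sqrt ((b \<bullet> k - a \<bullet> k) * (d \<bullet> k - c \<bullet> k)))"
    by (induction rule: finite_induct[OF finite_Basis]) (simp_all add: real_sqrt_mult)
  also have "\<dots> \<le> (\<Prod>k\<in>Basis. ((b \<bullet> k - a \<bullet> k) + (d \<bullet> k - c \<bullet> k)) / 2)"
    using lt by (intro prod_mono conjI arith_geo_mean_sqrt) (auto intro: less_imp_le)
  also have "\<dots> = measure lborel (box ?u ?v)"
    proof -
    have "?u \<bullet> k \<le> ?v \<bullet> k" if "k \<in> Basis" for k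
      using lt[OF that] by (simp add: inner_simps)
    then show ?thesis
      by (simp add: measure_lborel_box_eq) (intro prod.cong, auto simp: inner_simps field_simps)
  qed
  also have "\<dots> \<le> measure lborel T"
    using sub T by (intro measure_mono_fmeasurable) auto
  finally show ?thesis .
qed

lemma box_familyD:
  assumes "box_family D"
  shows "open (\<Union>D)" "bounded (\<Union>D)" "\<Union>D \<in> fmeasurable lborel"
proof -
  show o: "open (\<Union>D)" using assms by (intro open_Union ballI) (auto simp: box_family_def)
  show b: "bounded (\<Union>D)" using assms by (intro bounded_Union ballI) (auto simp: box_family_def)
  show "\<Union>D \<in> fmeasurable lborel" using fmeasurable_bounded_open[OF o b] .
qed

lemma box_family_measure_pos:
  assumes "box_family D" "D \<noteq> {}"
  shows "measure lborel (\<Union>D) > 0"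
proof -
  obtain B a b where B: "B \<in> D" "B = box a b" "B \<noteq> {}" using assms unfolding box_family_def by (metis ex_in_conv)
  have "0 < measure lborel (box a b)"
    using B by (auto simp: measure_lborel_box_eq box_ne_empty inner_diff_left less_imp_le intro!: prod_pos)
  also have "\<dots> \<le> measure lborel (\<Union>D)"
    using B box_familyD(3)[OF assms(1)] by (intro measure_mono_fmeasurable) auto
  finally show ?thesis .
qed

text \<open>Hadwiger--Ohmann induction: cut one family by a hyperplane separating two of its boxes, and
  the other family by a parallel hyperplane in the same volume ratio.\<close>

lemma brunn_minkowski_boxes:
  fixes D E :: "'a::euclidean_space set set"
  assumes "box_family D" "box_family E" "D \<noteq> {}" "E \<noteq> {}"
    "T \<in> fmeasurable lborel" "midpoints (\<Union>D) (\<Union>E) \<subseteq> T"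
  shows "sqrt (measure lborel (\<Union>D) * measure lborel (\<Union>E)) \<le> measure lborel T"
  using assms
proof (induction "card D + card E" arbitrary: D E T rule: less_induct)
  case less
  \<comment> \<open>\<open>D'\<close> is whichever of the two families has at least two boxes; by
    symmetry of the claim \<open>step\<close> serves for (D, E) and for (E, D).\<close>
  have step: "sqrt (measure lborel (\<Union>D') * measure lborel (\<Union>E')) \<le> measure lborel T"
    if card: "card D' + card E' = card D + card E" and D': "box_family D'" "D' \<noteq> {}" and E': "box_family E'" "E' \<noteq> {}"
      and mid: "midpoints (\<Union>D') (\<Union>E') \<subseteq> T" and two: "B \<in> D'" "C \<in> D'" "B \<noteq> C" for D' E' B C
  proof -
    \<comment> \<open>\<open>C'\<close> disappears from the left half and \<open>B'\<close> from the
      right half, so both halves have fewer boxes in total. Neither \<open>B'\<close> nor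
      \<open>C'\<close> lies in the hyperplane, so neither half is empty.\<close>
    obtain i c B' C' where i: "i \<in> Basis" and BC: "B' \<in> D'" "C' \<in> D'" "B' \<inter> {x. x \<bullet> i > c} = {}" "C' \<inter> {x. x \<bullet> i < c} = {}"
      using disjoint_boxes_separated[OF D'(1) two] by metis
    define Dl where "Dl = (\<lambda>B. B \<inter> {x. x \<bullet> i < c}) ` D' - {{}}"
    define Dr where "Dr = (\<lambda>B. B \<inter> {x. x \<bullet> i > c}) ` D' - {{}}"
    note Dl = box_family_Int[OF D'(1) i, of "{x. x \<bullet> i < c}" c, folded Dl_def, OF disjI1[OF refl]]
    note Dr = box_family_Int[OF D'(1) i, of "{x. x \<bullet> i > c}" c, folded Dr_def, OF disjI2[OF refl]]
    have null: "B = {}" if "B \<in> D'" "B \<subseteq> {x. x \<bullet> i = c}" for B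
    proof (rule ccontr)
      assume "B \<noteq> {}"
      have "{B} \<subseteq> D'" using that by auto
      then have "box_family {B}" using D'(1) that(1) by (auto simp: box_family_def)
      then have "measure lborel B > 0" using box_family_measure_pos[of "{B}"] by auto
      moreover have "B \<in> sets borel" using box_familyD(3)[OF \<open>box_family {B}\<close>] by auto
      then have "B \<in> null_sets lborel" using null_sets_lborel_hyperplane[OF i, of c] that(2) 
        by (metis null_sets_subset sets_lborel)
      ultimately show False by (auto simp: null_sets_def measure_def)
    qed
    have ne0: "B' \<noteq> {}" "C' \<noteq> {}" using D'(1) BC by (auto simp: box_family_def)
    have "\<not> B' \<subseteq> {x. x \<bullet> i = c}" "\<not> C' \<subseteq> {x. x \<bullet> i = c}" using null BC ne0 by blast+
    then have ne: "Dl \<noteq> {}" "Dr \<noteq> {}"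
      proof -
      have "B' \<inter> {x. x \<bullet> i < c} \<noteq> {}" "C' \<inter> {x. x \<bullet> i > c} \<noteq> {}"
        using BC(3,4) \<open>\<not> B' \<subseteq> {x. x \<bullet> i = c}\<close> \<open>\<not> C' \<subseteq> {x. x \<bullet> i = c}\<close> by (auto simp: not_less_iff_gr_or_eq neq_iff)
      then show "Dl \<noteq> {}" "Dr \<noteq> {}" using BC(1,2) unfolding Dl_def Dr_def by blast+
    qed
    define p where "p = measure lborel (\<Union>D')"
    define q where "q = measure lborel (\<Union>E')"
    have p: "p > 0" and q: "q > 0" using box_family_measure_pos D' E' by (auto simp: p_def q_def)
    define t where "t = measure lborel (\<Union>Dl) / p"
    have split: "p = measure lborel (\<Union>Dl) + measure lborel (\<Union>Dr)"
      unfolding p_def Dl(2) Dr(2) by (rule measure_halfspace_split[OF box_familyD(3)[OF D'(1)] i])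
    have pos: "measure lborel (\<Union>Dl) > 0" "measure lborel (\<Union>Dr) > 0"
      using box_family_measure_pos Dl(1) Dr(1) ne by auto
    have t: "0 < t" "t < 1" and tl: "measure lborel (\<Union>Dl) = t * p" and tr: "measure lborel (\<Union>Dr) = (1 - t) * p"
      using split pos p by (auto simp: t_def field_simps)
    obtain d where d: "measure lborel (\<Union>E' \<inter> {x. x \<bullet> i < d}) = t * q" "measure lborel (\<Union>E' \<inter> {x. x \<bullet> i > d}) = (1 - t) * q"
      using measure_halfspace_ratio[of "\<Union>E'" i t] box_familyD[OF E'(1)] i t unfolding q_def by auto
    define El where "El = (\<lambda>B. B \<inter> {x. x \<bullet> i < d}) ` E' - {{}}"
    define Er where "Er = (\<lambda>B. B \<inter> {x. x \<bullet> i > d}) ` E' - {{}}"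
    note El = box_family_Int[OF E'(1) i, of "{x. x \<bullet> i < d}" d, folded El_def, OF disjI1[OF refl]]
    note Er = box_family_Int[OF E'(1) i, of "{x. x \<bullet> i > d}" d, folded Er_def, OF disjI2[OF refl]]
    have neE: "El \<noteq> {}" "Er \<noteq> {}"
      using d El(2) Er(2) t q by auto
    \<comment> \<open>A midpoint of points to the left of \<open>c\<close> and of \<open>d\<close>
      lies to the left of \<open>m\<close>, and likewise on the right. The two recursive bounds thus
      concern disjoint parts of \<open>T\<close>, and their right sides add up to the measure of
      \<open>T\<close>.\<close>
    define m where "m = (c + d) / 2"
    let ?Tl = "T \<inter> {x. x \<bullet> i < m}" and ?Tr = "T \<inter> {x. x \<bullet> i > m}"
    have Tf: "?Tl \<in> fmeasurable lborel" "?Tr \<in> fmeasurable lborel"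
      using less.prems(5) by (auto intro!: fmeasurable_Int_fmeasurable)
    have "midpoints (\<Union>Dl) (\<Union>El) \<subseteq> ?Tl"
    proof -
      have "midpoints (\<Union>Dl) (\<Union>El) \<subseteq> T" 
        using midpoints_mono[of "\<Union>Dl" "\<Union>D'" "\<Union>El" "\<Union>E'"] mid unfolding Dl(2) El(2) by blast
      moreover have "midpoints (\<Union>Dl) (\<Union>El) \<subseteq> {x. x \<bullet> i < m}"
        unfolding Dl(2) El(2) by (auto simp: midpoints_def m_def inner_simps)
      ultimately show ?thesis by blast
    qed
    moreover have "card Dl + card El < card D + card E"
      using Dl(4)[OF BC(2,4)] El(3) card by linarith
    ultimately have L: "sqrt (measure lborel (\<Union>Dl) * measure lborel (\<Union>El)) \<le> measure lborel ?Tl"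
      using less.hyps Dl(1) El(1) ne neE Tf by blast
    have "midpoints (\<Union>Dr) (\<Union>Er) \<subseteq> ?Tr"
    proof -
      have "midpoints (\<Union>Dr) (\<Union>Er) \<subseteq> T" 
        using midpoints_mono[of "\<Union>Dr" "\<Union>D'" "\<Union>Er" "\<Union>E'"] mid unfolding Dr(2) Er(2) by blast
      moreover have "midpoints (\<Union>Dr) (\<Union>Er) \<subseteq> {x. x \<bullet> i > m}"
        unfolding Dr(2) Er(2) by (auto simp: midpoints_def m_def inner_simps)
      ultimately show ?thesis by blast
    qed
    moreover have "card Dr + card Er < card D + card E"
      using Dr(4)[OF BC(1,3)] Er(3) card by linarith
    ultimately have R: "sqrt (measure lborel (\<Union>Dr) * measure lborel (\<Union>Er)) \<le> measure lborel ?Tr"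
      using less.hyps Dr(1) Er(1) ne neE Tf by blast
    \<comment> \<open>Here the equal volume ratio matters: the geometric mean is homogeneous, so the
      two halves contribute exactly the fractions \<open>t\<close> and \<open>1 - t\<close>.\<close>
    have "sqrt (p * q) = t * sqrt (p * q) + (1 - t) * sqrt (p * q)" by (simp add: algebra_simps)
    also have "t * sqrt (p * q) = sqrt ((t * p) * (t * q))"
      using t p q by (simp add: real_sqrt_mult)
    also have "(1 - t) * sqrt (p * q) = sqrt (((1 - t) * p) * ((1 - t) * q))"
      using t p q by (simp add: real_sqrt_mult)
    also have "sqrt ((t * p) * (t * q)) + sqrt (((1 - t) * p) * ((1 - t) * q)) \<le> measure lborel ?Tl + measure lborel ?Tr"
      using L R d tl tr El(2) Er(2) by simp
    also have "\<dots> = measure lborel T"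
      by (rule measure_halfspace_split[symmetric, OF less.prems(5) i])
    finally show ?thesis by (simp add: p_def q_def)
  qed
  consider (D) B C where "B \<in> D" "C \<in> D" "B \<noteq> C" | (E) B C where "B \<in> E" "C \<in> E" "B \<noteq> C"
    | (one) B C where "D = {B}" "E = {C}"
    using less.prems(3,4) by (metis insertCI is_singletonI' is_singleton_def)
  then show ?case
  proof cases
    case D
    then show ?thesis using step[of D E] less.prems by auto
  next
    case E
    then show ?thesis using step[of E D] less.prems by (auto simp: midpoints_commute mult.commute)
  next
    case one
    then have "B \<noteq> {} \<and> (\<exists>a b. B = box a b)" "C \<noteq> {} \<and> (\<exists>a b. C = box a b)"
      using less.prems(1,2) by (simp_all add: box_family_def)
    then obtain a b c d where "B = box a b" "B \<noteq> {}" "C = box c d" "C \<noteq> {}" by metis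
    with one show ?thesis using less.prems(5,6) brunn_minkowski_single_boxes[of a b c d T] by simp
  qed
qed

text \<open>Inner regularity gives a compact \<open>K\<close> inside \<open>S\<close>, and finitely
  many boxes inside \<open>S\<close> cover it. A division of their union turns into a disjoint
  family when only the interiors of its cells are kept, which loses null faces only.\<close>

lemma box_family_inner_approx:
  fixes S :: "'a::euclidean_space set"
  assumes S: "open S" "bounded S" and e: "e > 0"
  obtains D where "box_family D" "\<Union>D \<subseteq> S" "measure lborel S - e < measure lborel (\<Union>D)"
proof -
  have Sf: "S \<in> fmeasurable lborel" using fmeasurable_bounded_open S by blast
  have "S \<in> sets lebesgue" using S(1) by auto
  then obtain K where K: "closed K" "K \<subseteq> S" "emeasure lebesgue (S - K) < e"
    using sets_lebesgue_inner_closed[OF \<open>S \<in> sets lebesgue\<close> e] by metis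
  have "compact K" using K S by (meson bounded_subset compact_eq_bounded_closed)
  have Kf: "K \<in> fmeasurable lborel" using fmeasurable_compact[OF \<open>compact K\<close>] .
  have "measure lborel S - measure lborel K = measure lborel (S - K)"
    using Sf Kf K by (intro measure_Diff[symmetric]) (auto simp: fmeasurable_def)
  also have "\<dots> < e"
  proof -
    have "S - K \<in> sets lborel" using Sf Kf by (intro sets.Diff fmeasurableD)
    then have "emeasure lborel (S - K) < ennreal e" using K(3) by simp
    then show ?thesis
      using ennreal_less_iff[of "measure lborel (S - K)" e] emeasure_eq_ennreal_measure[of lborel "S - K"] by force
  qed
  finally have mK: "measure lborel S - e < measure lborel K" by simp
  have "\<forall>x\<in>K. \<exists>a b. cbox a b \<subseteq> S \<and> x \<in> box a b"
    proof
    fix x assume "x \<in> K"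
    then obtain a b where "cbox a b \<subseteq> S" "x \<in> box a b"
      using open_contains_cbox[OF S(1) subsetD[OF K(2) \<open>x \<in> K\<close>]] by metis
    then show "\<exists>a b. cbox a b \<subseteq> S \<and> x \<in> box a b" by blast
  qed
  then obtain u v where uv: "\<And>x. x \<in> K \<Longrightarrow> cbox (u x) (v x) \<subseteq> S \<and> x \<in> box (u x) (v x)"
    by metis
  have "K \<subseteq> (\<Union>x\<in>K. box (u x) (v x))" using uv by blast
  then obtain F where F: "F \<subseteq> K" "finite F" "K \<subseteq> (\<Union>x\<in>F. box (u x) (v x))"
    using compactE_image[OF \<open>compact K\<close>, of K "\<lambda>x. box (u x) (v x)"] by (metis open_box)
  obtain p where p: "p division_of (\<Union>((\<lambda>x. cbox (u x) (v x)) ` F))"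
    using elementary_unions_intervals[of "(\<lambda>x. cbox (u x) (v x)) ` F"] F(2) by blast
  define D where "D = interior ` p - {{}}"
  have fin: "finite p" using p by blast
  have pb: "\<exists>a b. k = cbox a b" if "k \<in> p" for k using p that by blast
  have D: "box_family D" unfolding box_family_def D_def
  proof (intro conjI ballI)
    show "disjoint (interior ` p - {{}})"
      using division_ofD(5)[OF p] unfolding disjoint_def by auto
  next
    fix B assume "B \<in> interior ` p - {{}}"
    then show "\<exists>a b. B = box a b" using pb by (metis DiffD1 image_iff interior_cbox)
  qed (use fin in auto)
  have "\<Union>D \<subseteq> \<Union>p" unfolding D_def using interior_subset by blast
  also have "\<Union>p \<subseteq> S" using division_ofD(6)[OF p] F(1) uv by blast
  finally have "\<Union>D \<subseteq> S" .
  have kf: "k \<in> fmeasurable lborel" if "k \<in> p" for k using pb[OF that] fmeasurable_cbox by metis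
  have "measure lborel K \<le> measure lborel (\<Union>p)"
  proof (intro measure_mono_fmeasurable)
    show "K \<subseteq> \<Union>p" using F(3) box_subset_cbox division_ofD(6)[OF p] by blast
    show "K \<in> sets lborel" using Kf by auto
    show "\<Union>p \<in> fmeasurable lborel" using kf fin by (intro fmeasurable.finite_Union) auto
  qed
  also have "\<dots> \<le> (\<Sum>k\<in>p. measure lborel k)"
    using measure_UNION_le[of p "\<lambda>k. k" lborel] fin fmeasurableD[OF kf] by simp
  also have "\<dots> = (\<Sum>k\<in>p. measure lborel (interior k))"
  proof (intro sum.cong refl)
    fix k assume "k \<in> p"
    then obtain a b where "k = cbox a b" using pb by blast
    then show "measure lborel k = measure lborel (interior k)" 
      by (simp add: interior_cbox measure_lborel_cbox_eq measure_lborel_box_eq)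
  qed
  also have "\<dots> = measure lborel (\<Union>k\<in>p. interior k)"
  proof (intro measure_UNION_AE[symmetric] fin)
    show "interior k \<in> fmeasurable lborel" if "k \<in> p" for k
      using pb[OF that] by (metis D box_familyD(3) fmeasurable_bounded_open interior_cbox bounded_box open_box)
    show "pairwise (\<lambda>i j. AE x in lborel. x \<notin> interior i \<or> x \<notin> interior j) p"
      using division_ofD(5)[OF p] unfolding pairwise_def by (intro ballI impI AE_I2) blast
  qed
  also have "(\<Union>k\<in>p. interior k) = \<Union>D" by (auto simp: D_def)
  finally have "measure lborel S - e < measure lborel (\<Union>D)" using mK by linarith
  with D \<open>\<Union>D \<subseteq> S\<close> show ?thesis using that by blast
qed

text \<open>\<open>T\<close> stays fixed while both sets are exhausted from inside by box families,
  so only the left side has to pass to the limit.\<close>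

lemma brunn_minkowski_open:
  fixes A B :: "'a::euclidean_space set"
  assumes A: "open A" "bounded A" "A \<noteq> {}" and B: "open B" "bounded B" "B \<noteq> {}"
    and T: "T \<in> fmeasurable lborel" "midpoints A B \<subseteq> T"
  shows "sqrt (measure lborel A * measure lborel B) \<le> measure lborel T"
proof -
  have approx: "\<exists>D. \<forall>n. box_family (D n) \<and> \<Union>(D n) \<subseteq> S \<and> measure lborel S - inverse (real (Suc n)) < measure lborel (\<Union>(D n))"
    if "open S" "bounded S" for S :: "'a set"
    using box_family_inner_approx[OF that] by (intro choice allI) (metis inverse_positive_iff_positive of_nat_0_less_iff zero_less_Suc)
  have lim: "(\<lambda>n. measure lborel (\<Union>(D n))) \<longlonglongrightarrow> measure lborel S"
    if "open S" "bounded S" "\<forall>n. box_family (D n) \<and> \<Union>(D n) \<subseteq> S \<and> measure lborel S - inverse (real (Suc n)) < measure lborel (\<Union>(D n))"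
    for S :: "'a set" and D
  proof (rule tendsto_sandwich[of "\<lambda>n. measure lborel S - inverse (real (Suc n))" _ _ "\<lambda>n. measure lborel S"])
    show "(\<lambda>n. measure lborel S - inverse (real (Suc n))) \<longlonglongrightarrow> measure lborel S"
      using tendsto_diff[OF tendsto_const LIMSEQ_inverse_real_of_nat] by simp
    have "measure lborel (\<Union>(D n)) \<le> measure lborel S" for n
      using that fmeasurable_bounded_open[of S] box_familyD(3)[of "D n"] by (intro measure_mono_fmeasurable) auto
    then show "\<forall>\<^sub>F n in sequentially. measure lborel (\<Union>(D n)) \<le> measure lborel S" by simp
  qed (use that in \<open>auto intro!: always_eventually less_imp_le\<close>)
  obtain D where D: "\<forall>n. box_family (D n) \<and> \<Union>(D n) \<subseteq> A \<and> measure lborel A - inverse (real (Suc n)) < measure lborel (\<Union>(D n))"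
    using approx A by blast
  obtain E where E: "\<forall>n. box_family (E n) \<and> \<Union>(E n) \<subseteq> B \<and> measure lborel B - inverse (real (Suc n)) < measure lborel (\<Union>(E n))"
    using approx B by blast
  \<comment> \<open>An approximating family can be empty as long as its tolerance exceeds the
    measure; the left side is then 0.\<close>
  have "sqrt (measure lborel (\<Union>(D n)) * measure lborel (\<Union>(E n))) \<le> measure lborel T" for n
  proof (cases "D n = {} \<or> E n = {}")
    case True then show ?thesis by auto
  next
    case False
    then show ?thesis 
      using brunn_minkowski_boxes[of "D n" "E n" T] D E T midpoints_mono[of "\<Union>(D n)" A "\<Union>(E n)" B] by blast
  qed
  then show ?thesis
    by (intro LIMSEQ_le_const2[OF tendsto_real_sqrt[OF tendsto_mult[OF lim[OF A(1,2) D] lim[OF B(1,2) E]]]]) auto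
qed

lemma emeasure_lborel_uminus_image:
  fixes A :: "'a::euclidean_space set"
  assumes "A \<in> sets borel"
  shows "emeasure lborel (uminus ` A) = emeasure lborel A"
proof -
  have *: "(lborel :: 'a measure) = distr lborel borel uminus"
    using lborel_affine[of "-1 :: real" "0 :: 'a"] by (simp add: density_1 one_ennreal_def[symmetric])
  have "emeasure lborel (uminus ` A) = emeasure (distr lborel borel uminus) (uminus ` A)" using * by simp
  also have "\<dots> = emeasure lborel (uminus -` (uminus ` A))"
  proof -
    have "uminus ` A = uminus -` A" by force
    then have "uminus ` A \<in> sets borel" using assms measurable_sets[of uminus borel borel A] by auto
    then show ?thesis by (subst emeasure_distr) auto
  qed
  also have "uminus -` (uminus ` A) = A" by force
  finally show ?thesis .
qed

text \<open>The midpoints of S and -S lie in a centred ball of half the diameter.\<close>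

theorem isodiametric:
  fixes S :: "'a::euclidean_space set"
  assumes b: "bounded S" and d: "diameter S \<le> d" and S: "S \<in> sets borel"
  shows "emeasure lborel S \<le> ennreal (unit_ball_vol (real DIM('a)) * (d / 2) ^ DIM('a))"
proof (cases "S = {}")
  case False
  have d0: "0 \<le> d" using d b diameter_ge_0 order_trans by blast
  have dist: "dist x y \<le> d" if "x \<in> S" "y \<in> S" for x y
    using diameter_bounded_bound[OF b that] d by linarith
  have main: "measure lborel S \<le> unit_ball_vol (real DIM('a)) * (d / 2 + e) ^ DIM('a)" if e: "e > 0" for e
  proof -
    \<comment> \<open>The \<open>e\<close>-neighbourhood replaces \<open>S\<close> by an open set of
      diameter at most \<open>d + 2 * e\<close>. Both it and its reflection have the same measure,
      so the geometric mean is the measure of \<open>A\<close>.\<close>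
    define A where "A = (\<Union>x\<in>S. ball x e)"
    define B where "B = uminus ` A"
    obtain R where R: "S \<subseteq> cball 0 R" using b by (metis bounded_pos mem_cball_0 subsetI)
    have A: "open A" "bounded A" "A \<noteq> {}" "S \<subseteq> A"
    proof -
      have "A \<subseteq> cball 0 (R + e)"
      proof
        fix y assume "y \<in> A"
        then obtain x where "x \<in> S" "dist x y < e" by (auto simp: A_def)
        then show "y \<in> cball 0 (R + e)" using R dist_triangle[of 0 y x] by (force simp: subset_iff)
      qed
      then show "bounded A" by (meson bounded_cball bounded_subset)
    qed (use False e in \<open>auto simp: A_def\<close>)
    have B: "open B" "bounded B" "B \<noteq> {}"
      using A by (auto simp: B_def open_negations)
    have mid: "midpoints A B \<subseteq> cball 0 (d / 2 + e)"
    proof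
      fix z assume "z \<in> midpoints A B"
      then obtain x y where z: "z = (1/2) *\<^sub>R (x - y)" and xy: "x \<in> A" "y \<in> A"
        by (auto simp: midpoints_def B_def)
      then obtain x' y' where "x' \<in> S" "y' \<in> S" "dist x' x < e" "dist y' y < e" by (auto simp: A_def)
      then have "dist x y \<le> d + 2 * e"
        using dist[of x' y'] dist_triangle[of x y x'] dist_triangle[of x' y y'] by (simp add: dist_commute)
      then show "z \<in> cball 0 (d / 2 + e)" by (simp add: z dist_norm)
    qed
    have fA: "A \<in> fmeasurable lborel" "A \<in> sets borel" using fmeasurable_bounded_open A by auto
    have "measure lborel S \<le> measure lborel A"
      using A(4) S fA by (intro measure_mono_fmeasurable) auto
    also have "\<dots> = sqrt (measure lborel A * measure lborel B)"
      using emeasure_lborel_uminus_image[of A] fA by (simp add: B_def measure_def)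
    also have "\<dots> \<le> measure lborel (cball (0::'a) (d / 2 + e))"
      using brunn_minkowski_open[OF A(1-3) B _ mid] fmeasurable_compact[OF compact_cball] by blast
    also have "\<dots> = unit_ball_vol (real DIM('a)) * (d / 2 + e) ^ DIM('a)"
      using d0 e by (simp add: content_cball)
    finally show ?thesis .
  qed
  have "measure lborel S \<le> unit_ball_vol (real DIM('a)) * (d / 2 + 0) ^ DIM('a)"
  proof (rule tendsto_lowerbound[OF _ eventually_at_rightI[of 0 1]])
    show "((\<lambda>e. unit_ball_vol (real DIM('a)) * (d / 2 + e) ^ DIM('a)) \<longlongrightarrow> unit_ball_vol (real DIM('a)) * (d / 2 + 0) ^ DIM('a)) (at_right 0)"
      by (intro tendsto_intros)
  qed (use main in auto)
  moreover have "emeasure lborel S = ennreal (measure lborel S)"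
    using emeasure_bounded_finite[OF b] by (intro emeasure_eq_ennreal_measure) auto
  ultimately show ?thesis by (simp add: ennreal_leI)
qed auto

section \<open>Hausdorff measure\<close>

lemma diameter_le_dist:
  fixes S :: "'a::metric_space set"
  assumes "0 \<le> d" "\<And>x y. x \<in> S \<Longrightarrow> y \<in> S \<Longrightarrow> dist x y \<le> d"
  shows "diameter S \<le> d"
  unfolding diameter_def using assms by (auto intro!: cSUP_least)

text \<open>The volume of a ball with the diameter of \<open>C\<close>. Since
  \<open>0 powr s = 0\<close> for every \<open>s\<close>, the empty set costs nothing and may pad a
  sequence of covering sets.\<close>

definition ball_gauge :: "real \<Rightarrow> 'a::metric_space set \<Rightarrow> ennreal" where
  "ball_gauge s C = ennreal (unit_ball_vol s * (diameter C / 2) powr s)"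

lemma ball_gauge_empty [simp]: "ball_gauge s {} = 0"
  by (simp add: ball_gauge_def)

lemma ball_gauge_le:
  assumes "0 \<le> s" "diameter C \<le> d" "bounded C"
  shows "ball_gauge s C \<le> ennreal (unit_ball_vol s * (d / 2) powr s)"
  unfolding ball_gauge_def using assms diameter_ge_0[of C]
  by (intro ennreal_leI mult_left_mono powr_mono2) auto

definition fine_cover :: "real \<Rightarrow> 'a::metric_space set \<Rightarrow> (nat \<Rightarrow> 'a set) \<Rightarrow> bool" where
  "fine_cover \<delta> A C \<longleftrightarrow> A \<subseteq> (\<Union>i. C i) \<and> (\<forall>i. bounded (C i) \<and> diameter (C i) \<le> \<delta>)"

lemma hausdorff_pre_alt: "hausdorff_pre s \<delta> A = (INF C \<in> Collect (fine_cover \<delta> A). \<Sum>i. ball_gauge s (C i))"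
  unfolding hausdorff_pre_def fine_cover_def ball_gauge_def by simp

lemma hausdorff_pre_le: "fine_cover \<delta> A C \<Longrightarrow> hausdorff_pre s \<delta> A \<le> (\<Sum>i. ball_gauge s (C i))"
  unfolding hausdorff_pre_alt by (rule INF_lower) simp

lemma hausdorff_pre_ge: "(\<And>C. fine_cover \<delta> A C \<Longrightarrow> x \<le> (\<Sum>i. ball_gauge s (C i))) \<Longrightarrow> x \<le> hausdorff_pre s \<delta> A"
  unfolding hausdorff_pre_alt by (rule INF_greatest) simp

lemma hausdorff_pre_mono: "A \<subseteq> B \<Longrightarrow> hausdorff_pre s \<delta> A \<le> hausdorff_pre s \<delta> B"
  unfolding hausdorff_pre_alt by (intro INF_superset_mono) (auto simp: fine_cover_def subset_iff)

lemma hausdorff_pre_antimono: "\<delta> \<le> \<delta>' \<Longrightarrow> hausdorff_pre s \<delta>' A \<le> hausdorff_pre s \<delta> A"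
  unfolding hausdorff_pre_alt by (intro INF_superset_mono) (auto simp: fine_cover_def, meson order_trans)

lemma hausdorff_pre_single:
  assumes "0 \<le> \<delta>" "bounded C" "diameter C \<le> \<delta>"
  shows "hausdorff_pre s \<delta> C \<le> ball_gauge s C"
proof -
  have "hausdorff_pre s \<delta> C \<le> (\<Sum>i. ball_gauge s (if i = (0::nat) then C else {}))"
    using assms by (intro hausdorff_pre_le) (auto simp: fine_cover_def)
  also have "\<dots> = (\<Sum>i\<in>{0}. ball_gauge s (if i = (0::nat) then C else {}))"
    by (intro suminf_finite) auto
  finally show ?thesis by simp
qed

lemma hausdorff_pre_empty: "0 \<le> \<delta> \<Longrightarrow> hausdorff_pre s \<delta> {} = 0"
  using hausdorff_pre_single[of \<delta> "{}" s] by simp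

lemma hausdorff_pre_UN:
  fixes A :: "nat \<Rightarrow> 'a::metric_space set"
  shows "hausdorff_pre s \<delta> (\<Union>n. A n) \<le> (\<Sum>n. hausdorff_pre s \<delta> (A n))"
proof (cases "(\<Sum>n. hausdorff_pre s \<delta> (A n)) = top")
  case False
  then have fin: "hausdorff_pre s \<delta> (A n) < top" for n
    by (metis ennreal_suminf_lessD top.not_eq_extremum)
  show ?thesis
  proof (rule ennreal_le_epsilon)
    fix e :: real assume e: "e > 0"
    have "\<exists>C. fine_cover \<delta> (A n) C \<and> (\<Sum>i. ball_gauge s (C i)) < hausdorff_pre s \<delta> (A n) + ennreal (e * (1/2)^Suc n)" for n
    proof -
      have "hausdorff_pre s \<delta> (A n) < hausdorff_pre s \<delta> (A n) + ennreal (e * (1/2)^Suc n)"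
        using fin[of n] e by (simp add: ennreal_add_left_cancel_less add.commute[of _ "ennreal _"] ennreal_less_zero_iff) 
      then show ?thesis unfolding hausdorff_pre_alt[of s \<delta> "A n"] INF_less_iff by auto
    qed
    then obtain C where C: "\<And>n. fine_cover \<delta> (A n) (C n)" 
      "\<And>n. (\<Sum>i. ball_gauge s (C n i)) < hausdorff_pre s \<delta> (A n) + ennreal (e * (1/2)^Suc n)"
      by metis
    define D where "D k = (case prod_decode k of (n, i) \<Rightarrow> C n i)" for k
    have "fine_cover \<delta> (\<Union>n. A n) D"
      unfolding fine_cover_def
    proof (intro conjI allI)
      show "(\<Union>n. A n) \<subseteq> (\<Union>k. D k)"
      proof
        fix x assume "x \<in> (\<Union>n. A n)"
        then obtain n i where "x \<in> C n i" using C(1) by (auto simp: fine_cover_def) blast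
        then have "x \<in> D (prod_encode (n, i))" by (simp add: D_def)
        then show "x \<in> (\<Union>k. D k)" by blast
      qed
    qed (use C(1) in \<open>auto simp: D_def fine_cover_def split: prod.split\<close>)
    then have "hausdorff_pre s \<delta> (\<Union>n. A n) \<le> (\<Sum>k. ball_gauge s (D k))" by (rule hausdorff_pre_le)
    also have "\<dots> = (\<Sum>k. (\<lambda>(n,i). ball_gauge s (C n i)) (prod_decode k))"
      by (simp add: D_def case_prod_beta)
    also have "\<dots> = (\<Sum>n. \<Sum>i. ball_gauge s (C n i))"
      by (rule suminf_ennreal_2dimen) simp
    also have "\<dots> \<le> (\<Sum>n. hausdorff_pre s \<delta> (A n) + ennreal (e * (1/2)^Suc n))"
      by (intro suminf_le less_imp_le C(2)) auto
    also have "\<dots> = (\<Sum>n. hausdorff_pre s \<delta> (A n)) + (\<Sum>n. ennreal (e * (1/2)^Suc n))"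
      by (rule suminf_add[symmetric]) auto
    also have "(\<Sum>n. ennreal (e * (1/2)^Suc n)) = ennreal e"
      using sums_mult[OF power_half_series, of e] e by (intro suminf_ennreal_eq) auto
    finally show "hausdorff_pre s \<delta> (\<Union>n. A n) \<le> (\<Sum>n. hausdorff_pre s \<delta> (A n)) + ennreal e" .
  qed
qed simp

lemma hausdorff_pre_le_outer: "0 < \<delta> \<Longrightarrow> hausdorff_pre s \<delta> A \<le> hausdorff_outer s A"
  unfolding hausdorff_outer_def by (rule SUP_upper) simp

lemma hausdorff_outer_mono: "A \<subseteq> B \<Longrightarrow> hausdorff_outer s A \<le> hausdorff_outer s B"
  unfolding hausdorff_outer_def by (intro SUP_mono) (auto intro: hausdorff_pre_mono)

lemma hausdorff_outer_empty [simp]: "hausdorff_outer s {} = 0"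
  unfolding hausdorff_outer_def by (simp add: hausdorff_pre_empty)

lemma hausdorff_outer_UN:
  fixes A :: "nat \<Rightarrow> 'a::metric_space set"
  shows "hausdorff_outer s (\<Union>n. A n) \<le> (\<Sum>n. hausdorff_outer s (A n))"
  unfolding hausdorff_outer_def[of s "\<Union>n. A n"]
proof (rule SUP_least)
  fix \<delta> :: real assume "\<delta> \<in> {0<..}"
  then show "hausdorff_pre s \<delta> (\<Union>n. A n) \<le> (\<Sum>n. hausdorff_outer s (A n))"
    by (intro order_trans[OF hausdorff_pre_UN] suminf_le hausdorff_pre_le_outer) auto
qed

lemma hausdorff_outer_Un: "hausdorff_outer s (A \<union> B) \<le> hausdorff_outer s A + hausdorff_outer s B"
proof -
  define D where "D n = (if n = 0 then A else if n = 1 then B else {})" for n :: nat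
  have "A \<union> B \<subseteq> (\<Union>n. D n)" unfolding D_def by (auto split: if_splits intro: exI[of _ "0::nat"] exI[of _ "1::nat"])
  then have "hausdorff_outer s (A \<union> B) \<le> hausdorff_outer s (\<Union>n. D n)" by (rule hausdorff_outer_mono)
  also have "\<dots> \<le> (\<Sum>n. hausdorff_outer s (D n))" by (rule hausdorff_outer_UN)
  also have "\<dots> = (\<Sum>n\<in>{..<2}. hausdorff_outer s (D n))"
    by (intro suminf_finite) (auto simp: D_def)
  also have "\<dots> = hausdorff_outer s A + hausdorff_outer s B" by (simp add: D_def numeral_2_eq_2)
  finally show ?thesis .
qed

section \<open>Measurability of Borel sets\<close>

text \<open>A set of diameter less than \<open>e\<close> cannot meet both \<open>A\<close> and
  \<open>B\<close>. A sufficiently fine cover of the union therefore splits into a cover of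
  \<open>A\<close> and one of \<open>B\<close>, each member being charged at most once.\<close>

lemma hausdorff_outer_separated:
  fixes A B :: "'a::metric_space set"
  assumes e: "e > 0" and sep: "\<And>x y. x \<in> A \<Longrightarrow> y \<in> B \<Longrightarrow> e \<le> dist x y"
  shows "hausdorff_outer s A + hausdorff_outer s B \<le> hausdorff_outer s (A \<union> B)"
proof -
  have pre: "hausdorff_pre s \<delta> A + hausdorff_pre s \<delta> B \<le> hausdorff_pre s \<delta> (A \<union> B)" if d: "0 < \<delta>" "\<delta> < e" for \<delta>
  proof (rule hausdorff_pre_ge)
    fix C assume C: "fine_cover \<delta> (A \<union> B) C"
    define CA where "CA i = (if C i \<inter> A = {} then {} else C i)" for i
    define CB where "CB i = (if C i \<inter> B = {} then {} else C i)" for i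
    have fA: "fine_cover \<delta> A CA" and fB: "fine_cover \<delta> B CB"
      using C d unfolding fine_cover_def CA_def CB_def by (auto simp: subset_iff) (metis disjoint_iff)+
    have "C i \<inter> A = {} \<or> C i \<inter> B = {}" for i
    proof (rule ccontr)
      assume "\<not> ?thesis"
      then obtain x y where xy: "x \<in> C i" "y \<in> C i" "x \<in> A" "y \<in> B" by blast
      have "dist x y \<le> diameter (C i)" using C xy by (intro diameter_bounded_bound) (auto simp: fine_cover_def)
      also have "\<dots> \<le> \<delta>" using C by (auto simp: fine_cover_def)
      finally show False using sep[OF xy(3,4)] d by linarith
    qed
    then have le: "ball_gauge s (CA i) + ball_gauge s (CB i) \<le> ball_gauge s (C i)" for i
      by (auto simp: CA_def CB_def)
    have "hausdorff_pre s \<delta> A + hausdorff_pre s \<delta> B \<le> (\<Sum>i. ball_gauge s (CA i)) + (\<Sum>i. ball_gauge s (CB i))"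
      by (intro add_mono hausdorff_pre_le fA fB)
    also have "\<dots> = (\<Sum>i. ball_gauge s (CA i) + ball_gauge s (CB i))"
      by (rule suminf_add) auto
    also have "\<dots> \<le> (\<Sum>i. ball_gauge s (C i))"
      by (intro suminf_le le) auto
    finally show "hausdorff_pre s \<delta> A + hausdorff_pre s \<delta> B \<le> (\<Sum>i. ball_gauge s (C i))" .
  qed
  have "hausdorff_outer s A + hausdorff_outer s B = (SUP \<delta>\<in>{0<..}. hausdorff_pre s \<delta> A + hausdorff_outer s B)"
    unfolding hausdorff_outer_def[of s A] by (subst ennreal_SUP_add_left) auto
  also have "\<dots> = (SUP \<delta>\<in>{0<..}. SUP \<delta>'\<in>{0<..}. hausdorff_pre s \<delta> A + hausdorff_pre s \<delta>' B)"
    unfolding hausdorff_outer_def[of s B] by (subst ennreal_SUP_add_right) auto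
  also have "\<dots> \<le> hausdorff_outer s (A \<union> B)"
  proof (intro SUP_least)
    fix d1 d2 :: real assume d: "d1 \<in> {0<..}" "d2 \<in> {0<..}"
    \<comment> \<open>A common mesh for both suprema; \<open>e / 2\<close> keeps it strictly below
      the separation.\<close>
    define \<delta> where "\<delta> = min (min d1 d2) (e / 2)"
    have \<delta>: "0 < \<delta>" "\<delta> < e" "\<delta> \<le> d1" "\<delta> \<le> d2" using d e by (auto simp: \<delta>_def)
    have "hausdorff_pre s d1 A + hausdorff_pre s d2 B \<le> hausdorff_pre s \<delta> A + hausdorff_pre s \<delta> B"
      using \<delta> by (intro add_mono hausdorff_pre_antimono)
    also have "\<dots> \<le> hausdorff_outer s (A \<union> B)"
      by (rule order_trans[OF pre[OF \<delta>(1,2)] hausdorff_pre_le_outer[OF \<delta>(1)]])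
    finally show "hausdorff_pre s d1 A + hausdorff_pre s d2 B \<le> hausdorff_outer s (A \<union> B)" .
  qed
  finally show ?thesis .
qed

text \<open>The shells around a closed set at distance between
  1/(k+2) and 1/(k+1) are pairwise separated unless adjacent, so their measures are summable.\<close>

lemma hausdorff_outer_closed_split:
  fixes F E :: "'a::metric_space set"
  assumes F: "closed F" "F \<noteq> {}" and fin: "hausdorff_outer s E < top"
  shows "hausdorff_outer s (E \<inter> F) + hausdorff_outer s (E - F) \<le> hausdorff_outer s E"
proof -
  let ?H = "hausdorff_outer s"
  define G where "G n = {x\<in>E. inverse (real (Suc n)) \<le> infdist x F}" for n
  define R where "R k = {x\<in>E. inverse (real (Suc (Suc k))) \<le> infdist x F \<and> infdist x F < inverse (real (Suc k))}" for k
  have le: "?H X \<le> ?H E" if "X \<subseteq> E" for X using that by (rule hausdorff_outer_mono)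
  have invlt: "inverse (real (Suc j)) < inverse (real (Suc i))" if "i < j" for i j
    using that by simp
  have far: "inverse (real (Suc i)) - inverse (real (Suc j)) \<le> dist x y" 
    if "inverse (real (Suc i)) \<le> infdist x F" "infdist y F < inverse (real (Suc j))" for x y i j
    using infdist_triangle[of x F y] that by (simp add: dist_commute)
  \<comment> \<open>The sum runs over the even shells for \<open>p = 0\<close> and over the odd ones
    for \<open>p = 1\<close>. Within one parity a whole shell lies between any two members, so
    additivity for separated sets applies.\<close>
  have sumR: "(\<Sum>k<n. ?H (R (2 * k + p))) \<le> ?H (\<Union>k<n. R (2 * k + p))" for n p
  proof (induction n)
    case (Suc n)
    have "(\<Sum>k<Suc n. ?H (R (2 * k + p))) \<le> ?H (\<Union>k<n. R (2 * k + p)) + ?H (R (2 * n + p))"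
      using Suc by (simp add: add_right_mono)
    also have "\<dots> \<le> ?H ((\<Union>k<n. R (2 * k + p)) \<union> R (2 * n + p))"
    \<comment> \<open>For \<open>n = 0\<close> the union is empty. Otherwise
      \<open>2 * n + p - 1\<close> is a genuine subtraction and indexes the shell between the new
      one and all earlier ones.\<close>
    proof (cases "n = 0")
      case False
      show ?thesis
      proof (rule hausdorff_outer_separated)
        show "0 < inverse (real (Suc (2 * n + p - 1))) - inverse (real (Suc (2 * n + p)))"
          using invlt[of "2 * n + p - 1" "2 * n + p"] False by simp
        fix x y assume "x \<in> (\<Union>k<n. R (2 * k + p))" "y \<in> R (2 * n + p)"
        then obtain k where k: "k < n" "x \<in> R (2 * k + p)" by blast
        have "inverse (real (Suc (2 * n + p - 1))) \<le> inverse (real (Suc (Suc (2 * k + p))))"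
          using k(1) by (intro le_imp_inverse_le) auto
        also have "\<dots> \<le> infdist x F" using k(2) by (simp add: R_def)
        finally have "inverse (real (Suc (2 * n + p - 1))) \<le> infdist x F" .
        moreover have "infdist y F < inverse (real (Suc (2 * n + p)))" using \<open>y \<in> R (2 * n + p)\<close> by (auto simp: R_def)
        ultimately show "inverse (real (Suc (2 * n + p - 1))) - inverse (real (Suc (2 * n + p))) \<le> dist x y"
          by (rule far)
      qed
    qed simp
    also have "(\<Union>k<n. R (2 * k + p)) \<union> R (2 * n + p) = (\<Union>k<Suc n. R (2 * k + p))"
      by (auto simp: lessThan_Suc)
    finally show ?case .
  qed simp
  have sumE: "(\<Sum>k. ?H (R (2 * k + p))) \<le> ?H E" for p
    by (intro suminf_le_const summableI order_trans[OF sumR] le) (auto simp: R_def)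
  define r where "r k = enn2real (?H (R k))" for k
  have Rfin: "?H (R k) < top" for k using le[of "R k"] fin by (auto simp: R_def intro: le_less_trans)
  have r: "?H (R k) = ennreal (r k)" "r k \<ge> 0" for k using Rfin[of k] by (simp_all add: r_def)
  obtain c where c: "?H E = ennreal c" "c \<ge> 0" using fin by (cases "?H E") auto
  have "summable (\<lambda>k. r (2 * k + p))" for p
  proof (rule summableI_nonneg_bounded)
    fix n
    have "ennreal (\<Sum>k<n. r (2 * k + p)) = (\<Sum>k<n. ?H (R (2 * k + p)))" by (simp add: r)
    also have "\<dots> \<le> (\<Sum>k. ?H (R (2 * k + p)))" by (intro sum_le_suminf) auto
    also have "\<dots> \<le> ennreal c" using sumE c by simp
    finally show "(\<Sum>k<n. r (2 * k + p)) \<le> c" using c by (simp add: ennreal_le_iff)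
  qed (use r in auto)
  note this[of 0] this[of 1]
  then have "summable r"
  proof -
    assume s: "summable (\<lambda>k. r (2 * k + 0))" "summable (\<lambda>k. r (2 * k + 1))"
    show ?thesis
    proof (rule summableI_nonneg_bounded)
      fix n
      have "(\<Sum>k<n. r k) \<le> (\<Sum>k<2*n. r k)" using r by (intro sum_mono2) auto
      also have "\<dots> = (\<Sum>k<n. r (2 * k + 0)) + (\<Sum>k<n. r (2 * k + 1))"
        by (induction n) (auto simp: algebra_simps)
      also have "\<dots> \<le> (\<Sum>k. r (2 * k + 0)) + (\<Sum>k. r (2 * k + 1))"
        using r s by (intro add_mono sum_le_suminf) auto
      finally show "(\<Sum>k<n. r k) \<le> (\<Sum>k. r (2 * k + 0)) + (\<Sum>k. r (2 * k + 1))" .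
    qed (use r in auto)
  qed
  show ?thesis
  proof (rule ennreal_le_epsilon)
    fix e :: real assume e: "e > 0"
    obtain N where N: "norm (\<Sum>k. r (k + N)) < e"
      using suminf_exist_split[OF e \<open>summable r\<close>] by blast
    have sub: "E - F \<subseteq> G N \<union> (\<Union>k. R (k + N))"
    proof
      fix x assume x: "x \<in> E - F"
      then have "infdist x F > 0" using F by (simp add: infdist_pos_not_in_closed)
      then obtain m where m: "inverse (real (Suc m)) < infdist x F" using reals_Archimedean by blast
      show "x \<in> G N \<union> (\<Union>k. R (k + N))"
      proof (cases "x \<in> G N")
        case False
        then have lt: "infdist x F < inverse (real (Suc N))" using x by (auto simp: G_def)
        \<comment> \<open>The first threshold that \<open>x\<close> reaches; its predecessor is
          missed, so \<open>x\<close> lies in the shell with index \<open>j - 1\<close>.\<close>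
        define j where "j = (LEAST j. inverse (real (Suc j)) \<le> infdist x F)"
        have j: "inverse (real (Suc j)) \<le> infdist x F" unfolding j_def by (rule LeastI[of _ m]) (use m in simp)
        have "j > N" using j lt by (meson leD le_imp_inverse_le le_less_trans less_imp_le not_less of_nat_0_less_iff of_nat_le_iff Suc_le_mono zero_less_Suc)
        then obtain k where k: "j = Suc (k + N)" by (metis add.commute less_imp_Suc_add)
        have "\<not> inverse (real (Suc (k + N))) \<le> infdist x F"
          using not_less_Least[of "k + N" "\<lambda>j. inverse (real (Suc j)) \<le> infdist x F"] k unfolding j_def[symmetric] by simp
        then have "x \<in> R (k + N)" using x j k by (auto simp: R_def)
        then show ?thesis by blast
      qed simp
    qed
    have "?H (E - F) \<le> ?H (G N) + ?H (\<Union>k. R (k + N))"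
      by (rule order_trans[OF hausdorff_outer_mono[OF sub] hausdorff_outer_Un])
    also have "?H (\<Union>k. R (k + N)) \<le> (\<Sum>k. ?H (R (k + N)))" by (rule hausdorff_outer_UN)
    also have "\<dots> = ennreal (\<Sum>k. r (k + N))"
      using \<open>summable r\<close> r by (subst suminf_ennreal2[symmetric]) (auto simp: summable_iff_shift)
    also have "\<dots> \<le> ennreal e" using N by (intro ennreal_leI) auto
    finally have 1: "?H (E - F) \<le> ?H (G N) + ennreal e" by (simp add: add_left_mono)
    have "?H (E \<inter> F) + ?H (G N) \<le> ?H ((E \<inter> F) \<union> G N)"
    proof (rule hausdorff_outer_separated)
      show "0 < inverse (real (Suc N))" by simp
      fix x y assume "x \<in> E \<inter> F" "y \<in> G N"
      then show "inverse (real (Suc N)) \<le> dist x y" 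
        using infdist_le[of x F y] by (auto simp: G_def dist_commute)
    qed
    also have "\<dots> \<le> ?H E" by (intro le) (auto simp: G_def)
    finally have 2: "?H (E \<inter> F) + ?H (G N) \<le> ?H E" .
    have "?H (E \<inter> F) + ?H (E - F) \<le> ?H (E \<inter> F) + ?H (G N) + ennreal e"
      using 1 by (simp add: add_left_mono add.assoc)
    also have "\<dots> \<le> ?H E + ennreal e" using 2 by (rule add_right_mono)
    finally show "?H (E \<inter> F) + ?H (E - F) \<le> ?H E + ennreal e" .
  qed
qed

text \<open>Caratheodory's criterion: closed sets split every test set additively, so they belong to
  the lambda system, a sigma-algebra on which the outer measure is a measure. Only with this does
  \<open>measure_of\<close>, through which \<open>surface_measure\<close> is defined, return the
  Hausdorff measure as its value.\<close>

lemma measure_space_hausdorff: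
  "measure_space UNIV (sets (borel :: 'a::metric_space measure)) (hausdorff_outer s)"
proof -
  let ?H = "hausdorff_outer s :: 'a set \<Rightarrow> ennreal"
  let ?L = "lambda_system UNIV UNIV ?H"
  interpret sigma_algebra "UNIV :: 'a set" UNIV using sigma_algebra_Pow[of UNIV] by simp
  have "outer_measure_space UNIV ?H"
    unfolding outer_measure_space_def
    by (auto simp: positive_def increasing_def countably_subadditive_def intro: hausdorff_outer_mono hausdorff_outer_UN)
  then have L: "measure_space UNIV ?L ?H" by (rule caratheodory_lemma)
  have "closed F \<Longrightarrow> F \<in> ?L" for F
  proof -
    assume F: "closed F"
    have "?H (F \<inter> E) + ?H ((UNIV - F) \<inter> E) = ?H E" for E
    proof (rule antisym)
      show "?H (F \<inter> E) + ?H ((UNIV - F) \<inter> E) \<le> ?H E"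
      proof (cases "F = {} \<or> ?H E = top")
        case False
        then show ?thesis using hausdorff_outer_closed_split[OF F, of s E] 
          by (simp add: Int_commute Diff_eq top.not_eq_extremum)
      qed auto
      have "E = (F \<inter> E) \<union> ((UNIV - F) \<inter> E)" by auto
      then show "?H E \<le> ?H (F \<inter> E) + ?H ((UNIV - F) \<inter> E)" using hausdorff_outer_Un[of s "F \<inter> E" "(UNIV - F) \<inter> E"] by simp
    qed
    then show ?thesis by (simp add: lambda_system_def)
  qed
  moreover have "sigma_algebra UNIV ?L" using L by (simp add: measure_space_def)
  ultimately have "sigma_sets UNIV (Collect closed) \<subseteq> ?L"
    by (intro sigma_algebra.sigma_sets_subset) auto
  then have "sets (borel :: 'a measure) \<subseteq> ?L" by (simp add: borel_eq_closed)
  then show ?thesis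
    using measure_down[OF L] sets.sigma_algebra_axioms[of "borel :: 'a measure"] by simp
qed

lemma sets_surface_measure [simp, measurable_cong]: "sets surface_measure = sets borel"
  unfolding surface_measure_def by (metis sets_measure_of space_borel sets.space_closed sets.sigma_sets_eq)

lemma space_surface_measure [simp]: "space surface_measure = UNIV"
  unfolding surface_measure_def by (simp add: space_measure_of_conv)

lemma emeasure_surface_measure:
  fixes A :: "'a::euclidean_space set"
  assumes "A \<in> sets borel"
  shows "emeasure surface_measure A = hausdorff_outer (real DIM('a) - 1) A"
  using measure_space_hausdorff[where 'a='a, of "real DIM('a) - 1"] assms
  unfolding surface_measure_def measure_space_def
  by (intro emeasure_measure_of_sigma) auto

text \<open>The images of the members of a cover with mesh \<open>\<delta> / K\<close> form a cover
  with mesh \<open>\<delta>\<close>, and each diameter grows by a factor of at most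
  \<open>K\<close>, each gauge by at most \<open>K powr s\<close>.\<close>

lemma hausdorff_outer_lipschitz:
  fixes g :: "'a::metric_space \<Rightarrow> 'b::metric_space"
  assumes s: "s > 0" and K: "K > 0" and g: "\<And>x y. x \<in> A \<Longrightarrow> y \<in> A \<Longrightarrow> dist (g x) (g y) \<le> K * dist x y"
  shows "hausdorff_outer s (g ` A) \<le> ennreal (K powr s) * hausdorff_outer s A"
  unfolding hausdorff_outer_def[of s "g ` A"]
proof (rule SUP_least)
  fix \<delta> :: real assume "\<delta> \<in> {0<..}"
  then have \<delta>: "\<delta> / K > 0" using K by simp
  have "hausdorff_pre s \<delta> (g ` A) \<le> ennreal (K powr s) * (\<Sum>i. ball_gauge s (C i))" if C: "fine_cover (\<delta> / K) A C" for C
  proof -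
    \<comment> \<open>Intersecting with \<open>A\<close> is essential, since \<open>g\<close> is
      controlled only there.\<close>
    define D where "D i = g ` (C i \<inter> A)" for i
    have b: "bounded (C i \<inter> A)" and dc: "diameter (C i \<inter> A) \<le> diameter (C i)" for i
      using C diameter_subset[of "C i \<inter> A" "C i"] by (auto simp: fine_cover_def bounded_Int)
    have d: "diameter (D i) \<le> K * diameter (C i \<inter> A)" for i
    proof (rule diameter_le_dist)
      show "0 \<le> K * diameter (C i \<inter> A)" using K diameter_ge_0[OF b] by simp
      fix x y assume "x \<in> D i" "y \<in> D i"
      then obtain u v where uv: "u \<in> C i \<inter> A" "v \<in> C i \<inter> A" "x = g u" "y = g v" by (auto simp: D_def)
      have "dist x y \<le> K * dist u v" using uv g by simp
      also have "\<dots> \<le> K * diameter (C i \<inter> A)" using K uv b diameter_bounded_bound by (intro mult_left_mono) auto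
      finally show "dist x y \<le> K * diameter (C i \<inter> A)" .
    qed
    have bD: "bounded (D i)" for i
    proof (cases "C i \<inter> A = {}")
      case False
      then obtain u where u: "u \<in> C i \<inter> A" by blast
      have "D i \<subseteq> cball (g u) (K * diameter (C i \<inter> A))"
      proof
        fix x assume "x \<in> D i"
        then obtain v where v: "v \<in> C i \<inter> A" "x = g v" by (auto simp: D_def)
        have "dist (g u) x \<le> K * dist u v" using u v g by simp
        also have "\<dots> \<le> K * diameter (C i \<inter> A)" using K u v b diameter_bounded_bound by (intro mult_left_mono) auto
        finally show "x \<in> cball (g u) (K * diameter (C i \<inter> A))" by simp
      qed
      then show ?thesis by (meson bounded_cball bounded_subset)
    qed (simp add: D_def)
    have dD: "diameter (D i) \<le> K * diameter (C i)" for i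
      using order_trans[OF d mult_left_mono[OF dc]] K by simp
    have "K * diameter (C i) \<le> \<delta>" for i using C K by (auto simp: fine_cover_def field_simps)
    then have "diameter (D i) \<le> \<delta>" for i using dD order_trans by blast
    moreover have "g ` A \<subseteq> (\<Union>i. D i)" using C unfolding fine_cover_def D_def by blast
    ultimately have "fine_cover \<delta> (g ` A) D" using bD by (auto simp: fine_cover_def)
    then have "hausdorff_pre s \<delta> (g ` A) \<le> (\<Sum>i. ball_gauge s (D i))" by (rule hausdorff_pre_le)
    also have "\<dots> \<le> (\<Sum>i. ennreal (K powr s) * ball_gauge s (C i))"
    proof (intro suminf_le)
      fix i
      have "diameter (C i) \<ge> 0" using C diameter_ge_0 by (auto simp: fine_cover_def)
      have "ball_gauge s (D i) \<le> ennreal (unit_ball_vol s * (K * diameter (C i) / 2) powr s)"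
        using s bD dD by (intro ball_gauge_le) auto
      also have "(K * diameter (C i) / 2) powr s = K powr s * (diameter (C i) / 2) powr s"
        using K \<open>diameter (C i) \<ge> 0\<close> by (subst powr_mult[symmetric]) auto
      also have "ennreal (unit_ball_vol s * (K powr s * (diameter (C i) / 2) powr s)) = ennreal (K powr s) * ball_gauge s (C i)"
        using s by (simp add: ball_gauge_def ennreal_mult[symmetric] mult_ac)
      finally show "ball_gauge s (D i) \<le> ennreal (K powr s) * ball_gauge s (C i)" .
    qed auto
    also have "\<dots> = ennreal (K powr s) * (\<Sum>i. ball_gauge s (C i))" by simp
    finally show ?thesis .
  qed
  then have "hausdorff_pre s \<delta> (g ` A) / ennreal (K powr s) \<le> hausdorff_pre s (\<delta> / K) A"
    using K by (intro hausdorff_pre_ge divide_le_posI_ennreal) (auto simp: mult.commute)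
  also have "\<dots> \<le> hausdorff_outer s A" by (rule hausdorff_pre_le_outer[OF \<delta>])
  finally have "ennreal (K powr s) * (hausdorff_pre s \<delta> (g ` A) / ennreal (K powr s)) \<le> ennreal (K powr s) * hausdorff_outer s A"
    by (rule mult_left_mono) simp
  moreover have "ennreal (K powr s) * (hausdorff_pre s \<delta> (g ` A) / ennreal (K powr s)) = hausdorff_pre s \<delta> (g ` A)"
    using K by (simp add: ennreal_times_divide mult.commute[of "ennreal _"] ennreal_mult_divide_eq)
  ultimately show "hausdorff_pre s \<delta> (g ` A) \<le> ennreal (K powr s) * hausdorff_outer s A" by simp
qed


section \<open>Hausdorff measure of full dimension is Lebesgue measure\<close>

text \<open>\<open>from_nat_into\<close> alone would repeat a member when \<open>C\<close> is finite
  and so destroy disjointness; the guard lets every index occur once and pads with empty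
  sets.\<close>

lemma disjoint_family_enumeration:
  assumes "countable C" "\<And>i j. i \<in> C \<Longrightarrow> j \<in> C \<Longrightarrow> i \<noteq> j \<Longrightarrow> f i \<inter> f j = {}"
  shows "disjoint_family (\<lambda>n. if \<exists>i\<in>C. to_nat_on C i = n then f (from_nat_into C n) else {})"
  unfolding disjoint_family_on_def
proof (intro ballI impI)
  fix m n :: nat assume "m \<noteq> n"
  let ?g = "\<lambda>n. if \<exists>i\<in>C. to_nat_on C i = n then f (from_nat_into C n) else {}"
  show "?g m \<inter> ?g n = {}"
  proof (cases "(\<exists>i\<in>C. to_nat_on C i = m) \<and> (\<exists>i\<in>C. to_nat_on C i = n)")
    case True
    then obtain i j where ij: "i \<in> C" "to_nat_on C i = m" "j \<in> C" "to_nat_on C j = n" by blast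
    then have "?g m = f i" "?g n = f j" using assms(1) by auto
    moreover have "i \<noteq> j" using ij \<open>m \<noteq> n\<close> by auto
    ultimately show ?thesis using assms(2) ij by auto
  qed auto
qed

lemma cube_cover_countable:
  fixes t :: real
  assumes "t > 0"
  obtains Q :: "nat \<Rightarrow> 'a::euclidean_space" where "(\<Union>n. cbox (Q n - t *\<^sub>R One) (Q n + t *\<^sub>R One)) = UNIV"
proof -
  obtain D :: "'a set" where D: "countable D" "\<And>X. open X \<Longrightarrow> X \<noteq> {} \<Longrightarrow> \<exists>d\<in>D. d \<in> X"
    using countable_dense_setE by blast
  have "D \<noteq> {}" using D(2)[of UNIV] by auto
  then obtain Q :: "nat \<Rightarrow> 'a" where Q: "range Q = D" using D(1) by (metis range_from_nat_into)
  have "x \<in> (\<Union>n. cbox (Q n - t *\<^sub>R One) (Q n + t *\<^sub>R One))" for x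
  proof -
    obtain d where d: "d \<in> D" "d \<in> ball x t" using D(2)[of "ball x t"] assms by auto
    then obtain n where n: "d = Q n" using Q by blast
    have "\<bar>(x - d) \<bullet> i\<bar> \<le> t" if "i \<in> Basis" for i
      using d(2) Basis_le_norm[OF that, of "x - d"] by (simp add: dist_norm)
    then have "x \<in> cbox (Q n - t *\<^sub>R One) (Q n + t *\<^sub>R One)"
      by (simp add: mem_box n inner_simps abs_le_iff) (smt (verit))
    then show ?thesis by blast
  qed
  then show ?thesis using that by blast
qed

text \<open>A null set inside a cube is covered by dyadic subcubes of arbitrarily small total
  volume. For cubes, unlike for arbitrary boxes, the gauge is at most a constant times the volume,
  so the premeasure is arbitrarily small as well.\<close>

lemma hausdorff_pre_null_in_cube:
  fixes N :: "'a::euclidean_space set"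
  assumes N: "N \<in> null_sets lborel" and sub: "N \<subseteq> cbox (q - t *\<^sub>R One) (q + t *\<^sub>R One)" and t: "t > 0"
    and \<delta>: "2 * t * real DIM('a) \<le> \<delta>"
  shows "hausdorff_pre (real DIM('a)) \<delta> N = 0"
proof -
  let ?m = "real DIM('a)"
  let ?a = "q - t *\<^sub>R One" and ?b = "q + t *\<^sub>R One"
  \<comment> \<open>Bounds gauge over volume for a cube: side \<open>r\<close> gives diameter at
    most \<open>r * DIM('a)\<close> through the l1 norm.\<close>
  define K where "K = unit_ball_vol ?m * ?m ^ DIM('a)"
  have K: "K \<ge> 0" by (simp add: K_def)
  have ab': "?b \<bullet> i - ?a \<bullet> i = 2 * t" if "i \<in> Basis" for i using that by (simp add: inner_simps)
  have Nl: "N \<in> lmeasurable" "measure lebesgue N = 0"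
    using N by (auto simp: fmeasurable_def null_sets_def measure_def)
  have "hausdorff_pre ?m \<delta> N \<le> ennreal (K * e)" if e: "e > 0" for e
  proof -
    obtain \<D> where D: "countable \<D>" "\<And>A. A \<in> \<D> \<Longrightarrow> A \<subseteq> cbox ?a ?b \<and> A \<noteq> {} \<and> (\<exists>c d. A = cbox c d)"
        "pairwise (\<lambda>A B. interior A \<inter> interior B = {}) \<D>"
        "\<And>u v. cbox u v \<in> \<D> \<Longrightarrow> \<exists>n. \<forall>i \<in> Basis. v \<bullet> i - u \<bullet> i = (?b \<bullet> i - ?a \<bullet> i)/2^n"
        "N \<subseteq> \<Union>\<D>" "\<Union>\<D> \<in> lmeasurable" "measure lebesgue (\<Union>\<D>) \<le> measure lebesgue N + e"
      using measurable_outer_intervals_bounded[OF Nl(1) sub e] by metis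
    have cube: "\<exists>u v r. A = cbox u v \<and> 0 \<le> r \<and> r \<le> 2 * t \<and> (\<forall>i\<in>Basis. v \<bullet> i - u \<bullet> i = r)" if AD: "A \<in> \<D>" for A
    proof -
      obtain u v where uv: "A = cbox u v" using D(2)[OF AD] by blast
      \<comment> \<open>All sides are halved equally often and the initial box is a cube, hence so
        is \<open>A\<close>.\<close>
      then obtain n :: nat where n: "\<forall>i \<in> Basis. v \<bullet> i - u \<bullet> i = (?b \<bullet> i - ?a \<bullet> i)/2^n" using D(4) AD by blast
      have "2 * t / 2 ^ n \<le> 2 * t" using t by (intro divide_left_mono[of 1 "2^n" "2*t", simplified]) auto
      then show ?thesis using uv n ab' t by (intro exI[of _ u] exI[of _ v] exI[of _ "2 * t / 2 ^ n"]) auto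
    qed
    have fine: "bounded A \<and> diameter A \<le> \<delta> \<and> ball_gauge ?m A \<le> ennreal K * emeasure lborel A" if AD: "A \<in> \<D>" for A
    proof -
      obtain u v r where uvr: "A = cbox u v" "0 \<le> r" "r \<le> 2 * t" "\<forall>i\<in>Basis. v \<bullet> i - u \<bullet> i = r"
        using cube[OF AD] by blast
      have di: "diameter A \<le> r * ?m"
      proof (rule diameter_le_dist)
        fix x y assume "x \<in> A" "y \<in> A"
        then have "\<bar>(x - y) \<bullet> i\<bar> \<le> r" if "i \<in> Basis" for i
          using that uvr by (auto simp: mem_box inner_diff_left) (smt (verit))
        then have "(\<Sum>i\<in>Basis. \<bar>(x - y) \<bullet> i\<bar>) \<le> (\<Sum>i\<in>(Basis::'a set). r)" by (intro sum_mono)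
        then show "dist x y \<le> r * ?m" using norm_le_l1[of "x - y"] by (simp add: dist_norm mult.commute)
      qed (use uvr in auto)
      have "r * ?m \<le> 2 * t * ?m" using uvr by (intro mult_right_mono) auto
      then have "diameter A \<le> \<delta>" using di \<delta> by linarith
      moreover have "ball_gauge ?m A \<le> ennreal (unit_ball_vol ?m * (r * ?m / 2) powr ?m)"
        using di uvr by (intro ball_gauge_le) auto
      moreover have "unit_ball_vol ?m * (r * ?m / 2) powr ?m \<le> K * r ^ DIM('a)"
      proof (cases "r = 0")
        case False
        then have "r > 0" using uvr by simp
        have "(r * ?m / 2) powr ?m = (r * ?m / 2) ^ DIM('a)" using \<open>r > 0\<close> by (intro powr_realpow) simp
        also have "\<dots> \<le> (r * ?m) ^ DIM('a)" using \<open>r > 0\<close> by (intro power_mono) auto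
        finally show ?thesis by (simp add: K_def power_mult_distrib mult_ac mult_left_mono)
      qed (simp add: K_def)
      moreover have "emeasure lborel A = ennreal (r ^ DIM('a))"
      proof -
        have "\<And>i. i \<in> Basis \<Longrightarrow> (v - u) \<bullet> i = r" "\<And>i. i \<in> Basis \<Longrightarrow> u \<bullet> i \<le> v \<bullet> i" 
          using uvr by (auto simp: inner_diff_left algebra_simps)
        then show ?thesis using uvr(1) by (simp add: emeasure_lborel_cbox)
      qed
      moreover have "ennreal K * ennreal (r ^ DIM('a)) = ennreal (K * r ^ DIM('a))" 
        using K uvr by (simp add: ennreal_mult)
      ultimately show ?thesis using uvr by (auto intro: order_trans ennreal_leI)
    qed
    show ?thesis
    proof (cases "\<D> = {}")
      case True
      have "0 \<le> 2 * t * ?m" using t by simp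
      then have "0 \<le> \<delta>" using \<delta> by linarith
      then show ?thesis using True D(5) by (simp add: hausdorff_pre_empty)
    next
      case False
      have "hausdorff_pre ?m \<delta> N \<le> hausdorff_pre ?m \<delta> (\<Union>n. if \<exists>A\<in>\<D>. to_nat_on \<D> A = n then from_nat_into \<D> n else {})"
      proof (rule hausdorff_pre_mono, rule order_trans[OF D(5)], safe)
        fix x A assume "x \<in> A" "A \<in> \<D>"
        then show "x \<in> (\<Union>n. if \<exists>A\<in>\<D>. to_nat_on \<D> A = n then from_nat_into \<D> n else {})"
          using D(1) by (intro UN_I[of "to_nat_on \<D> A"]) auto
      qed
      also have "\<dots> \<le> (\<Sum>n. hausdorff_pre ?m \<delta> (if \<exists>A\<in>\<D>. to_nat_on \<D> A = n then from_nat_into \<D> n else {}))"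
        by (rule hausdorff_pre_UN)
      \<comment> \<open>The dyadic cubes may share faces; passing to interiors keeps the volumes and
        makes the pieces disjoint, so that the volumes can be summed.\<close>
      also have "\<dots> \<le> (\<Sum>n. ennreal K * emeasure lborel (if \<exists>A\<in>\<D>. to_nat_on \<D> A = n then interior (from_nat_into \<D> n) else {}))"
      proof (intro suminf_le)
        fix n
        have "from_nat_into \<D> n \<in> \<D>" using False by (rule from_nat_into)
        moreover from this have "emeasure lborel (interior (from_nat_into \<D> n)) = emeasure lborel (from_nat_into \<D> n)"
          using cube by (metis emeasure_lborel_box_eq emeasure_lborel_cbox_eq interior_cbox)
        moreover have "\<delta> \<ge> 0" using \<delta> t by (meson mult_nonneg_nonneg of_nat_0_le_iff order_trans less_imp_le zero_le_numeral)
        ultimately show "hausdorff_pre ?m \<delta> (if \<exists>A\<in>\<D>. to_nat_on \<D> A = n then from_nat_into \<D> n else {})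
          \<le> ennreal K * emeasure lborel (if \<exists>A\<in>\<D>. to_nat_on \<D> A = n then interior (from_nat_into \<D> n) else {})"
          using fine[of "from_nat_into \<D> n"] hausdorff_pre_single[of \<delta> "from_nat_into \<D> n" ?m]
          by (auto simp: hausdorff_pre_empty intro: order_trans)
      qed auto
      also have "\<dots> = ennreal K * (\<Sum>n. emeasure lborel (if \<exists>A\<in>\<D>. to_nat_on \<D> A = n then interior (from_nat_into \<D> n) else {}))"
        by simp
      also have "(\<Sum>n. emeasure lborel (if \<exists>A\<in>\<D>. to_nat_on \<D> A = n then interior (from_nat_into \<D> n) else {}))
        = emeasure lborel (\<Union>n. if \<exists>A\<in>\<D>. to_nat_on \<D> A = n then interior (from_nat_into \<D> n) else {})"
      proof (rule suminf_emeasure)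
        show "range (\<lambda>n. if \<exists>A\<in>\<D>. to_nat_on \<D> A = n then interior (from_nat_into \<D> n) else {}) \<subseteq> sets lborel"
          by auto
        show "disjoint_family (\<lambda>n. if \<exists>A\<in>\<D>. to_nat_on \<D> A = n then interior (from_nat_into \<D> n) else {})"
          using D(3) by (intro disjoint_family_enumeration[OF D(1)]) (auto simp: pairwise_def)
      qed
      also have "\<dots> \<le> emeasure lebesgue (\<Union>\<D>)"
      proof -
        have "(\<Union>n. if \<exists>A\<in>\<D>. to_nat_on \<D> A = n then interior (from_nat_into \<D> n) else {}) \<subseteq> \<Union>\<D>" (is "?U \<subseteq> _")
          proof
          fix x assume "x \<in> ?U"
          then obtain A where "A \<in> \<D>" "x \<in> interior A" using D(1) by (auto split: if_splits)
          then show "x \<in> \<Union>\<D>" using interior_subset by blast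
        qed
        moreover have "?U \<in> sets borel" by (intro borel_open open_UN) auto
        ultimately have "emeasure lebesgue ?U \<le> emeasure lebesgue (\<Union>\<D>)"
          using D(6) by (intro emeasure_mono) auto
        then show ?thesis using \<open>?U \<in> sets borel\<close> by simp
      qed
      also have "emeasure lebesgue (\<Union>\<D>) = ennreal (measure lebesgue (\<Union>\<D>))"
        using D(6) by (simp add: emeasure_eq_measure2)
      also have "ennreal K * ennreal (measure lebesgue (\<Union>\<D>)) \<le> ennreal K * ennreal e"
        using D(7) Nl by (intro mult_left_mono ennreal_leI) auto
      also have "\<dots> = ennreal (K * e)" using K e by (simp add: ennreal_mult)
      finally show ?thesis by (simp add: mult_left_mono)
    qed
  qed
  then have le: "hausdorff_pre ?m \<delta> N \<le> ennreal (K * e)" if "e > 0" for e using that by blast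
  have "hausdorff_pre ?m \<delta> N \<le> 0 + ennreal e" if "e > 0" for e
  proof -
    have "e / (K + 1) > 0" using K that by simp
    then have "hausdorff_pre ?m \<delta> N \<le> ennreal (K * (e / (K + 1)))"
      by (rule le)
    also have "\<dots> \<le> ennreal e" using K that by (intro ennreal_leI) (simp add: field_simps)
    finally show ?thesis by simp
  qed
  then have "hausdorff_pre ?m \<delta> N \<le> 0" using ennreal_le_epsilon[of 0 "hausdorff_pre ?m \<delta> N"] by simp
  then show ?thesis by simp
qed

lemma hausdorff_pre_null:
  fixes N :: "'a::euclidean_space set"
  assumes N: "N \<in> null_sets lborel" and \<delta>: "\<delta> > 0"
  shows "hausdorff_pre (real DIM('a)) \<delta> N = 0"
proof -
  define t where "t = \<delta> / (2 * real DIM('a))"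
  have t: "t > 0" "2 * t * real DIM('a) \<le> \<delta>" using \<delta> by (auto simp: t_def)
  obtain Q :: "nat \<Rightarrow> 'a" where Q: "(\<Union>n. cbox (Q n - t *\<^sub>R One) (Q n + t *\<^sub>R One)) = UNIV"
    using cube_cover_countable[OF t(1)] by blast
  have "N = N \<inter> (\<Union>n. cbox (Q n - t *\<^sub>R One) (Q n + t *\<^sub>R One))" unfolding Q by simp
  also have "\<dots> = (\<Union>n. N \<inter> cbox (Q n - t *\<^sub>R One) (Q n + t *\<^sub>R One))" by (rule Int_UN_distrib)
  finally have "hausdorff_pre (real DIM('a)) \<delta> N \<le> (\<Sum>n. hausdorff_pre (real DIM('a)) \<delta> (N \<inter> cbox (Q n - t *\<^sub>R One) (Q n + t *\<^sub>R One)))"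
    using hausdorff_pre_UN[of "real DIM('a)" \<delta> "\<lambda>n. N \<inter> cbox (Q n - t *\<^sub>R One) (Q n + t *\<^sub>R One)"] by (rule ord_eq_le_trans[OF arg_cong[of _ _ "hausdorff_pre (real DIM('a)) \<delta>"]])
  also have "\<dots> = (\<Sum>n::nat. 0)"
    using N by (intro suminf_cong hausdorff_pre_null_in_cube[OF _ _ t]) (auto intro: null_set_Int2)
  finally show ?thesis by simp
qed

text \<open>Vitali's theorem fills the open set, up to a null set, with disjoint balls of diameter
  at most \<open>\<delta>\<close>. The gauge of a ball is exactly its volume, and the null remainder
  costs nothing by \<open>hausdorff_pre_null\<close>.\<close>

lemma hausdorff_pre_open_le:
  fixes O' :: "'a::euclidean_space set"
  assumes O': "open O'" and \<delta>: "\<delta> > 0"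
  shows "hausdorff_pre (real DIM('a)) \<delta> O' \<le> emeasure lborel O'"
proof -
  let ?m = "real DIM('a)"
  define K where "K = {(x, r). ball x r \<subseteq> O' \<and> 0 < r \<and> r < \<delta> / 2}"
  have fine: "\<exists>i. i \<in> K \<and> x \<in> ball (fst i) (snd i) \<and> snd i < d" if x: "x \<in> O'" and d: "0 < d" for x d
  proof -
    obtain e where e: "e > 0" "ball x e \<subseteq> O'" using openE[OF O' x] by metis
    define r where "r = min e (min (\<delta> / 4) (d / 2))"
    have "r > 0" "r \<le> e" "r < \<delta> / 2" "r < d" using e d \<delta> by (auto simp: r_def min_def)
    then show ?thesis using e by (intro exI[of _ "(x, r)"]) (auto simp: K_def)
  qed
  obtain C where C: "countable C" "C \<subseteq> K"
     "pairwise (\<lambda>i j. disjnt (ball (fst i) (snd i)) (ball (fst j) (snd j))) C"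
     "negligible (O' - (\<Union>i\<in>C. ball (fst i) (snd i)))"
    by (rule Vitali_covering_theorem_balls[of O' K fst snd, OF fine])
  define B where "B n = (if \<exists>i\<in>C. to_nat_on C i = n then ball (fst (from_nat_into C n)) (snd (from_nat_into C n)) else {})" for n
  define N where "N = O' - (\<Union>i\<in>C. ball (fst i) (snd i))"
  have "N \<in> sets borel" unfolding N_def using O' C(1) by (intro sets.Diff sets.countable_UN'') auto
  then have N: "N \<in> null_sets lborel"
    using C(4) by (simp add: N_def negligible_iff_null_sets null_sets_completion_iff)
  have BU: "(\<Union>n. B n) = (\<Union>i\<in>C. ball (fst i) (snd i))"
    using C(1) by (force simp: B_def)
  have "O' \<subseteq> N \<union> (\<Union>n. B n)" unfolding BU N_def by blast
  define D where "D n = (case n of 0 \<Rightarrow> N | Suc k \<Rightarrow> B k)" for n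
  have "O' \<subseteq> (\<Union>n. D n)"
  proof
    fix x assume "x \<in> O'"
    then consider "x \<in> D 0" | k where "x \<in> D (Suc k)" using \<open>O' \<subseteq> N \<union> (\<Union>n. B n)\<close> by (auto simp: D_def)
    then show "x \<in> (\<Union>n. D n)" by cases blast+
  qed
  then have "hausdorff_pre ?m \<delta> O' \<le> hausdorff_pre ?m \<delta> (\<Union>n. D n)" by (rule hausdorff_pre_mono)
  also have "\<dots> \<le> (\<Sum>n. hausdorff_pre ?m \<delta> (D n))" by (rule hausdorff_pre_UN)
  also have "\<dots> = (\<Sum>n. hausdorff_pre ?m \<delta> (B n)) + hausdorff_pre ?m \<delta> N"
    by (subst suminf_offset[of _ 1]) (auto simp: D_def add.commute)
  also have "hausdorff_pre ?m \<delta> N = 0" by (rule hausdorff_pre_null[OF N \<delta>])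
  also have "(\<Sum>n. hausdorff_pre ?m \<delta> (B n)) \<le> (\<Sum>n. emeasure lborel (B n))"
  proof (intro suminf_le)
    fix n
    have "hausdorff_pre ?m \<delta> (ball x r) \<le> emeasure lborel (ball x r)" if "(x, r) \<in> K" for x r
    proof -
      have r: "r > 0" "2 * r \<le> \<delta>" using that by (auto simp: K_def)
      have "hausdorff_pre ?m \<delta> (ball x r) \<le> ball_gauge ?m (ball x r)"
        using r \<delta> by (intro hausdorff_pre_single) auto
      also have "\<dots> = emeasure lborel (ball x r)"
        using r by (simp add: ball_gauge_def emeasure_ball powr_realpow)
      finally show ?thesis .
    qed
    then show "hausdorff_pre ?m \<delta> (B n) \<le> emeasure lborel (B n)"
      using C(1,2) \<delta> by (auto simp: B_def hausdorff_pre_empty)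
  qed auto
  also have "(\<Sum>n. emeasure lborel (B n)) = emeasure lborel (\<Union>n. B n)"
  proof (rule suminf_emeasure)
    show "disjoint_family B"
      using C(3) unfolding B_def by (intro disjoint_family_enumeration[OF C(1)]) (auto simp: pairwise_def disjnt_def)
  qed (auto simp: B_def)
  also have "\<dots> \<le> emeasure lborel O'"
  proof -
    have "ball (fst i) (snd i) \<subseteq> O'" if "i \<in> C" for i
      using subsetD[OF C(2) that] by (auto simp: K_def)
    then show ?thesis using O' unfolding BU by (intro emeasure_mono UN_least) auto
  qed
  finally show ?thesis by simp
qed

text \<open>The upper bound uses efficient covers, namely balls together with outer regularity; the
  lower bound says that no cover is more efficient, which is the isodiametric inequality for each of
  its members. This exact agreement is what lets a nearly isometric chart carry a constant close to
  1.\<close>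

theorem hausdorff_outer_eq_lborel:
  fixes A :: "'a::euclidean_space set"
  assumes A: "A \<in> sets borel"
  shows "hausdorff_outer (real DIM('a)) A = emeasure lborel A"
proof (rule antisym)
  let ?m = "real DIM('a)"
  show "hausdorff_outer ?m A \<le> emeasure lborel A"
    unfolding hausdorff_outer_def
  proof (rule SUP_least, rule ennreal_le_epsilon)
    fix \<delta> e :: real assume "\<delta> \<in> {0<..}" and e: "e > 0"
    then have \<delta>: "\<delta> > 0" by simp
    obtain U where U: "open U" "A \<subseteq> U" "emeasure lborel (U - A) < ennreal e"
      using outer_regular_lborel[OF A e] by metis
    have "hausdorff_pre ?m \<delta> A \<le> hausdorff_pre ?m \<delta> U" by (rule hausdorff_pre_mono[OF U(2)])
    also have "\<dots> \<le> emeasure lborel U" by (rule hausdorff_pre_open_le[OF U(1) \<delta>])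
    also have "\<dots> = emeasure lborel (A \<union> (U - A))" using U(2) by (simp add: Un_absorb1)
    also have "\<dots> \<le> emeasure lborel A + emeasure lborel (U - A)"
      using A U(1) by (intro emeasure_subadditive) auto
    also have "\<dots> \<le> emeasure lborel A + ennreal e" using U(3) by (intro add_left_mono) auto
    finally show "hausdorff_pre ?m \<delta> A \<le> emeasure lborel A + ennreal e" .
  qed
  \<comment> \<open>The isodiametric inequality holds at every scale, so any single mesh will do,
    here 1.\<close>
  have "emeasure lborel A \<le> hausdorff_pre ?m 1 A"
  proof (rule hausdorff_pre_ge)
    fix C assume C: "fine_cover 1 A C"
    have b: "bounded (C i)" for i using C by (simp add: fine_cover_def)
    \<comment> \<open>Covering sets are arbitrary; their closures are Borel and have the same
      diameter.\<close>
    have "emeasure lborel A \<le> emeasure lborel (\<Union>i. closure (C i))"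
      using C closure_subset by (intro emeasure_mono) (auto simp: fine_cover_def, blast)
    also have "\<dots> \<le> (\<Sum>i. emeasure lborel (closure (C i)))"
      by (intro emeasure_subadditive_countably) auto
    also have "\<dots> \<le> (\<Sum>i. ball_gauge ?m (C i))"
    proof (intro suminf_le)
      fix i
      have d: "0 \<le> diameter (C i)" using b by (rule diameter_ge_0)
      have "emeasure lborel (closure (C i)) \<le> ennreal (unit_ball_vol ?m * (diameter (C i) / 2) ^ DIM('a))"
        using b by (intro isodiametric) (auto simp: diameter_closure)
      also have "(diameter (C i) / 2) ^ DIM('a) = (diameter (C i) / 2) powr ?m"
        using d by (cases "diameter (C i) = 0") (auto simp: powr_realpow)
      finally show "emeasure lborel (closure (C i)) \<le> ball_gauge ?m (C i)" by (simp add: ball_gauge_def)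
    qed auto
    finally show "emeasure lborel A \<le> (\<Sum>i. ball_gauge ?m (C i))" .
  qed
  also have "\<dots> \<le> hausdorff_outer ?m A" by (rule hausdorff_pre_le_outer) simp
  finally show "emeasure lborel A \<le> hausdorff_outer ?m A" .
qed

lemma hausdorff_outer_isometry:
  fixes T :: "'a::metric_space \<Rightarrow> 'b::metric_space"
  assumes s: "s > 0" and T: "\<And>x y. x \<in> A \<Longrightarrow> y \<in> A \<Longrightarrow> dist (T x) (T y) = dist x y"
  shows "hausdorff_outer s (T ` A) = hausdorff_outer s A"
proof (rule antisym)
  show "hausdorff_outer s (T ` A) \<le> hausdorff_outer s A"
    using hausdorff_outer_lipschitz[OF s, of 1 A T] T by simp
  have inj: "inj_on T A" using T by (metis (no_types, lifting) dist_eq_0_iff inj_onI)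
  have "hausdorff_outer s (inv_into A T ` T ` A) \<le> hausdorff_outer s (T ` A)"
  proof -
    have "dist (inv_into A T x) (inv_into A T y) \<le> 1 * dist x y" if "x \<in> T ` A" "y \<in> T ` A" for x y
      using that T inj by (auto simp: inv_into_f_f)
    then show ?thesis using hausdorff_outer_lipschitz[OF s, of 1 "T ` A" "inv_into A T"] by simp
  qed
  then show "hausdorff_outer s A \<le> hausdorff_outer s (T ` A)" using inj by simp
qed

text \<open>Full-dimensional Hausdorff measure depends on distances only, so Lebesgue measure is
  transported by isometries even between different types, such as \<open>'b \<times> real\<close>
  and \<open>'a\<close>, with no determinant involved.\<close>

lemma distr_lborel_isometry:
  fixes T :: "'a::euclidean_space \<Rightarrow> 'b::euclidean_space"
  assumes T: "\<And>x y. dist (T x) (T y) = dist x y" "surj T" and dim: "DIM('a) = DIM('b)"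
  shows "distr lborel lborel T = lborel"
proof (rule measure_eqI)
  fix A assume "A \<in> sets (distr lborel lborel T)"
  then have A: "A \<in> sets borel" by simp
  have "1-lipschitz_on UNIV T" using T by (intro lipschitz_onI) auto
  then have meas: "T \<in> borel_measurable borel"
    by (intro borel_measurable_continuous_onI lipschitz_on_continuous_on)
  have TA: "T -` A \<in> sets borel" using measurable_sets[OF meas A] by simp
  have "emeasure (distr lborel lborel T) A = emeasure lborel (T -` A)"
    using meas A by (subst emeasure_distr) auto
  also have "\<dots> = hausdorff_outer (real DIM('a)) (T -` A)" using hausdorff_outer_eq_lborel[OF TA] by simp
  also have "\<dots> = hausdorff_outer (real DIM('a)) (T ` (T -` A))"
    using T by (intro hausdorff_outer_isometry[symmetric]) auto
  also have "T ` (T -` A) = A" using T(2) by (simp add: surj_image_vimage_eq)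
  also have "hausdorff_outer (real DIM('a)) A = emeasure lborel A" using hausdorff_outer_eq_lborel[OF A] dim by simp
  finally show "emeasure (distr lborel lborel T) A = emeasure lborel A" .
qed simp

section \<open>Concentration of level-set kernels on the boundary\<close>

text \<open>The tent over [0, 2] with peak 1 at 1 and integral 1. As a combination of positive parts
  it has an explicit piecewise quadratic antiderivative, \<open>ramp\<close>, which is a C^1 step
  from 0 to 1.\<close>

definition hat :: "real \<Rightarrow> real" where
  "hat u = max 0 u - 2 * max 0 (u - 1) + max 0 (u - 2)"

definition ramp :: "real \<Rightarrow> real" where
  "ramp u = ((max 0 u)\<^sup>2 - 2 * (max 0 (u - 1))\<^sup>2 + (max 0 (u - 2))\<^sup>2) / 2"

lemma DERIV_max_0_square: "((\<lambda>u. (max 0 u)\<^sup>2) has_real_derivative 2 * max 0 u) (at (u::real))"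
proof -
  consider "u > 0" | "u < 0" | "u = 0" by linarith
  then show ?thesis
  proof cases
    case 1
    have "((\<lambda>u. u\<^sup>2) has_real_derivative 2 * max 0 u) (at u)"
      using 1 by (auto intro!: derivative_eq_intros)
    moreover have "eventually (\<lambda>x. (max 0 x)\<^sup>2 = x\<^sup>2) (nhds u)"
      using 1 by (intro eventually_mono[OF eventually_nhds_in_open[of "{0<..}" u]]) auto
    ultimately show ?thesis by (rule DERIV_cong_ev[OF refl _ refl, THEN iffD2, rotated])
  next
    case 2
    have "((\<lambda>u. 0) has_real_derivative 2 * max 0 u) (at u)"
      using 2 by (auto intro!: derivative_eq_intros)
    moreover have "eventually (\<lambda>x. (max 0 x)\<^sup>2 = (0::real)) (nhds u)"
      using 2 by (intro eventually_mono[OF eventually_nhds_in_open[of "{..<0}" u]]) auto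
    ultimately show ?thesis by (rule DERIV_cong_ev[OF refl _ refl, THEN iffD2, rotated])
  next
    case 3
    have "((\<lambda>h. max 0 h) \<longlongrightarrow> max 0 (0::real)) (at 0)" by (intro tendsto_intros)
    moreover have "((max 0 (0 + h))\<^sup>2 - (max 0 0)\<^sup>2) / h = max 0 h" if "h \<noteq> 0" for h :: real
      using that by (auto simp: max_def power2_eq_square)
    ultimately show ?thesis unfolding DERIV_def 3
      by (subst tendsto_cong[of _ "\<lambda>h. max 0 h"]) (auto simp: eventually_at_filter)
  qed
qed

lemma DERIV_ramp: "(ramp has_real_derivative hat u) (at u)"
proof -
  have s: "((\<lambda>u. (max 0 (u - c))\<^sup>2) has_real_derivative 2 * max 0 (u - c)) (at u)" for c
    by (rule DERIV_chain2[OF DERIV_max_0_square, THEN DERIV_cong]) (auto intro!: derivative_eq_intros)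
  have "(ramp has_real_derivative (2 * max 0 u - 2 * (2 * max 0 (u - 1)) + 2 * max 0 (u - 2)) / 2) (at u)"
    unfolding ramp_def by (intro DERIV_cdivide DERIV_add DERIV_diff DERIV_cmult DERIV_max_0_square s)
  then show ?thesis by (rule DERIV_cong) (simp add: hat_def field_simps)
qed

lemma hat_nonneg: "hat u \<ge> 0" and hat_le_1: "hat u \<le> 1" and hat_zero: "u \<le> 0 \<or> u \<ge> 2 \<Longrightarrow> hat u = 0"
  by (auto simp: hat_def max_def)

lemma ramp_zero: "u \<le> 0 \<Longrightarrow> ramp u = 0" and ramp_one: "u \<ge> 2 \<Longrightarrow> ramp u = 1"
  by (auto simp: ramp_def max_def power2_eq_square algebra_simps)

lemma continuous_on_hat: "continuous_on A hat"
  unfolding hat_def by (intro continuous_intros)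

lemma ramp_mono: "u \<le> v \<Longrightarrow> ramp u \<le> ramp v"
  by (rule DERIV_nonneg_imp_nondecreasing[where f = ramp]) (use DERIV_ramp hat_nonneg in blast)+

lemma ramp_bounds: "0 \<le> ramp u" "ramp u \<le> 1"
  using ramp_mono[of "min u 0" u] ramp_mono[of u "max u 2"] by (auto simp: ramp_zero ramp_one)

text \<open>The substitution places the tent over the levels between -3 delta and -delta. They stay
  away from the level 0 of the boundary, so the cutoff has compact support inside the domain, and
  \<open>level_kernel\<close> is a probability density in the level variable.\<close>

definition level_cut :: "real \<Rightarrow> real \<Rightarrow> real" where "level_cut \<delta> t = ramp (- t / \<delta> - 1)"
definition level_kernel :: "real \<Rightarrow> real \<Rightarrow> real" where "level_kernel \<delta> t = hat (- t / \<delta> - 1) / \<delta>"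

lemma DERIV_level_cut: "\<delta> > 0 \<Longrightarrow> (level_cut \<delta> has_real_derivative - level_kernel \<delta> t) (at t)"
  unfolding level_cut_def level_kernel_def
  by (rule DERIV_chain2[OF DERIV_ramp, THEN DERIV_cong]) (auto intro!: derivative_eq_intros)

lemma level_kernel_nonneg: "\<delta> > 0 \<Longrightarrow> 0 \<le> level_kernel \<delta> t" and level_kernel_le: "\<delta> > 0 \<Longrightarrow> level_kernel \<delta> t \<le> 1 / \<delta>"
  by (auto simp: level_kernel_def hat_nonneg hat_le_1 divide_right_mono)

lemma level_kernel_zero: "\<delta> > 0 \<Longrightarrow> t \<le> - 3 * \<delta> \<or> t \<ge> - \<delta> \<Longrightarrow> level_kernel \<delta> t = 0"
  unfolding level_kernel_def by (subst hat_zero) (auto simp: field_simps)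

lemma level_cut_zero: "\<delta> > 0 \<Longrightarrow> t \<ge> - \<delta> \<Longrightarrow> level_cut \<delta> t = 0"
  unfolding level_cut_def by (rule ramp_zero) (auto simp: field_simps)

lemma level_cut_one: "\<delta> > 0 \<Longrightarrow> t \<le> - 3 * \<delta> \<Longrightarrow> level_cut \<delta> t = 1"
  unfolding level_cut_def by (rule ramp_one) (auto simp: field_simps)

lemma level_cut_bounds: "0 \<le> level_cut \<delta> t" "level_cut \<delta> t \<le> 1"
  by (simp_all add: level_cut_def ramp_bounds)

lemma continuous_on_level_kernel: "\<delta> > 0 \<Longrightarrow> continuous_on A (level_kernel \<delta>)"
  unfolding level_kernel_def by (intro continuous_intros continuous_on_compose2[OF continuous_on_hat[of UNIV]]) auto

lemma continuous_on_level_cut: "\<delta> > 0 \<Longrightarrow> continuous_on A (level_cut \<delta>)"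
  by (intro continuous_at_imp_continuous_on ballI DERIV_isCont[OF DERIV_level_cut])

text \<open>Coordinates at a boundary point p with unit normal e = grad f(p) / a: L is an isometry onto the
  tangent hyperplane, and the zero set of f is a graph over it with slope at most 2 * eta.\<close>

locale graph_chart =
  fixes f :: "'a::euclidean_space \<Rightarrow> real" and G :: "'a \<Rightarrow> 'a" and p e :: 'a
    and L :: "'b::euclidean_space \<Rightarrow> 'a" and a \<eta> \<rho> :: real
  assumes deriv: "\<And>x. x \<in> ball p \<rho> \<Longrightarrow> (f has_derivative (\<lambda>h. G x \<bullet> h)) (at x)"
    and contG: "continuous_on (ball p \<rho>) G"
    and near: "\<And>x. x \<in> ball p \<rho> \<Longrightarrow> norm (G x - a *\<^sub>R e) \<le> \<eta> * a"
    and pos: "0 < \<eta>" "\<eta> \<le> 1 / 2" "0 < a" "0 < \<rho>"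
    and e1: "norm e = 1" and linL: "linear L" and normL: "\<And>y. norm (L y) = norm y"
    and orthL: "\<And>y. L y \<bullet> e = 0" and surjL: "\<And>x. \<exists>y. x = L y + (x \<bullet> e) *\<^sub>R e"
    and fp: "f p = 0" and dim: "DIM('a) = DIM('b) + 1"
begin

section \<open>Isometric coordinates at a boundary point\<close>

definition \<Phi> :: "'b \<Rightarrow> real \<Rightarrow> 'a" where "\<Phi> y s = p + (L y + s *\<^sub>R e)"
text \<open>The radii keep \<open>\<Phi> y s\<close> in \<open>ball p \<rho>\<close> and force a
  change of sign of \<open>f\<close> along each normal segment: from the base point to an end the
  normal part changes \<open>f\<close> by at least (rho/2)(a/2) = a rho/4, while the tangential part
  is at most (1/2) a (rho/4) = a rho/8.\<close>

definition D :: "'b set" where "D = ball 0 (\<rho> / 4)"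
definition V :: "'a set" where "V = {\<Phi> y s | y s. y \<in> D \<and> \<bar>s\<bar> < \<rho> / 2}"

lemma ee: "e \<bullet> e = 1" using e1 by (simp add: norm_eq_1)

lemma norm_frame: "(norm (L y + s *\<^sub>R e))\<^sup>2 = (norm y)\<^sup>2 + s\<^sup>2"
proof -
  have "orthogonal (L y) (s *\<^sub>R e)" by (simp add: orthogonal_def orthL)
  from norm_add_Pythagorean[OF this] show ?thesis by (simp add: normL e1)
qed

lemma diff_\<Phi>: "\<Phi> y s - \<Phi> y' s' = L (y - y') + (s - s') *\<^sub>R e"
  by (simp add: \<Phi>_def linear_diff[OF linL] algebra_simps)

lemma dist_\<Phi>: "dist (\<Phi> y s) (\<Phi> y' s') = dist (y, s) (y', s')"
proof -
  have "dist (\<Phi> y s) (\<Phi> y' s') = sqrt ((norm (y - y'))\<^sup>2 + (s - s')\<^sup>2)"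
    using norm_frame[of "y - y'" "s - s'"] by (metis diff_\<Phi> dist_norm norm_ge_zero real_sqrt_unique)
  also have "\<dots> = dist (y, s) (y', s')" by (simp add: dist_Pair_Pair dist_norm[of y] dist_real_def)
  finally show ?thesis .
qed

lemma dist_\<Phi>_ge: "dist y y' \<le> dist (\<Phi> y s) (\<Phi> y' s')"
  unfolding dist_\<Phi> using dist_fst_le[of "(y, s)" "(y', s')"] by simp

lemma dist_\<Phi>_le: "dist (\<Phi> y s) (\<Phi> y' s') \<le> dist y y' + \<bar>s - s'\<bar>"
  unfolding dist_norm diff_\<Phi> using norm_triangle_ineq[of "L (y - y')" "(s - s') *\<^sub>R e"] by (simp add: normL e1)

lemma \<Phi>_inject: "\<Phi> y s = \<Phi> y' s' \<longleftrightarrow> y = y' \<and> s = s'"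
  using dist_\<Phi>[of y s y' s'] by (metis Pair_inject dist_eq_0_iff)

lemma \<Phi>_surj: "\<exists>y s. x = \<Phi> y s"
proof -
  obtain y where "x - p = L y + ((x - p) \<bullet> e) *\<^sub>R e" using surjL by blast
  then have "x = \<Phi> y ((x - p) \<bullet> e)" unfolding \<Phi>_def by (metis add_diff_cancel_left' add_diff_eq)
  then show ?thesis by blast
qed

text \<open>This allows the layer integral to be computed by Fubini: first along the normal lines,
  then over the tangent hyperplane.\<close>

lemma lborel_\<Phi>: "distr lborel lborel (\<lambda>z. \<Phi> (fst z) (snd z)) = lborel"
proof (rule distr_lborel_isometry)
  show "surj (\<lambda>z. \<Phi> (fst z) (snd z))" using \<Phi>_surj by (metis (no_types, lifting) fst_conv snd_conv surjI surj_def)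
  show "DIM('b \<times> real) = DIM('a)" using dim by simp
qed (simp add: dist_\<Phi>)

lemma continuous_on_\<Phi>: "continuous_on A (\<lambda>z. \<Phi> (fst z) (snd z))"
proof -
  have "1-lipschitz_on A (\<lambda>z. \<Phi> (fst z) (snd z))" by (intro lipschitz_onI) (auto simp: dist_\<Phi>)
  then show ?thesis by (rule lipschitz_on_continuous_on)
qed

lemma open_V: "open V"
proof -
  have "V = {x. norm ((x - p) - ((x - p) \<bullet> e) *\<^sub>R e) < \<rho> / 4 \<and> \<bar>(x - p) \<bullet> e\<bar> < \<rho> / 2}"
  proof (intro set_eqI)
    fix x
    obtain y s where x: "x = \<Phi> y s" using \<Phi>_surj by blast
    have s: "(x - p) \<bullet> e = s" by (simp add: x \<Phi>_def inner_simps orthL ee)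
    have "(x - p) - ((x - p) \<bullet> e) *\<^sub>R e = L y" by (simp only: s) (simp add: x \<Phi>_def)
    then have "norm ((x - p) - ((x - p) \<bullet> e) *\<^sub>R e) = norm y" by (simp add: normL)
    moreover have "x \<in> V \<longleftrightarrow> y \<in> D \<and> \<bar>s\<bar> < \<rho> / 2" by (auto simp: V_def x \<Phi>_inject)
    ultimately show "x \<in> V \<longleftrightarrow> x \<in> {x. norm ((x - p) - ((x - p) \<bullet> e) *\<^sub>R e) < \<rho> / 4 \<and> \<bar>(x - p) \<bullet> e\<bar> < \<rho> / 2}"
      using s by (simp add: D_def)
  qed
  also have "open \<dots>" by (intro open_Collect_conj open_Collect_less continuous_intros)
  finally show ?thesis .
qed

lemma p_in_V: "p \<in> V"
  using pos by (auto simp: V_def \<Phi>_def D_def linear_0[OF linL] intro!: exI[of _ 0])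

lemma \<Phi>_in_ball:
  assumes "y \<in> D" "\<bar>s\<bar> \<le> \<rho> / 2"
  shows "\<Phi> y s \<in> ball p \<rho>"
proof -
  have "dist (\<Phi> y s) (\<Phi> 0 0) < \<rho>"
    using dist_\<Phi>_le[of y s 0 0] assms by (auto simp: D_def)
  then show ?thesis by (simp add: \<Phi>_def linear_0[OF linL] dist_commute)
qed

lemma V_subset_ball: "V \<subseteq> ball p \<rho>"
  unfolding V_def using \<Phi>_in_ball by fastforce

lemma G_e: "x \<in> ball p \<rho> \<Longrightarrow> (1 - \<eta>) * a \<le> G x \<bullet> e"
  and G_L: "x \<in> ball p \<rho> \<Longrightarrow> \<bar>G x \<bullet> L y\<bar> \<le> \<eta> * a * norm y"
  and norm_G: "x \<in> ball p \<rho> \<Longrightarrow> norm (G x) \<le> (1 + \<eta>) * a"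
  and G_e_le: "G x \<bullet> e \<le> norm (G x)"
proof -
  assume x: "x \<in> ball p \<rho>"
  have "\<bar>(G x - a *\<^sub>R e) \<bullet> e\<bar> \<le> \<eta> * a"
    using Cauchy_Schwarz_ineq2[of "G x - a *\<^sub>R e" e] near[OF x] e1 by simp
  then show "(1 - \<eta>) * a \<le> G x \<bullet> e" by (simp add: inner_simps ee algebra_simps)
  have "\<bar>(G x - a *\<^sub>R e) \<bullet> L y\<bar> \<le> norm (G x - a *\<^sub>R e) * norm (L y)" by (rule Cauchy_Schwarz_ineq2)
  also have "\<dots> \<le> \<eta> * a * norm y" using near[OF x] by (simp add: normL mult_right_mono)
  finally show "\<bar>G x \<bullet> L y\<bar> \<le> \<eta> * a * norm y" using orthL[of y] by (simp add: inner_simps inner_commute)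
  have "norm (G x) \<le> norm (G x - a *\<^sub>R e) + norm (a *\<^sub>R e)" by (metis diff_add_cancel norm_triangle_ineq)
  then show "norm (G x) \<le> (1 + \<eta>) * a" using near[OF x] pos e1 by (simp add: algebra_simps)
next
  show "G x \<bullet> e \<le> norm (G x)" using norm_cauchy_schwarz[of "G x" e] e1 by simp
qed

lemma G_e_pos: "x \<in> ball p \<rho> \<Longrightarrow> 0 < G x \<bullet> e"
proof -
  assume "x \<in> ball p \<rho>"
  have "0 < (1 - \<eta>) * a" using pos by simp
  also have "\<dots> \<le> G x \<bullet> e" by (rule G_e) fact
  finally show ?thesis .
qed

lemma G_e_half: "x \<in> ball p \<rho> \<Longrightarrow> a / 2 \<le> G x \<bullet> e"
proof -
  assume "x \<in> ball p \<rho>"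
  have "1 / 2 * a \<le> (1 - \<eta>) * a" using pos by (intro mult_right_mono) auto
  also have "\<dots> \<le> G x \<bullet> e" by (rule G_e) fact
  finally show ?thesis by simp
qed

lemma mean_value:
  assumes "x \<in> ball p \<rho>" "x' \<in> ball p \<rho>"
  shows "\<exists>\<xi>\<in>ball p \<rho>. f x - f x' = G \<xi> \<bullet> (x - x')"
proof -
  let ?l = "\<lambda>t. x' + t *\<^sub>R (x - x')"
  have l: "?l t \<in> ball p \<rho>" if "0 \<le> t" "t \<le> 1" for t
  proof -
    have "?l t = (1 - t) *\<^sub>R x' + t *\<^sub>R x" by (simp add: algebra_simps)
    then show ?thesis using assms that convexD_alt[OF convex_ball, of x' p \<rho> x t] by metis
  qed
  have "\<exists>t\<in>{0<..<1}. (f \<circ> ?l) 1 - (f \<circ> ?l) 0 = (\<lambda>h. G (?l t) \<bullet> (h *\<^sub>R (x - x'))) (1 - 0)"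
  proof (rule mvt_simple)
    fix t :: real assume t: "0 \<le> t" "t \<le> 1"
    have "(?l has_derivative (\<lambda>h. h *\<^sub>R (x - x'))) (at t within {0..1})" by (auto intro!: derivative_eq_intros)
    from diff_chain_within[OF this has_derivative_at_withinI[OF deriv[OF l[OF t]]]]
    show "(f \<circ> ?l has_derivative (\<lambda>h. G (?l t) \<bullet> (h *\<^sub>R (x - x')))) (at t within {0..1})" by (simp add: o_def)
  qed simp
  then obtain t where "t \<in> {0<..<1}" "f x - f x' = G (?l t) \<bullet> (x - x')" by auto
  then show ?thesis using l[of t] by auto
qed

lemma mean_value_\<Phi>:
  assumes "y \<in> D" "\<bar>s\<bar> \<le> \<rho> / 2" "y' \<in> D" "\<bar>s'\<bar> \<le> \<rho> / 2"
  obtains \<xi> where "\<xi> \<in> ball p \<rho>" "f (\<Phi> y s) - f (\<Phi> y' s') = G \<xi> \<bullet> L (y - y') + (s - s') * (G \<xi> \<bullet> e)"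
  using mean_value[OF \<Phi>_in_ball[OF assms(1,2)] \<Phi>_in_ball[OF assms(3,4)]] unfolding diff_\<Phi> by (auto simp: inner_simps)

lemma f_increasing:
  assumes "y \<in> D" "\<bar>s\<bar> \<le> \<rho> / 2" "\<bar>s'\<bar> \<le> \<rho> / 2" "s' \<le> s"
  shows "(s - s') * (a / 2) \<le> f (\<Phi> y s) - f (\<Phi> y s')"
proof -
  obtain \<xi> where \<xi>: "\<xi> \<in> ball p \<rho>" "f (\<Phi> y s) - f (\<Phi> y s') = (s - s') * (G \<xi> \<bullet> e)"
    using mean_value_\<Phi>[OF assms(1,2,1,3)] linear_0[OF linL] by (metis diff_self inner_zero_right add_0)
  then show ?thesis using G_e_half[OF \<xi>(1)] assms(4) by (metis mult_left_mono diff_ge_0_iff_ge)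
qed

lemma f_top: "y \<in> D \<Longrightarrow> f (\<Phi> y (\<rho> / 2)) \<ge> a * \<rho> / 8"
  and f_bot: "y \<in> D \<Longrightarrow> f (\<Phi> y (- \<rho> / 2)) \<le> - a * \<rho> / 8"
proof -
  assume y: "y \<in> D"
  have 0: "0 \<in> D" "f (\<Phi> 0 0) = 0" "\<bar>\<rho> / 2\<bar> \<le> \<rho> / 2" "\<bar>- \<rho> / 2\<bar> \<le> \<rho> / 2" "\<bar>0\<bar> \<le> \<rho> / 2"
    using pos fp by (auto simp: D_def \<Phi>_def linear_0[OF linL])
  have small: "\<eta> * a * norm y \<le> a * \<rho> / 8"
  proof -
    have "\<eta> * a * norm y \<le> (1 / 2) * a * (\<rho> / 4)" using pos y by (intro mult_mono) (auto simp: D_def)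
    then show ?thesis by simp
  qed
  have big: "(\<rho> / 2) * (a / 2) \<le> (\<rho> / 2) * (G \<xi> \<bullet> e)" if "\<xi> \<in> ball p \<rho>" for \<xi>
    using G_e_half[OF that] pos by (intro mult_left_mono) auto
  obtain \<xi> where \<xi>: "\<xi> \<in> ball p \<rho>" "f (\<Phi> y (\<rho> / 2)) - f (\<Phi> 0 0) = G \<xi> \<bullet> L (y - 0) + (\<rho> / 2 - 0) * (G \<xi> \<bullet> e)"
    by (rule mean_value_\<Phi>[OF y 0(3) 0(1,5)])
  then show "f (\<Phi> y (\<rho> / 2)) \<ge> a * \<rho> / 8"
    using small big[OF \<xi>(1)] G_L[OF \<xi>(1), of y] 0(2) by (simp add: algebra_simps)
  obtain \<xi> where \<xi>: "\<xi> \<in> ball p \<rho>" "f (\<Phi> y (- \<rho> / 2)) - f (\<Phi> 0 0) = G \<xi> \<bullet> L (y - 0) + (- \<rho> / 2 - 0) * (G \<xi> \<bullet> e)"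
    by (rule mean_value_\<Phi>[OF y 0(4) 0(1,5)])
  then show "f (\<Phi> y (- \<rho> / 2)) \<le> - a * \<rho> / 8"
    using small big[OF \<xi>(1)] G_L[OF \<xi>(1), of y] 0(2) by (simp add: algebra_simps)
qed

lemma continuous_on_f: "continuous_on (ball p \<rho>) f"
  using deriv has_derivative_continuous by (intro continuous_at_imp_continuous_on) blast

lemma ex_zero:
  assumes y: "y \<in> D"
  shows "\<exists>s. \<bar>s\<bar> < \<rho> / 2 \<and> f (\<Phi> y s) = 0"
proof -
  have c: "continuous_on {- \<rho> / 2..\<rho> / 2} (\<lambda>s. f (\<Phi> y s))"
  proof (rule continuous_on_compose2[OF continuous_on_f])
    show "continuous_on {- \<rho> / 2..\<rho> / 2} (\<Phi> y)" unfolding \<Phi>_def by (intro continuous_intros)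
  qed (use \<Phi>_in_ball[OF y] in \<open>auto simp: abs_le_iff\<close>)
  have lt: "f (\<Phi> y (- \<rho> / 2)) < 0" "0 < f (\<Phi> y (\<rho> / 2))"
  proof -
    have "0 < a * \<rho> / 8" using pos by simp
    then show "f (\<Phi> y (- \<rho> / 2)) < 0" "0 < f (\<Phi> y (\<rho> / 2))" using f_top[OF y] f_bot[OF y] by linarith+
  qed
  then obtain s where s: "- \<rho> / 2 \<le> s" "s \<le> \<rho> / 2" "f (\<Phi> y s) = 0"
    using IVT'[of "\<lambda>s. f (\<Phi> y s)" "- \<rho> / 2" 0 "\<rho> / 2"] c pos by auto
  moreover have "s \<noteq> \<rho> / 2" "s \<noteq> - \<rho> / 2" using s(3) lt by auto
  ultimately show ?thesis by (intro exI[of _ s]) auto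
qed

section \<open>The boundary as a Lipschitz graph\<close>

text \<open>The height of the boundary over \<open>y\<close>, obtained from the intermediate value
  theorem on the normal segment (\<open>ex_zero\<close>). Strict increase of \<open>f\<close> along
  the segment makes the chosen zero the only one.\<close>

definition g :: "'b \<Rightarrow> real" where "g y = (SOME s. \<bar>s\<bar> < \<rho> / 2 \<and> f (\<Phi> y s) = 0)"
definition \<gamma> :: "'b \<Rightarrow> 'a" where "\<gamma> y = \<Phi> y (g y)"

lemma g: "y \<in> D \<Longrightarrow> \<bar>g y\<bar> < \<rho> / 2" "y \<in> D \<Longrightarrow> f (\<Phi> y (g y)) = 0"
  using someI_ex[OF ex_zero] unfolding g_def by blast+

text \<open>Quantitative uniqueness from the normal slope, which is at least a/2. Besides
  identifying the zero set with the graph, it confines the region where the kernel lives to distance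
  6 delta / a from the graph, measured along the normal.\<close>

lemma g_unique:
  assumes "y \<in> D" "\<bar>s\<bar> \<le> \<rho> / 2"
  shows "\<bar>s - g y\<bar> * (a / 2) \<le> \<bar>f (\<Phi> y s)\<bar>"
  using f_increasing[OF assms, of "g y"] f_increasing[of y "g y" s] g[OF assms(1)] assms
  by (cases "g y \<le> s") auto

text \<open>Both graph points are zeros of \<open>f\<close>, so the tangential and the normal part
  of its increment cancel. The tangential slope is at most \<open>\<eta> * a\<close> and the normal
  one at least \<open>a / 2\<close>, whence the quotient \<open>2 * \<eta>\<close>.\<close>

lemma g_lipschitz:
  assumes y: "y \<in> D" "y' \<in> D"
  shows "\<bar>g y - g y'\<bar> \<le> 2 * \<eta> * dist y y'"
proof -
  have b: "\<bar>g y\<bar> \<le> \<rho> / 2" "\<bar>g y'\<bar> \<le> \<rho> / 2" using g(1) y by (auto intro: less_imp_le)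
  obtain \<xi> where \<xi>: "\<xi> \<in> ball p \<rho>" "f (\<Phi> y (g y)) - f (\<Phi> y' (g y')) = G \<xi> \<bullet> L (y - y') + (g y - g y') * (G \<xi> \<bullet> e)"
    by (rule mean_value_\<Phi>[OF y(1) b(1) y(2) b(2)])
  then have "(g y - g y') * (G \<xi> \<bullet> e) = - (G \<xi> \<bullet> L (y - y'))" using g y by simp
  then have "\<bar>g y - g y'\<bar> * (G \<xi> \<bullet> e) = \<bar>G \<xi> \<bullet> L (y - y')\<bar>"
    using G_e_pos[OF \<xi>(1)] by (metis abs_minus_cancel abs_mult abs_of_pos)
  also have "\<dots> \<le> \<eta> * a * dist y y'" using G_L[OF \<xi>(1)] by (simp add: dist_norm)
  finally have "\<bar>g y - g y'\<bar> * (G \<xi> \<bullet> e) \<le> \<eta> * a * dist y y'" .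
  moreover have "\<bar>g y - g y'\<bar> * (a / 2) \<le> \<bar>g y - g y'\<bar> * (G \<xi> \<bullet> e)"
    using G_e_half[OF \<xi>(1)] by (intro mult_left_mono) auto
  moreover have "\<eta> * a * dist y y' = (2 * \<eta> * dist y y') * (a / 2)" by (simp add: field_simps)
  ultimately have "\<bar>g y - g y'\<bar> * (a / 2) \<le> (2 * \<eta> * dist y y') * (a / 2)" by linarith
  then show ?thesis using pos by (simp only: mult_le_cancel_right_pos half_gt_zero_iff)
qed

lemma \<gamma>_lipschitz: "y \<in> D \<Longrightarrow> y' \<in> D \<Longrightarrow> dist (\<gamma> y) (\<gamma> y') \<le> (1 + 2 * \<eta>) * dist y y'"
  using dist_\<Phi>_le[of y "g y" y' "g y'"] g_lipschitz[of y y'] unfolding \<gamma>_def by (simp add: algebra_simps)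

lemma \<gamma>_image: "\<gamma> ` D = {x\<in>V. f x = 0}"
proof (intro set_eqI iffI)
  fix x assume "x \<in> {x\<in>V. f x = 0}"
  then obtain y s where ys: "x = \<Phi> y s" "y \<in> D" "\<bar>s\<bar> < \<rho> / 2" "f (\<Phi> y s) = 0" by (auto simp: V_def)
  then have "\<bar>s - g y\<bar> * (a / 2) \<le> 0" using g_unique[of y s] by simp
  then have "s = g y" using pos by (simp add: mult_le_0_iff)
  then show "x \<in> \<gamma> ` D" using ys by (auto simp: \<gamma>_def)
qed (use g in \<open>auto simp: \<gamma>_def V_def\<close>)

lemma continuous_on_\<gamma>: "continuous_on D \<gamma>"
proof -
  have "(1 + 2 * \<eta>)-lipschitz_on D \<gamma>" using \<gamma>_lipschitz pos by (intro lipschitz_onI) auto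
  then show ?thesis by (rule lipschitz_on_continuous_on)
qed

lemma chart_sets: "D \<in> sets borel" "V \<in> sets borel" "{x\<in>V. f x = 0} \<in> sets borel"
proof -
  show D: "D \<in> sets borel" by (simp add: D_def)
  show V: "V \<in> sets borel" using open_V by simp
  have "closedin (top_of_set V) {x\<in>V. f x \<in> {0}}"
    using continuous_closedin_preimage[OF continuous_on_subset[OF continuous_on_f V_subset_ball], of "{0}"]
    by (simp add: vimage_def Int_def)
  then obtain C where "closed C" "{x\<in>V. f x = 0} = V \<inter> C" by (auto simp: closedin_closed)
  then show "{x\<in>V. f x = 0} \<in> sets borel" using V by auto
qed

text \<open>Projecting the graph back to the hyperplane does not increase distances, while
  \<open>\<gamma>\<close> increases them by at most the factor \<open>1 + 2 * \<eta>\<close>. The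
  Lipschitz estimate for Hausdorff measure is applied to both maps, and on \<open>'b\<close> that
  measure is Lebesgue measure.\<close>

lemma chart_surface_measure:
  assumes A: "A \<in> sets borel"
  shows "emeasure lborel (\<gamma> -` A \<inter> D) \<le> emeasure surface_measure (A \<inter> {x\<in>V. f x = 0})"
    "emeasure surface_measure (A \<inter> {x\<in>V. f x = 0}) \<le> ennreal ((1 + 2 * \<eta>) ^ DIM('b)) * emeasure lborel (\<gamma> -` A \<inter> D)"
proof -
  let ?B = "\<gamma> -` A \<inter> D" and ?m = "real DIM('b)"
  have m: "real DIM('a) - 1 = ?m" "?m > 0" using dim by simp_all
  have "\<gamma> \<in> borel_measurable (restrict_space borel D)"
    by (rule borel_measurable_continuous_on_restrict[OF continuous_on_\<gamma>])
  from measurable_sets[OF this A] have B: "?B \<in> sets borel"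
    using chart_sets(1) by (simp add: space_restrict_space sets_restrict_space_iff)
  have im: "A \<inter> {x\<in>V. f x = 0} = \<gamma> ` ?B" unfolding \<gamma>_image[symmetric] by auto
  have "A \<inter> {x\<in>V. f x = 0} \<in> sets borel" using A chart_sets by auto
  then have H: "emeasure surface_measure (A \<inter> {x\<in>V. f x = 0}) = hausdorff_outer ?m (\<gamma> ` ?B)"
    using emeasure_surface_measure m im by metis
  have LB: "emeasure lborel ?B = hausdorff_outer ?m ?B" using hausdorff_outer_eq_lborel[OF B] by simp
  have inj: "inj_on \<gamma> ?B" by (auto simp: inj_on_def \<gamma>_def \<Phi>_inject)
  have "hausdorff_outer ?m (inv_into ?B \<gamma> ` \<gamma> ` ?B) \<le> hausdorff_outer ?m (\<gamma> ` ?B)"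
  proof -
    have "dist (inv_into ?B \<gamma> x) (inv_into ?B \<gamma> x') \<le> 1 * dist x x'" if xx: "x \<in> \<gamma> ` ?B" "x' \<in> \<gamma> ` ?B" for x x'
    proof -
      obtain y y' where "y \<in> ?B" "y' \<in> ?B" "x = \<gamma> y" "x' = \<gamma> y'" using xx by blast
      then show ?thesis using inj dist_\<Phi>_ge by (simp add: inv_into_f_f) (simp add: \<gamma>_def)
    qed
    then show ?thesis using hausdorff_outer_lipschitz[OF m(2), of 1 "\<gamma> ` ?B" "inv_into ?B \<gamma>"] by simp
  qed
  then show "emeasure lborel ?B \<le> emeasure surface_measure (A \<inter> {x\<in>V. f x = 0})"
    using inj by (simp add: H LB)
  have "hausdorff_outer ?m (\<gamma> ` ?B) \<le> ennreal ((1 + 2 * \<eta>) powr ?m) * hausdorff_outer ?m ?B"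
    using \<gamma>_lipschitz pos by (intro hausdorff_outer_lipschitz m) auto
  moreover have "(1 + 2 * \<eta>) powr ?m = (1 + 2 * \<eta>) ^ DIM('b)" using pos by (intro powr_realpow) simp
  ultimately show "emeasure surface_measure (A \<inter> {x\<in>V. f x = 0}) \<le> ennreal ((1 + 2 * \<eta>) ^ DIM('b)) * emeasure lborel ?B"
    by (simp only: H LB)
qed

text \<open>The setwise bounds sandwich the restricted surface measure \<open>M2\<close> between
  \<open>M1\<close>, the image of Lebesgue measure under \<open>\<gamma>\<close>, and a multiple of
  it; integrals of nonnegative functions are monotone in the measure.\<close>

lemma chart_surface_nn_integral:
  fixes \<phi> :: "'a \<Rightarrow> ennreal"
  assumes \<phi>: "\<phi> \<in> borel_measurable borel"
  defines "M \<equiv> (\<integral>\<^sup>+y. \<phi> (\<gamma> y) * indicator D y \<partial>lborel)"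
    and "S \<equiv> (\<integral>\<^sup>+x. \<phi> x * indicator {x\<in>V. f x = 0} x \<partial>surface_measure)"
  shows "M \<le> S" "S \<le> ennreal ((1 + 2 * \<eta>) ^ DIM('b)) * M"
proof -
  let ?A = "{x\<in>V. f x = 0}" and ?K = "ennreal ((1 + 2 * \<eta>) ^ DIM('b))"
  define M1 where "M1 = distr (restrict_space lborel D) borel \<gamma>"
  define M2 where "M2 = density surface_measure (indicator ?A)"
  have meas: "\<gamma> \<in> measurable (restrict_space lborel D) borel"
    using borel_measurable_continuous_on_restrict[OF continuous_on_\<gamma>] 
    by (simp cong: measurable_cong_sets add: sets_restrict_space)
  have s1: "sets M1 = sets borel" "sets M2 = sets borel" by (simp_all add: M1_def M2_def)
  have e1: "emeasure M1 A = emeasure lborel (\<gamma> -` A \<inter> D)" if "A \<in> sets borel" for A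
    using that meas chart_sets(1) unfolding M1_def
    by (simp add: emeasure_distr space_restrict_space emeasure_restrict_space)
  have e2: "emeasure M2 A = emeasure surface_measure (A \<inter> ?A)" if "A \<in> sets borel" for A
    using that chart_sets(3) unfolding M2_def
    by (simp add: emeasure_density indicator_inter_arith[symmetric] Int_commute sets.Int)
  have n1: "nn_integral M1 \<phi> = M"
    using meas \<phi> chart_sets(1) unfolding M1_def M_def
    by (simp add: nn_integral_distr nn_integral_restrict_space)
  have n2: "nn_integral M2 \<phi> = S"
    using \<phi> chart_sets(3) unfolding M2_def S_def
    by (simp add: nn_integral_density mult.commute cong: measurable_cong_sets)
  have "M1 \<le> M2" using s1 by (subst le_measure) (auto simp: e1 e2 chart_surface_measure)
  then show "M \<le> S" using nn_integral_mono_measure[of M1 M2 \<phi>] s1 n1 n2 by simp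
  have "M2 \<le> scale_measure ?K M1" using s1 by (subst le_measure) (auto simp: e1 e2 chart_surface_measure)
  then have "nn_integral M2 \<phi> \<le> nn_integral (scale_measure ?K M1) \<phi>" using s1 by (intro nn_integral_mono_measure) auto
  also have "\<dots> = ?K * nn_integral M1 \<phi>" using \<phi> s1 by (intro nn_integral_scale_measure) (simp cong: measurable_cong_sets)
  finally show "S \<le> ?K * M" by (simp only: n1 n2)
qed

section \<open>Integration along the normal lines\<close>

lemma DERIV_line:
  assumes "y \<in> D" "\<bar>s\<bar> \<le> \<rho> / 2"
  shows "((\<lambda>s. f (\<Phi> y s)) has_real_derivative (G (\<Phi> y s) \<bullet> e)) (at s)"
proof -
  have "(\<Phi> y has_derivative (\<lambda>h. h *\<^sub>R e)) (at s)" unfolding \<Phi>_def by (auto intro!: derivative_eq_intros)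
  from diff_chain_at[OF this deriv[OF \<Phi>_in_ball[OF assms]]]
  show ?thesis by (simp add: o_def has_field_derivative_def mult.commute[of _ "G (\<Phi> y s) \<bullet> e"])
qed

lemma line_continuous:
  assumes y: "y \<in> D"
  shows "continuous_on {- \<rho> / 2..\<rho> / 2} (\<lambda>s. f (\<Phi> y s))" "continuous_on {- \<rho> / 2..\<rho> / 2} (\<lambda>s. G (\<Phi> y s) \<bullet> e)"
proof -
  have c: "continuous_on {- \<rho> / 2..\<rho> / 2} (\<Phi> y)" unfolding \<Phi>_def by (intro continuous_intros)
  have i: "\<Phi> y ` {- \<rho> / 2..\<rho> / 2} \<subseteq> ball p \<rho>" using \<Phi>_in_ball[OF y] by (auto simp: abs_le_iff)
  show "continuous_on {- \<rho> / 2..\<rho> / 2} (\<lambda>s. f (\<Phi> y s))"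
    by (rule continuous_on_compose2[OF continuous_on_f c i])
  show "continuous_on {- \<rho> / 2..\<rho> / 2} (\<lambda>s. G (\<Phi> y s) \<bullet> e)"
    by (intro continuous_intros continuous_on_compose2[OF contG c i])
qed

text \<open>The factor \<open>G (\<Phi> y s) \<bullet> e\<close> is the derivative of
  \<open>f\<close> along the normal line, so inside the segment this is the derivative of
  \<open>- level_cut \<delta> (f (\<Phi> y s))\<close> and its integral is known exactly.\<close>

definition weight :: "real \<Rightarrow> 'b \<Rightarrow> real \<Rightarrow> real" where
  "weight \<delta> y s = indicator {- \<rho> / 2..\<rho> / 2} s * (level_kernel \<delta> (f (\<Phi> y s)) * (G (\<Phi> y s) \<bullet> e))"

text \<open>The integral is a difference of two cutoff values. At the upper end \<open>f\<close> is
  positive and the cutoff is 0; at the lower end \<open>f\<close> is at most -a rho/8, where the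
  cutoff is 1 once 3 delta does not exceed a rho/8. So the weights become probability densities
  concentrating at the graph.\<close>

lemma weight:
  assumes y: "y \<in> D" and \<delta>: "\<delta> > 0"
  shows "integrable lborel (weight \<delta> y)" "0 \<le> weight \<delta> y s" "(LINT s|lborel. weight \<delta> y s) \<le> 1"
    "3 * \<delta> \<le> a * \<rho> / 8 \<Longrightarrow> (LINT s|lborel. weight \<delta> y s) = 1"
    "weight \<delta> y s \<noteq> 0 \<Longrightarrow> \<bar>s - g y\<bar> * (a / 2) \<le> 3 * \<delta>"
proof -
  let ?r = "\<rho> / 2" and ?w = "\<lambda>s. level_kernel \<delta> (f (\<Phi> y s)) * (G (\<Phi> y s) \<bullet> e)"
  have cw: "continuous_on {- ?r..?r} ?w"
    using line_continuous[OF y] by (intro continuous_on_mult continuous_on_compose2[OF continuous_on_level_kernel[OF \<delta>, of UNIV]]) auto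
  then show "integrable lborel (weight \<delta> y)"
    using borel_integrable_compact[of "{- ?r..?r}" ?w] unfolding weight_def by (simp add: indicator_scaleR_eq_if if_distrib)
  have inb: "\<Phi> y s \<in> ball p \<rho>" if "s \<in> {- ?r..?r}" for s
    using \<Phi>_in_ball[OF y, of s] that by (auto simp: abs_le_iff)
  show "0 \<le> weight \<delta> y s"
    using level_kernel_nonneg[OF \<delta>] less_imp_le[OF G_e_pos[OF inb]] by (cases "s \<in> {- ?r..?r}") (simp_all add: weight_def)
  have "(?w has_integral (- level_cut \<delta> (f (\<Phi> y ?r))) - (- level_cut \<delta> (f (\<Phi> y (- ?r))))) {- ?r..?r}"
  proof (rule fundamental_theorem_of_calculus)
    show "- ?r \<le> ?r" using pos by simp
    fix s assume s: "s \<in> {- ?r..?r}"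
    have "((\<lambda>s. - level_cut \<delta> (f (\<Phi> y s))) has_real_derivative ?w s) (at s)"
      using DERIV_minus[OF DERIV_chain2[OF DERIV_level_cut[OF \<delta>] DERIV_line[OF y, of s]]] s by (auto simp: abs_le_iff)
    then show "((\<lambda>s. - level_cut \<delta> (f (\<Phi> y s))) has_vector_derivative ?w s) (at s within {- ?r..?r})"
      using has_vector_derivative_at_within by (simp add: has_real_derivative_iff_has_vector_derivative) blast
  qed
  then have "integral {- ?r..?r} ?w = level_cut \<delta> (f (\<Phi> y (- ?r))) - level_cut \<delta> (f (\<Phi> y ?r))"
    by (subst integral_unique) auto
  moreover have "set_integrable lborel {- ?r..?r} ?w"
    unfolding set_integrable_def using cw by (intro borel_integrable_compact) auto
  ultimately have I: "(LINT s|lborel. weight \<delta> y s) = level_cut \<delta> (f (\<Phi> y (- ?r))) - level_cut \<delta> (f (\<Phi> y ?r))"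
    using set_borel_integral_eq_integral(2)[of "{- ?r..?r}" ?w]
    unfolding set_lebesgue_integral_def weight_def by simp
  have top: "level_cut \<delta> (f (\<Phi> y ?r)) = 0"
  proof -
    have "0 < a * \<rho> / 8" using pos by simp
    then show ?thesis using f_top[OF y] \<delta> by (intro level_cut_zero) auto
  qed
  show "(LINT s|lborel. weight \<delta> y s) \<le> 1" using I top level_cut_bounds(2) by simp
  show "(LINT s|lborel. weight \<delta> y s) = 1" if "3 * \<delta> \<le> a * \<rho> / 8"
    using I top f_bot[OF y] that level_cut_one[OF \<delta>, of "f (\<Phi> y (- ?r))"] by simp
  assume "weight \<delta> y s \<noteq> 0"
  then have s: "s \<in> {- ?r..?r}" "level_kernel \<delta> (f (\<Phi> y s)) \<noteq> 0" by (auto simp: weight_def indicator_def split: if_splits)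
  then have "\<not> (f (\<Phi> y s) \<le> - 3 * \<delta> \<or> f (\<Phi> y s) \<ge> - \<delta>)" using level_kernel_zero[OF \<delta>, of "f (\<Phi> y s)"] by blast
  then have "\<bar>f (\<Phi> y s)\<bar> \<le> 3 * \<delta>" using \<delta> by linarith
  moreover have "\<bar>s - g y\<bar> * (a / 2) \<le> \<bar>f (\<Phi> y s)\<bar>" using s(1) by (intro g_unique y) (auto simp: abs_le_iff)
  ultimately show "\<bar>s - g y\<bar> * (a / 2) \<le> 3 * \<delta>" by linarith
qed

lemma line_limit:
  assumes y: "y \<in> D" and \<theta>: "continuous_on V \<theta>" and \<delta>: "\<And>k. \<delta> k > 0" "\<delta> \<longlonglongrightarrow> 0"
    and meas: "\<And>k. integrable lborel (\<lambda>s. weight (\<delta> k) y s * (indicator {- \<rho> / 2<..<\<rho> / 2} s * \<theta> (\<Phi> y s)))"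
  shows "(\<lambda>k. LINT s|lborel. weight (\<delta> k) y s * (indicator {- \<rho> / 2<..<\<rho> / 2} s * \<theta> (\<Phi> y s))) \<longlonglongrightarrow> \<theta> (\<gamma> y)"
proof (rule LIMSEQ_I)
  fix \<epsilon> :: real assume \<epsilon>: "0 < \<epsilon>"
  let ?I = "{- \<rho> / 2<..<\<rho> / 2}"
  have gy: "g y \<in> ?I" using g(1)[OF y] by auto
  have "continuous_on ?I (\<lambda>s. \<theta> (\<Phi> y s))"
  proof (rule continuous_on_compose2[OF \<theta>])
    show "continuous_on ?I (\<Phi> y)" unfolding \<Phi>_def by (intro continuous_intros)
  qed (use y in \<open>force simp: V_def abs_less_iff\<close>)
  then have "isCont (\<lambda>s. \<theta> (\<Phi> y s)) (g y)" using gy by (simp add: continuous_on_eq_continuous_at)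
  then have "\<forall>\<^sub>F s in at (g y). dist (\<theta> (\<Phi> y s)) (\<theta> (\<gamma> y)) < \<epsilon> / 2"
    using \<epsilon> unfolding isCont_def \<gamma>_def by (intro tendstoD) auto
  moreover have "\<forall>\<^sub>F s in at (g y). s \<in> ?I" using gy by (intro eventually_at_in_open') auto
  ultimately have "\<forall>\<^sub>F s in at (g y). s \<in> ?I \<and> dist (\<theta> (\<Phi> y s)) (\<theta> (\<gamma> y)) < \<epsilon> / 2" by eventually_elim simp
  then obtain d where d: "d > 0" "\<And>s. s \<noteq> g y \<Longrightarrow> dist s (g y) < d \<Longrightarrow> s \<in> ?I \<and> dist (\<theta> (\<Phi> y s)) (\<theta> (\<gamma> y)) < \<epsilon> / 2"
    unfolding eventually_at by auto
  have d': "s \<in> ?I \<and> \<bar>\<theta> (\<Phi> y s) - \<theta> (\<gamma> y)\<bar> \<le> \<epsilon> / 2" if "\<bar>s - g y\<bar> < d" for s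
    using d(2)[of s] that gy \<epsilon> by (cases "s = g y") (auto simp: dist_real_def \<gamma>_def)
  \<comment> \<open>The first bound puts the support of the weight within \<open>d\<close> of
    \<open>g y\<close>, the second one gives it total mass 1.\<close>
  define b where "b = min (d * (a / 2)) (a * \<rho> / 8)"
  have b: "b > 0" using d(1) pos by (simp add: b_def)
  have "(\<lambda>k. 3 * \<delta> k) \<longlonglongrightarrow> 3 * 0" by (intro tendsto_intros \<delta>)
  then have "\<forall>\<^sub>F k in sequentially. 3 * \<delta> k < b" using b by (intro order_tendstoD) auto
  then obtain N where N: "\<And>k. k \<ge> N \<Longrightarrow> 3 * \<delta> k < b" by (auto simp: eventually_sequentially)
  have "norm ((LINT s|lborel. weight (\<delta> k) y s * (indicator ?I s * \<theta> (\<Phi> y s))) - \<theta> (\<gamma> y)) < \<epsilon>" if k: "k \<ge> N" for k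
  proof -
    let ?w = "weight (\<delta> k) y"
    note w = weight[OF y \<delta>(1)[of k]]
    have kb: "3 * \<delta> k < d * (a / 2)" "3 * \<delta> k \<le> a * \<rho> / 8" using N[OF k] by (auto simp: b_def)
    have le: "\<bar>?w s * (indicator ?I s * \<theta> (\<Phi> y s)) - ?w s * \<theta> (\<gamma> y)\<bar> \<le> ?w s * (\<epsilon> / 2)" for s
    proof (cases "?w s = 0")
      case False
      then have "\<bar>s - g y\<bar> * (a / 2) < d * (a / 2)" using w(5) kb(1) by force
      then have "\<bar>s - g y\<bar> < d" using pos by (simp only: mult_less_cancel_right_pos half_gt_zero_iff)
      from d'[OF this] have "\<bar>indicator ?I s * \<theta> (\<Phi> y s) - \<theta> (\<gamma> y)\<bar> \<le> \<epsilon> / 2" by simp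
      then have "\<bar>?w s\<bar> * \<bar>indicator ?I s * \<theta> (\<Phi> y s) - \<theta> (\<gamma> y)\<bar> \<le> \<bar>?w s\<bar> * (\<epsilon> / 2)" by (intro mult_left_mono) auto
      then show ?thesis using w(2)[of s] by (simp only: right_diff_distrib[symmetric] abs_mult abs_of_nonneg)
    qed simp
    have one: "(LINT s|lborel. ?w s * c) = c" for c
      unfolding integral_mult_left_zero w(4)[OF kb(2)] by (rule mult_1)
    have "norm (LINT s|lborel. ?w s * (indicator ?I s * \<theta> (\<Phi> y s)) - ?w s * \<theta> (\<gamma> y)) \<le> (LINT s|lborel. ?w s * (\<epsilon> / 2))"
    proof (rule Bochner_Integration.integral_norm_bound_integral)
      show "integrable lborel (\<lambda>s. ?w s * (indicator ?I s * \<theta> (\<Phi> y s)) - ?w s * \<theta> (\<gamma> y))"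
        using meas[of k] w(1) by (intro Bochner_Integration.integrable_diff integrable_mult_left)
      show "integrable lborel (\<lambda>s. ?w s * (\<epsilon> / 2))" using w(1) by (rule integrable_mult_left)
    qed (rule le[folded real_norm_def])
    moreover have "(LINT s|lborel. ?w s * (indicator ?I s * \<theta> (\<Phi> y s)) - ?w s * \<theta> (\<gamma> y))
      = (LINT s|lborel. ?w s * (indicator ?I s * \<theta> (\<Phi> y s))) - \<theta> (\<gamma> y)"
      using Bochner_Integration.integral_diff[OF meas[of k] integrable_mult_left[OF w(1), of "\<theta> (\<gamma> y)"]] unfolding one .
    ultimately show ?thesis using \<epsilon> unfolding one by simp
  qed
  then show "\<exists>N. \<forall>k\<ge>N. norm ((LINT s|lborel. weight (\<delta> k) y s * (indicator ?I s * \<theta> (\<Phi> y s))) - \<theta> (\<gamma> y)) < \<epsilon>" by blast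
qed

lemma bounded_V: "bounded V"
  using V_subset_ball bounded_ball bounded_subset by blast

lemma integrable_indicator_V:
  fixes h :: "'a \<Rightarrow> real"
  assumes "continuous_on V h" "\<And>x. x \<in> V \<Longrightarrow> \<bar>h x\<bar> \<le> C"
  shows "integrable lborel (\<lambda>x. indicator V x *\<^sub>R h x)"
proof (rule Bochner_Integration.integrable_bound)
  have "emeasure lborel V < \<infinity>" using bounded_V by (rule emeasure_bounded_finite)
  then show "integrable lborel (\<lambda>x. indicator V x *\<^sub>R C)"
    using chart_sets(2) by (intro integrable_scaleR_left integrable_real_indicator) auto
  show "(\<lambda>x. indicator V x *\<^sub>R h x) \<in> borel_measurable lborel"
    using borel_measurable_continuous_on_indicator[OF chart_sets(2) assms(1)] by simp
  show "AE x in lborel. norm (indicator V x *\<^sub>R h x) \<le> norm (indicator V x *\<^sub>R C)"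
    using assms(2) by (intro AE_I2) (force simp: indicator_def)
qed

text \<open>Dividing \<open>\<psi>\<close> by the normal slope pays for the slope built into
  \<open>weight\<close>. On each normal line the weights then form an approximate identity at the
  graph, and the line integrals are dominated by a constant on the bounded set
  \<open>D\<close>.\<close>

lemma chart_limit:
  assumes \<psi>: "continuous_on V \<psi>" "\<And>x. x \<in> V \<Longrightarrow> 0 \<le> \<psi> x" "\<And>x. x \<in> V \<Longrightarrow> \<psi> x \<le> B"
    and \<delta>: "\<And>k. \<delta> k > 0" "\<delta> \<longlonglongrightarrow> 0"
  shows "(\<lambda>k. LINT x|lborel. indicator V x *\<^sub>R (level_kernel (\<delta> k) (f x) * \<psi> x)) \<longlonglongrightarrow> (LINT y|lborel. indicator D y *\<^sub>R (\<psi> (\<gamma> y) / (G (\<gamma> y) \<bullet> e)))"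
proof -
  let ?r = "\<rho> / 2"
  define \<theta> where "\<theta> x = \<psi> x / (G x \<bullet> e)" for x
  have Gp: "0 < G x \<bullet> e" "a / 2 \<le> G x \<bullet> e" if "x \<in> V" for x using that V_subset_ball G_e_pos G_e_half by auto
  have "0 \<le> B" using \<psi>(2,3)[OF p_in_V] by linarith
  have \<theta>b: "0 \<le> \<theta> x" "\<theta> x \<le> B / (a / 2)" if "x \<in> V" for x
  proof -
    show "0 \<le> \<theta> x" using that \<psi>(2) Gp by (simp add: \<theta>_def less_imp_le)
    show "\<theta> x \<le> B / (a / 2)" unfolding \<theta>_def using \<psi>(3)[OF that] \<open>0 \<le> B\<close> Gp(2)[OF that] pos by (intro frac_le) auto
  qed
  have \<theta>c: "continuous_on V \<theta>"
    unfolding \<theta>_def using \<psi>(1) continuous_on_subset[OF contG V_subset_ball] Gp(1) by (intro continuous_intros) force+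
  define F where "F k x = indicator V x *\<^sub>R (level_kernel (\<delta> k) (f x) * \<psi> x)" for k x
  have Fint: "integrable lborel (F k)" for k
  proof -
    have "continuous_on V (\<lambda>x. level_kernel (\<delta> k) (f x) * \<psi> x)"
      using \<psi>(1) continuous_on_subset[OF continuous_on_f V_subset_ball]
      by (intro continuous_on_mult continuous_on_compose2[OF continuous_on_level_kernel[OF \<delta>(1), of UNIV]]) auto
    moreover have "\<bar>level_kernel (\<delta> k) (f x) * \<psi> x\<bar> \<le> 1 / \<delta> k * B" if "x \<in> V" for x
      using \<psi>(2,3)[OF that] level_kernel_nonneg[OF \<delta>(1)] level_kernel_le[OF \<delta>(1)] \<delta>(1)[of k] unfolding abs_mult
      by (intro mult_mono) (auto simp: less_imp_le)
    ultimately show ?thesis unfolding F_def by (rule integrable_indicator_V)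
  qed
  have meas\<Phi>: "(\<lambda>z. \<Phi> (fst z) (snd z)) \<in> lborel \<rightarrow>\<^sub>M lborel"
    using borel_measurable_continuous_onI[OF continuous_on_\<Phi>] by simp
  define h where "h k z = F k (\<Phi> (fst z) (snd z))" for k and z :: "'b \<times> real"
  have hint: "integrable (lborel \<Otimes>\<^sub>M lborel) (h k)" for k
    using integrable_distr[OF meas\<Phi>, of "F k"] Fint[of k] lborel_\<Phi> unfolding h_def lborel_prod by simp
  have heq: "h k (y, s) = weight (\<delta> k) y s * (indicator {- ?r<..<?r} s * \<theta> (\<Phi> y s))" if y: "y \<in> D" for k y s
  proof (cases "s \<in> {- ?r<..<?r}")
    case True
    then have "\<Phi> y s \<in> V" using y by (force simp: V_def abs_less_iff)
    moreover from this have "G (\<Phi> y s) \<bullet> e \<noteq> 0" using Gp(1) by force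
    ultimately show ?thesis using True by (simp add: h_def F_def weight_def \<theta>_def)
  next
    case False
    then have "\<Phi> y s \<notin> V" by (auto simp: V_def \<Phi>_inject abs_less_iff)
    then show ?thesis using False by (simp add: h_def F_def)
  qed
  have h0: "h k (y, s) = 0" if "y \<notin> D" for k y s
    using that by (auto simp: h_def F_def V_def \<Phi>_inject indicator_def)
  define E where "E = B / (a / 2)"
  have E: "0 \<le> E" using \<open>0 \<le> B\<close> pos by (simp add: E_def)
  have ib: "0 \<le> indicator {- ?r<..<?r} s * \<theta> (\<Phi> y s)" "indicator {- ?r<..<?r} s * \<theta> (\<Phi> y s) \<le> E" if y: "y \<in> D" for y s
  proof -
    have "\<Phi> y s \<in> V" if "s \<in> {- ?r<..<?r}" using that y by (force simp: V_def abs_less_iff)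
    then show "0 \<le> indicator {- ?r<..<?r} s * \<theta> (\<Phi> y s)" "indicator {- ?r<..<?r} s * \<theta> (\<Phi> y s) \<le> E"
      using \<theta>b E by (auto simp: indicator_def E_def)
  qed
  define I where "I k y = (LINT s|lborel. h k (y, s))" for k y
  have LHS: "(LINT x|lborel. F k x) = (LINT y|lborel. I k y)" for k
  proof -
    have "(LINT x|lborel. F k x) = (LINT x|distr lborel lborel (\<lambda>z. \<Phi> (fst z) (snd z)). F k x)" by (simp only: lborel_\<Phi>)
    also have "\<dots> = (LINT z|lborel. h k z)" unfolding h_def using Fint[of k] by (intro integral_distr meas\<Phi>) auto
    also have "\<dots> = (LINT z|(lborel \<Otimes>\<^sub>M lborel). h k z)" by (simp only: lborel_prod)
    also have "\<dots> = (LINT y|lborel. I k y)" unfolding I_def by (rule lborel_pair.integral_fst'[symmetric, OF hint])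
    finally show ?thesis .
  qed
  have Imeas: "integrable lborel (I k)" for k unfolding I_def by (rule lborel_pair.integrable_fst'[OF hint])
  have sec: "integrable lborel (\<lambda>s. h k (y, s))" if "y \<in> D" for k y
  proof -
    have "continuous_on {- ?r<..<?r} (\<lambda>s. \<theta> (\<Phi> y s))"
    proof (rule continuous_on_compose2[OF \<theta>c])
      show "continuous_on {- ?r<..<?r} (\<Phi> y)" unfolding \<Phi>_def by (intro continuous_intros)
    qed (use that in \<open>force simp: V_def abs_less_iff\<close>)
    then have m: "(\<lambda>s. indicator {- ?r<..<?r} s *\<^sub>R \<theta> (\<Phi> y s)) \<in> borel_measurable borel"
      by (intro borel_measurable_continuous_on_indicator) auto
    show ?thesis unfolding heq[OF that]
    proof (rule Bochner_Integration.integrable_bound[OF integrable_mult_left[OF weight(1)[OF that \<delta>(1)[of k]], of E]])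
      show "(\<lambda>s. weight (\<delta> k) y s * (indicator {- ?r<..<?r} s * \<theta> (\<Phi> y s))) \<in> borel_measurable lborel"
        by (rule borel_measurable_times[OF borel_measurable_integrable[OF weight(1)[OF that \<delta>(1)[of k]]]]) (use m in simp)
      show "AE s in lborel. norm (weight (\<delta> k) y s * (indicator {- ?r<..<?r} s * \<theta> (\<Phi> y s))) \<le> norm (weight (\<delta> k) y s * E)"
        unfolding real_norm_def abs_mult[of "weight (\<delta> k) y _"] abs_of_nonneg[OF ib(1)[OF that]] abs_of_nonneg[OF E]
        by (intro AE_I2 mult_left_mono ib that) simp
    qed
  qed
  have lim: "(\<lambda>k. I k y) \<longlonglongrightarrow> indicator D y *\<^sub>R \<theta> (\<gamma> y)" for y
  proof (cases "y \<in> D")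
    case True
    show ?thesis using line_limit[OF True \<theta>c \<delta>] sec[OF True] True unfolding I_def heq[OF True] by simp
  qed (simp add: I_def h0)
  have bound: "norm (I k y) \<le> indicator D y *\<^sub>R E" for k y
  proof (cases "y \<in> D")
    case True
    note w = weight[OF True \<delta>(1)[of k]]
    have "norm (I k y) \<le> (LINT s|lborel. weight (\<delta> k) y s * E)"
      unfolding I_def
    proof (rule Bochner_Integration.integral_norm_bound_integral[OF sec[OF True] integrable_mult_left[OF w(1)]])
      fix s
      show "norm (h k (y, s)) \<le> weight (\<delta> k) y s * E"
        unfolding heq[OF True] real_norm_def abs_mult[of "weight (\<delta> k) y _"] abs_of_nonneg[OF ib(1)[OF True]] abs_of_nonneg[OF w(2)]
        by (intro mult_left_mono ib True w)
    qed
    also have "\<dots> \<le> 1 * E"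
      unfolding integral_mult_left_zero using w(3) E by (intro mult_right_mono) auto
    finally show ?thesis using True by simp
  qed (simp add: I_def h0)
  have "(\<lambda>k. LINT y|lborel. I k y) \<longlonglongrightarrow> (LINT y|lborel. indicator D y *\<^sub>R \<theta> (\<gamma> y))"
  proof (rule integral_dominated_convergence[where w = "\<lambda>y. indicator D y *\<^sub>R E"])
    show "(\<lambda>y. indicator D y *\<^sub>R \<theta> (\<gamma> y)) \<in> borel_measurable lborel"
      by (rule borel_measurable_LIMSEQ_real[OF lim borel_measurable_integrable[OF Imeas]])
    show "integrable lborel (\<lambda>y. indicator D y *\<^sub>R E)"
      using emeasure_lborel_ball_finite by (intro integrable_scaleR_left integrable_real_indicator) (auto simp: D_def)
  qed (use lim bound Imeas in auto)
  then show ?thesis unfolding LHS[symmetric] F_def \<theta>_def .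
qed

lemma \<gamma>_in_V: "y \<in> D \<Longrightarrow> \<gamma> y \<in> V"
  using \<gamma>_image by blast

text \<open>The chart limit \<open>l\<close> and the surface integral are both compared with
  \<open>M\<close>, the integral over \<open>D\<close> of the density divided by
  \<open>norm (G (\<gamma> y))\<close>. Replacing the norm by the normal slope costs at most (1 +
  eta)/(1 - eta), replacing Lebesgue by surface measure at most (1 + 2 eta)^m with m the dimension
  of \<open>'b\<close>. Both quantities thus lie between \<open>M\<close> and (1 + epsilon)
  \<open>M\<close>.\<close>

lemma chart_compare:
  assumes \<psi>: "continuous_on V \<psi>" "\<And>x. x \<in> V \<Longrightarrow> 0 \<le> \<psi> x" "\<And>x. x \<in> V \<Longrightarrow> \<psi> x \<le> B"
    and \<epsilon>: "(1 + 2 * \<eta>) ^ DIM('b) \<le> 1 + \<epsilon>" "(1 + \<eta>) / (1 - \<eta>) \<le> 1 + \<epsilon>" "0 < \<epsilon>"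
  defines "\<phi> \<equiv> \<lambda>x. indicator {x\<in>V. f x = 0} x *\<^sub>R (\<psi> x / norm (G x))"
    and "l \<equiv> (LINT y|lborel. indicator D y *\<^sub>R (\<psi> (\<gamma> y) / (G (\<gamma> y) \<bullet> e)))"
  shows "integrable surface_measure \<phi>"
    and "\<bar>l - (LINT x|surface_measure. \<phi> x)\<bar> \<le> \<epsilon> * (LINT x|surface_measure. \<phi> x)"
proof -
  have Gp: "0 < G x \<bullet> e" "a / 2 \<le> G x \<bullet> e" "a / 2 \<le> norm (G x)" "norm (G x) \<le> (1 + \<epsilon>) * (G x \<bullet> e)" if "x \<in> V" for x
  proof -
    have x: "x \<in> ball p \<rho>" using that V_subset_ball by blast
    show "0 < G x \<bullet> e" "a / 2 \<le> G x \<bullet> e" using x G_e_pos G_e_half by auto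
    then show "a / 2 \<le> norm (G x)" using G_e_le[of x] by linarith
    have "norm (G x) \<le> (1 + \<eta>) / (1 - \<eta>) * ((1 - \<eta>) * a)" using norm_G[OF x] pos by simp
    also have "\<dots> \<le> (1 + \<eta>) / (1 - \<eta>) * (G x \<bullet> e)" using G_e[OF x] pos by (intro mult_left_mono) auto
    also have "\<dots> \<le> (1 + \<epsilon>) * (G x \<bullet> e)" using \<open>0 < G x \<bullet> e\<close> \<epsilon> by (intro mult_right_mono) auto
    finally show "norm (G x) \<le> (1 + \<epsilon>) * (G x \<bullet> e)" .
  qed
  have "0 \<le> B" using \<psi>(2,3)[OF p_in_V] by linarith
  define E where "E = B / (a / 2)"
  have E: "0 \<le> E" using \<open>0 \<le> B\<close> pos by (simp add: E_def)
  have q: "0 \<le> \<psi> x / norm (G x)" "\<psi> x / norm (G x) \<le> \<psi> x / (G x \<bullet> e)" "\<psi> x / (G x \<bullet> e) \<le> (1 + \<epsilon>) * (\<psi> x / norm (G x))" 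
    "\<psi> x / (G x \<bullet> e) \<le> E" if x: "x \<in> V" for x
  proof -
    show "0 \<le> \<psi> x / norm (G x)" using \<psi>(2)[OF x] by simp
    show "\<psi> x / norm (G x) \<le> \<psi> x / (G x \<bullet> e)" using \<psi>(2)[OF x] Gp(1)[OF x] G_e_le[of x] by (intro divide_left_mono mult_pos_pos) linarith+
    have "0 < norm (G x)" using Gp(3)[OF x] pos by linarith
    have "1 / (G x \<bullet> e) \<le> (1 + \<epsilon>) / norm (G x)" using Gp(1,4)[OF x] \<open>0 < norm (G x)\<close> by (simp add: field_simps)
    from mult_left_mono[OF this \<psi>(2)[OF x]]
    show "\<psi> x / (G x \<bullet> e) \<le> (1 + \<epsilon>) * (\<psi> x / norm (G x))" by (simp add: mult.commute)
    show "\<psi> x / (G x \<bullet> e) \<le> E" unfolding E_def using \<psi>(3)[OF x] \<open>0 \<le> B\<close> Gp(2)[OF x] pos by (intro frac_le) auto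
  qed
  have contV: "continuous_on V (\<lambda>x. \<psi> x / norm (G x))" "continuous_on V (\<lambda>x. \<psi> x / (G x \<bullet> e))"
    using \<psi>(1) continuous_on_subset[OF contG V_subset_ball] Gp(1,3) pos by (auto intro!: continuous_intros) force+
  have \<phi>meas: "\<phi> \<in> borel_measurable borel"
    unfolding \<phi>_def using contV(1) by (intro borel_measurable_continuous_on_indicator chart_sets) (auto elim: continuous_on_subset)
  have \<phi>0: "0 \<le> \<phi> x" for x using q(1) by (auto simp: \<phi>_def indicator_def)
  have \<phi>\<gamma>: "\<phi> (\<gamma> y) = \<psi> (\<gamma> y) / norm (G (\<gamma> y))" if "y \<in> D" for y
    using that \<gamma>_image unfolding \<phi>_def by (metis (no_types, lifting) image_eqI indicator_simps(1) scaleR_one)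
  have m1: "(\<lambda>y. indicator D y *\<^sub>R (\<psi> (\<gamma> y) / norm (G (\<gamma> y)))) \<in> borel_measurable borel"
    and m2: "(\<lambda>y. indicator D y *\<^sub>R (\<psi> (\<gamma> y) / (G (\<gamma> y) \<bullet> e))) \<in> borel_measurable borel"
    by (intro borel_measurable_continuous_on_indicator chart_sets continuous_on_compose2[OF contV(1) continuous_on_\<gamma>] 
        continuous_on_compose2[OF contV(2) continuous_on_\<gamma>]; use \<gamma>_in_V in blast)+
  define M where "M = (LINT y|lborel. indicator D y *\<^sub>R (\<psi> (\<gamma> y) / norm (G (\<gamma> y))))"
  have Dint: "integrable lborel (\<lambda>y. indicator D y *\<^sub>R E)"
    using emeasure_lborel_ball_finite by (intro integrable_scaleR_left integrable_real_indicator) (auto simp: D_def)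
  have i1: "integrable lborel (\<lambda>y. indicator D y *\<^sub>R (\<psi> (\<gamma> y) / norm (G (\<gamma> y))))"
  proof (rule Bochner_Integration.integrable_bound[OF Dint])
    have "norm (indicator D y *\<^sub>R (\<psi> (\<gamma> y) / norm (G (\<gamma> y)))) \<le> norm (indicator D y *\<^sub>R E)" for y
      using q(1,2,4)[OF \<gamma>_in_V, of y] E by (cases "y \<in> D") auto
    then show "AE y in lborel. norm (indicator D y *\<^sub>R (\<psi> (\<gamma> y) / norm (G (\<gamma> y)))) \<le> norm (indicator D y *\<^sub>R E)" by simp
  qed (use m1 in simp)
  have i2: "integrable lborel (\<lambda>y. indicator D y *\<^sub>R (\<psi> (\<gamma> y) / (G (\<gamma> y) \<bullet> e)))"
  proof (rule Bochner_Integration.integrable_bound[OF Dint])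
    have "norm (indicator D y *\<^sub>R (\<psi> (\<gamma> y) / (G (\<gamma> y) \<bullet> e))) \<le> norm (indicator D y *\<^sub>R E)" for y
      using q(1,2,4)[OF \<gamma>_in_V, of y] E by (cases "y \<in> D") auto
    then show "AE y in lborel. norm (indicator D y *\<^sub>R (\<psi> (\<gamma> y) / (G (\<gamma> y) \<bullet> e))) \<le> norm (indicator D y *\<^sub>R E)" by simp
  qed (use m2 in simp)
  have Ml: "M \<le> l"
    unfolding M_def l_def using q(2)[OF \<gamma>_in_V] by (intro integral_mono i1 i2) (auto simp: indicator_def)
  have "l \<le> (LINT y|lborel. (1 + \<epsilon>) * (indicator D y *\<^sub>R (\<psi> (\<gamma> y) / norm (G (\<gamma> y)))))"
    unfolding l_def using q(3)[OF \<gamma>_in_V] by (intro integral_mono integrable_mult_right i1 i2) (auto simp: indicator_def)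
  then have lM: "l \<le> (1 + \<epsilon>) * M" unfolding M_def by (simp only: integral_mult_right_zero)
  define Mn where "Mn = (\<integral>\<^sup>+y. ennreal (\<phi> (\<gamma> y)) * indicator D y \<partial>lborel)"
  define Sn where "Sn = (\<integral>\<^sup>+x. ennreal (\<phi> x) * indicator {x\<in>V. f x = 0} x \<partial>surface_measure)"
  have comp: "Mn \<le> Sn" "Sn \<le> ennreal ((1 + 2 * \<eta>) ^ DIM('b)) * Mn"
    unfolding Mn_def Sn_def using \<phi>meas by (intro chart_surface_nn_integral; simp)+
  have Mn: "Mn = ennreal M"
  proof -
    have "Mn = (\<integral>\<^sup>+y. ennreal (indicator D y *\<^sub>R (\<psi> (\<gamma> y) / norm (G (\<gamma> y)))) \<partial>lborel)"
      unfolding Mn_def by (intro nn_integral_cong) (auto simp: \<phi>\<gamma> indicator_def)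
    also have "\<dots> = ennreal M" unfolding M_def using q(1)[OF \<gamma>_in_V] by (intro nn_integral_eq_integral i1) (auto simp: indicator_def)
    finally show ?thesis .
  qed
  have Sn: "Sn = (\<integral>\<^sup>+x. ennreal (\<phi> x) \<partial>surface_measure)"
    unfolding Sn_def by (intro nn_integral_cong) (auto simp: \<phi>_def indicator_def)
  have "Sn < top" using comp(2) Mn by (auto simp: ennreal_mult_less_top intro: le_less_trans)
  then show int: "integrable surface_measure \<phi>"
    using \<phi>meas \<phi>0 Sn by (intro integrableI_nonneg) (auto cong: measurable_cong_sets)
  have M0: "0 \<le> M" unfolding M_def using q(1)[OF \<gamma>_in_V] by (intro integral_nonneg_AE) (auto simp: indicator_def)
  let ?S = "LINT x|surface_measure. \<phi> x"
  have Sn': "Sn = ennreal ?S" unfolding Sn using int \<phi>0 by (intro nn_integral_eq_integral) auto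
  have S0: "0 \<le> ?S" using \<phi>0 by (intro integral_nonneg_AE) auto
  have "M \<le> ?S" using comp(1) S0 by (simp add: Mn Sn')
  have "ennreal ?S \<le> ennreal ((1 + 2 * \<eta>) ^ DIM('b) * M)" using comp(2) M0 pos by (simp add: Mn Sn' ennreal_mult)
  then have "?S \<le> (1 + 2 * \<eta>) ^ DIM('b) * M" using M0 pos by (subst (asm) ennreal_le_iff) auto
  also have "\<dots> \<le> (1 + \<epsilon>) * M" using \<epsilon> M0 by (intro mult_right_mono)
  finally have "?S \<le> M + \<epsilon> * M" by (simp add: algebra_simps)
  moreover have "\<epsilon> * M \<le> \<epsilon> * ?S" using \<epsilon>(3) \<open>M \<le> ?S\<close> by simp
  ultimately show "\<bar>l - ?S\<bar> \<le> \<epsilon> * ?S" using Ml lM[unfolded distrib_right mult_1] \<open>M \<le> ?S\<close> by linarith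
qed

end

section \<open>From charts to the whole boundary\<close>

text \<open>The orthogonal complement of \<open>e\<close> has the dimension of \<open>'b\<close>,
  and subspaces of equal dimension are isometric. Modelling it on a type of its own provides the
  Lebesgue measure over which the graph is parametrised.\<close>

lemma isometry_frame:
  fixes e :: "'a::euclidean_space"
  assumes e: "norm e = 1" and dim: "DIM('a) = DIM('b::euclidean_space) + 1"
  obtains L :: "'b::euclidean_space \<Rightarrow> 'a" where "linear L" "\<And>y. norm (L y) = norm y" "\<And>y. L y \<bullet> e = 0" 
    "\<And>x. \<exists>y. x = L y + (x \<bullet> e) *\<^sub>R e"
proof -
  have "e \<noteq> 0" using e by auto
  have "dim (UNIV :: 'b set) = dim {x. e \<bullet> x = 0}" using dim dim_hyperplane[OF \<open>e \<noteq> 0\<close>] by simp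
  then obtain L :: "'b \<Rightarrow> 'a" where L: "linear L" "L ` UNIV = {x. e \<bullet> x = 0}" "\<And>x. x \<in> UNIV \<Longrightarrow> norm (L x) = norm x"
    by (rule isometry_subspaces[OF subspace_UNIV subspace_hyperplane]) auto
  have orth: "L y \<bullet> e = 0" for y using L(2) by (auto simp: inner_commute)
  have surj: "\<exists>y. x = L y + (x \<bullet> e) *\<^sub>R e" for x
  proof -
    have "e \<bullet> e = 1" using e by (simp add: norm_eq_1)
    then have "e \<bullet> (x - (x \<bullet> e) *\<^sub>R e) = 0" by (simp add: inner_simps inner_commute)
    then have "x - (x \<bullet> e) *\<^sub>R e \<in> range L" using L(2) by simp
    then obtain y where "x - (x \<bullet> e) *\<^sub>R e = L y" by blast
    then show ?thesis by (intro exI[of _ y]) (simp add: algebra_simps)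
  qed
  from that[OF L(1) L(3)[OF UNIV_I] orth surj] show ?thesis .
qed

locale C1_domain =
  fixes \<Omega> U :: "'a::euclidean_space set" and f :: "'a \<Rightarrow> real" and G :: "'a \<Rightarrow> 'a"
  assumes bounded: "bounded \<Omega>" and open_\<Omega>: "open \<Omega>" and open_U: "open U" and closure_U: "closure \<Omega> \<subseteq> U"
    and deriv: "\<And>x. x \<in> U \<Longrightarrow> (f has_derivative (\<lambda>h. G x \<bullet> h)) (at x)"
    and contG: "continuous_on U G"
    and sublevel: "\<Omega> = {x\<in>U. f x < 0}" and level: "frontier \<Omega> = {x\<in>U. f x = 0}"
    and regular: "\<And>x. x \<in> frontier \<Omega> \<Longrightarrow> G x \<noteq> 0"
begin

text \<open>Dividing by the norm of the gradient is the coarea factor: between levels that differ by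
  dt the domain has thickness dt / |grad f|.\<close>

definition bdry :: "('a \<Rightarrow> real) \<Rightarrow> 'a \<Rightarrow> real" where
  "bdry \<psi> x = indicator (frontier \<Omega>) x *\<^sub>R (\<psi> x / norm (G x))"

definition layer :: "(nat \<Rightarrow> real) \<Rightarrow> ('a \<Rightarrow> real) \<Rightarrow> nat \<Rightarrow> real" where
  "layer \<delta> \<psi> k = (LINT x|lborel. indicator \<Omega> x *\<^sub>R (level_kernel (\<delta> k) (f x) * \<psi> x))"

definition almost_limit :: "(nat \<Rightarrow> real) \<Rightarrow> real \<Rightarrow> ('a \<Rightarrow> real) \<Rightarrow> bool" where
  "almost_limit \<delta> \<epsilon> \<psi> \<longleftrightarrow> integrable surface_measure (bdry \<psi>) \<and>
    (\<exists>l. layer \<delta> \<psi> \<longlonglongrightarrow> l \<and> \<bar>l - (LINT x|surface_measure. bdry \<psi> x)\<bar> \<le> \<epsilon> * (LINT x|surface_measure. bdry \<psi> x))"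

lemma continuous_on_f: "continuous_on U f"
  using deriv has_derivative_continuous by (intro continuous_at_imp_continuous_on) blast

lemma \<Omega>_subset_U: "\<Omega> \<subseteq> U" using sublevel by blast

text \<open>\<open>\<eta>\<close> is chosen so small that both distortion factors of a chart are
  below 1 + epsilon, then \<open>\<rho>\<close> so small that the gradient varies by at most
  \<open>\<eta> * a\<close> on the ball. Points of the chart outside the domain do not contribute,
  because there \<open>f\<close> is nonnegative and the kernel vanishes.\<close>

lemma almost_limit_boundary:
  assumes dim: "DIM('a) = DIM('b::euclidean_space) + 1"
    and p: "p \<in> frontier \<Omega>" and \<epsilon>: "0 < \<epsilon>" and \<delta>: "\<And>k. \<delta> k > 0" "\<delta> \<longlonglongrightarrow> 0"
  shows "\<exists>V. open V \<and> p \<in> V \<and> bounded V \<and> 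
    (\<forall>\<psi>. continuous_on UNIV \<psi> \<longrightarrow> (\<forall>x. 0 \<le> \<psi> x) \<longrightarrow> (\<forall>x. x \<notin> V \<longrightarrow> \<psi> x = 0) \<longrightarrow> almost_limit \<delta> \<epsilon> \<psi>)"
proof -
  have "((\<lambda>\<eta>. (1 + 2 * \<eta>) ^ DIM('b)) \<longlongrightarrow> (1 + 2 * 0) ^ DIM('b)) (at_right (0::real))" by (intro tendsto_intros)
  then have e1: "\<forall>\<^sub>F \<eta> in at_right (0::real). (1 + 2 * \<eta>) ^ DIM('b) < 1 + \<epsilon>" using \<epsilon> by (intro order_tendstoD) auto
  have "((\<lambda>\<eta>. (1 + \<eta>) / (1 - \<eta>)) \<longlongrightarrow> (1 + 0) / (1 - 0)) (at_right (0::real))" by (intro tendsto_intros) auto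
  then have e2: "\<forall>\<^sub>F \<eta> in at_right (0::real). (1 + \<eta>) / (1 - \<eta>) < 1 + \<epsilon>" using \<epsilon> by (intro order_tendstoD) auto
  have e3: "\<forall>\<^sub>F \<eta> in at_right (0::real). \<eta> \<in> {0<..<1/2}" by (rule eventually_at_right_real) simp
  have "\<forall>\<^sub>F \<eta> in at_right (0::real). (1 + 2 * \<eta>) ^ DIM('b) < 1 + \<epsilon> \<and> (1 + \<eta>) / (1 - \<eta>) < 1 + \<epsilon> \<and> \<eta> \<in> {0<..<1/2}"
    using e1 e2 e3 by eventually_elim simp
  then obtain \<eta> :: real where \<eta>: "(1 + 2 * \<eta>) ^ DIM('b) < 1 + \<epsilon>" "(1 + \<eta>) / (1 - \<eta>) < 1 + \<epsilon>" "0 < \<eta>" "\<eta> < 1 / 2"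
    using eventually_happens'[OF trivial_limit_at_right_real] by fastforce
  define a where "a = norm (G p)"
  define e where "e = (1 / a) *\<^sub>R G p"
  have pU: "p \<in> U" "f p = 0" using p level by auto
  have a: "0 < a" using regular[OF p] by (simp add: a_def)
  have e: "norm e = 1" "a *\<^sub>R e = G p" using a by (auto simp: e_def a_def)
  have "isCont G p" using contG open_U pU by (simp add: continuous_on_eq_continuous_at)
  then obtain r1 where r1: "r1 > 0" "\<And>x. dist x p < r1 \<Longrightarrow> dist (G x) (G p) < \<eta> * a"
    unfolding continuous_at_eps_delta using \<eta> a by (metis mult_pos_pos)
  obtain r2 where r2: "r2 > 0" "ball p r2 \<subseteq> U" using openE[OF open_U pU(1)] by metis
  define \<rho> where "\<rho> = min r1 r2"
  have \<rho>: "\<rho> > 0" "ball p \<rho> \<subseteq> U" using r1 r2 by (auto simp: \<rho>_def)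
  obtain L :: "'b \<Rightarrow> 'a" where L: "linear L" "\<And>y. norm (L y) = norm y" "\<And>y. L y \<bullet> e = 0" 
    "\<And>x. \<exists>y. x = L y + (x \<bullet> e) *\<^sub>R e"
    using isometry_frame[OF e(1) dim] by metis
  interpret graph_chart f G p e L a \<eta> \<rho>
  proof (rule graph_chart.intro)
    show "norm (G x - a *\<^sub>R e) \<le> \<eta> * a" if "x \<in> ball p \<rho>" for x
      using that r1(2)[of x] unfolding e by (simp add: \<rho>_def dist_norm norm_minus_commute less_imp_le)
    show "(f has_derivative (\<lambda>h. G x \<bullet> h)) (at x)" if "x \<in> ball p \<rho>" for x
      using deriv \<rho>(2) that by blast
    show "continuous_on (ball p \<rho>) G" by (rule continuous_on_subset[OF contG \<rho>(2)])
    show "\<exists>y. x = L y + (x \<bullet> e) *\<^sub>R e" for x by (rule L(4))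
    show "DIM('a) = DIM('b) + 1" by (rule dim)
  qed (use \<rho>(1) \<eta> a e(1) L(1-3) pU(2) in auto)
  have VU: "V \<subseteq> U" using V_subset_ball \<rho> by blast
  have lev: "{x\<in>V. f x = 0} = V \<inter> frontier \<Omega>" using VU level by auto
  have "almost_limit \<delta> \<epsilon> \<psi>" if \<psi>: "continuous_on UNIV \<psi>" "\<forall>x. 0 \<le> \<psi> x" "\<forall>x. x \<notin> V \<longrightarrow> \<psi> x = 0" for \<psi>
  proof -
    have "compact (\<psi> ` closure V)" using \<psi>(1) bounded_V by (intro compact_continuous_image) (auto intro: continuous_on_subset)
    from compact_imp_bounded[OF this] obtain B where "\<forall>y\<in>\<psi> ` closure V. norm y \<le> B"
      unfolding bounded_iff by metis
    then have B: "norm (\<psi> x) \<le> B" if "x \<in> closure V" for x using that by simp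
    have B': "\<psi> x \<le> B" if "x \<in> V" for x
      using B[OF subsetD[OF closure_subset that]] by (simp add: abs_le_iff)
    have cV: "continuous_on V \<psi>" using \<psi>(1) by (rule continuous_on_subset) simp
    have bd: "bdry \<psi> = (\<lambda>x. indicator {x\<in>V. f x = 0} x *\<^sub>R (\<psi> x / norm (G x)))"
      unfolding bdry_def lev using \<psi>(3) by (auto simp: indicator_def fun_eq_iff)
    have ly: "layer \<delta> \<psi> = (\<lambda>k. LINT x|lborel. indicator V x *\<^sub>R (level_kernel (\<delta> k) (f x) * \<psi> x))"
    proof
      fix k
      have "indicator \<Omega> x *\<^sub>R (level_kernel (\<delta> k) (f x) * \<psi> x) = indicator V x *\<^sub>R (level_kernel (\<delta> k) (f x) * \<psi> x)" for x
      proof (cases "x \<in> V \<and> x \<notin> \<Omega>")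
        case True
        then have "f x \<ge> 0" using VU sublevel by force
        then have "level_kernel (\<delta> k) (f x) = 0" using level_kernel_zero[OF \<delta>(1)[of k], of "f x"] \<delta>(1)[of k] by linarith
        then show ?thesis by simp
      next
        case False
        then show ?thesis using \<psi>(3) by (auto simp: indicator_def)
      qed
      then show "layer \<delta> \<psi> k = (LINT x|lborel. indicator V x *\<^sub>R (level_kernel (\<delta> k) (f x) * \<psi> x))" by (simp only: layer_def)
    qed
    show ?thesis
      unfolding almost_limit_def bd ly
      using chart_compare[OF cV _ B', of \<epsilon>] chart_limit[OF cV _ B' \<delta>] \<eta> \<psi>(2) \<epsilon> by (auto simp: less_imp_le)
  qed
  then show ?thesis using open_V p_in_V bounded_V by blast
qed

lemma frontier_disjoint: "x \<in> \<Omega> \<Longrightarrow> x \<notin> frontier \<Omega>"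
  using open_\<Omega> by (simp add: frontier_def interior_open)

text \<open>On a closed ball inside the domain \<open>f\<close> has a negative maximum. Once 3 delta
  is smaller than its absolute value, the kernel vanishes on the ball, and the boundary integral is
  0 as well.\<close>

lemma almost_limit_interior:
  assumes p: "p \<in> \<Omega>" and \<delta>: "\<And>k. \<delta> k > 0" "\<delta> \<longlonglongrightarrow> 0"
  shows "\<exists>V. open V \<and> p \<in> V \<and> bounded V \<and> 
    (\<forall>\<psi>. (\<forall>x. x \<notin> V \<longrightarrow> \<psi> x = 0) \<longrightarrow> almost_limit \<delta> \<epsilon> \<psi>)"
proof -
  obtain r where r: "r > 0" "cball p r \<subseteq> \<Omega>" using open_contains_cball open_\<Omega> p by metis
  have "continuous_on (cball p r) f" using continuous_on_f r \<Omega>_subset_U by (meson continuous_on_subset subset_trans)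
  then obtain q where q: "q \<in> cball p r" "\<And>x. x \<in> cball p r \<Longrightarrow> f x \<le> f q"
    using continuous_attains_sup[of "cball p r" f] r by auto
  have "f q < 0" using q(1) r sublevel by auto
  have "almost_limit \<delta> \<epsilon> \<psi>" if \<psi>: "\<forall>x. x \<notin> ball p r \<longrightarrow> \<psi> x = 0" for \<psi>
  proof -
    have "\<psi> x = 0" if "x \<in> frontier \<Omega>" for x
      using that \<psi> r frontier_disjoint by (metis ball_subset_cball subsetD)
    then have bd: "bdry \<psi> = (\<lambda>x. 0)" by (auto simp: bdry_def indicator_def fun_eq_iff)
    have "\<forall>\<^sub>F k in sequentially. \<delta> k < - f q / 3" using \<open>f q < 0\<close> by (intro order_tendstoD[OF \<delta>(2)]) simp
    then have "\<forall>\<^sub>F k in sequentially. layer \<delta> \<psi> k = 0"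
    proof eventually_elim
      case (elim k)
      have z: "indicator \<Omega> x *\<^sub>R (level_kernel (\<delta> k) (f x) * \<psi> x) = 0" for x
      proof (cases "x \<in> ball p r")
        case True
        have "f x \<le> f q" using q(2)[of x] True by simp
        then have "f x \<le> - 3 * \<delta> k" using elim by simp
        then have "level_kernel (\<delta> k) (f x) = 0" using level_kernel_zero[OF \<delta>(1)] by blast
        then show ?thesis by simp
      qed (use \<psi> in simp)
      show ?case by (simp only: layer_def z integral_zero)
    qed
    then have "layer \<delta> \<psi> \<longlonglongrightarrow> 0" by (rule tendsto_eventually)
    then show ?thesis by (auto simp: almost_limit_def bd)
  qed
  then have "\<forall>\<psi>. (\<forall>x. x \<notin> ball p r \<longrightarrow> \<psi> x = 0) \<longrightarrow> almost_limit \<delta> \<epsilon> \<psi>" by blast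
  moreover have "open (ball p r)" "p \<in> ball p r" "bounded (ball p r)" using r by simp_all
  ultimately show ?thesis by (metis (no_types))
qed

lemma compact_closure_\<Omega>: "compact (closure \<Omega>)"
  using bounded by simp

lemma continuous_on_level_kernel_f:
  assumes "\<delta> > 0"
  shows "continuous_on (closure \<Omega>) (\<lambda>x. level_kernel \<delta> (f x))"
  using continuous_on_subset[OF continuous_on_f closure_U]
  by (intro continuous_on_compose2[OF continuous_on_level_kernel[OF assms, of UNIV]]) auto

lemma layer_integrable:
  fixes \<psi> :: "'a \<Rightarrow> 'c::{banach, second_countable_topology}"
  assumes "\<delta> > 0" "continuous_on (closure \<Omega>) \<psi>"
  shows "integrable lborel (\<lambda>x. indicator \<Omega> x *\<^sub>R (level_kernel \<delta> (f x) *\<^sub>R \<psi> x))"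
proof -
  have "set_integrable lborel (closure \<Omega>) (\<lambda>x. level_kernel \<delta> (f x) *\<^sub>R \<psi> x)"
    unfolding set_integrable_def using assms
    by (intro borel_integrable_compact compact_closure_\<Omega> continuous_on_scaleR continuous_on_level_kernel_f)
  then have "set_integrable lborel \<Omega> (\<lambda>x. level_kernel \<delta> (f x) *\<^sub>R \<psi> x)"
    by (rule set_integrable_subset) (use open_\<Omega> closure_subset in auto)
  then show ?thesis by (simp add: set_integrable_def)
qed

lemma layer_cong: "(\<And>x. x \<in> closure \<Omega> \<Longrightarrow> \<psi> x = \<psi>' x) \<Longrightarrow> layer \<delta> \<psi> = layer \<delta> \<psi>'"
  unfolding layer_def using closure_subset[of \<Omega>] by (intro ext Bochner_Integration.integral_cong) (auto simp: indicator_def)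

lemma bdry_cong: "(\<And>x. x \<in> closure \<Omega> \<Longrightarrow> \<psi> x = \<psi>' x) \<Longrightarrow> bdry \<psi> = bdry \<psi>'"
  unfolding bdry_def by (auto simp: fun_eq_iff indicator_def frontier_def)

text \<open>A partition of unity over a finite cover of the compact closure gives an almost limit
  for every epsilon. The layer integrals themselves do not depend on epsilon, so there is one limit,
  whose distance from the boundary integral is at most any positive multiple of that
  integral.\<close>

lemma layer_limit_nonneg:
  assumes dim: "DIM('a) = DIM('b::euclidean_space) + 1"
    and \<psi>: "continuous_on UNIV \<psi>" "\<And>x. 0 \<le> \<psi> x" and \<delta>: "\<And>k. \<delta> k > 0" "\<delta> \<longlonglongrightarrow> 0"
  shows "integrable surface_measure (bdry \<psi>)" "layer \<delta> \<psi> \<longlonglongrightarrow> (LINT x|surface_measure. bdry \<psi> x)"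
proof -
  have main: "almost_limit \<delta> \<epsilon> \<psi>" if \<epsilon>: "\<epsilon> > 0" for \<epsilon>
  proof (cases "\<Omega> = {}")
    case True
    have "bdry \<psi> = (\<lambda>x. 0)" "layer \<delta> \<psi> = (\<lambda>k. 0)"
      unfolding fun_eq_iff bdry_def layer_def by (simp_all add: True)
    then show ?thesis by (auto simp: almost_limit_def)
  next
    case False
    have "\<exists>V. open V \<and> p \<in> V \<and> bounded V \<and> 
      (\<forall>\<psi>. continuous_on UNIV \<psi> \<longrightarrow> (\<forall>x. 0 \<le> \<psi> x) \<longrightarrow> (\<forall>x. x \<notin> V \<longrightarrow> \<psi> x = 0) \<longrightarrow> almost_limit \<delta> \<epsilon> \<psi>)"
      if "p \<in> closure \<Omega>" for p
    proof (cases "p \<in> \<Omega>")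
      case True
      from almost_limit_interior[OF this \<delta>] show ?thesis by metis
    next
      case False
      then have "p \<in> frontier \<Omega>" using that open_\<Omega> by (simp add: frontier_def interior_open)
      from almost_limit_boundary[OF dim this \<epsilon> \<delta>] show ?thesis .
    qed
    then obtain V where V: "\<And>p. p \<in> closure \<Omega> \<Longrightarrow> open (V p)" "\<And>p. p \<in> closure \<Omega> \<Longrightarrow> p \<in> V p" "\<And>p. p \<in> closure \<Omega> \<Longrightarrow> bounded (V p)"
      and VL: "\<And>p \<psi>. p \<in> closure \<Omega> \<Longrightarrow> continuous_on UNIV \<psi> \<Longrightarrow> \<forall>x. 0 \<le> \<psi> x \<Longrightarrow> \<forall>x. x \<notin> V p \<longrightarrow> \<psi> x = 0 \<Longrightarrow> almost_limit \<delta> \<epsilon> \<psi>"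
      by metis
    have "closure \<Omega> \<subseteq> (\<Union>p\<in>closure \<Omega>. V p)" using V(2) by blast
    then obtain F where F: "F \<subseteq> closure \<Omega>" "finite F" "closure \<Omega> \<subseteq> (\<Union>p\<in>F. V p)"
      using compactE_image[OF compact_closure_\<Omega>, of "closure \<Omega>" V] V(1) by metis
    \<comment> \<open>The distance to the complement is positive exactly on \<open>V p\<close>. In
      \<open>den\<close> the distance to the closure of the domain is added so that the quotients
      are continuous everywhere, while on the closure they still sum to 1.\<close>
    define b where "b p x = infdist x (- V p)" for p x
    define den where "den x = (\<Sum>p\<in>F. b p x) + infdist x (closure \<Omega>)" for x
    have b0: "0 \<le> b p x" for p x by (simp add: b_def infdist_nonneg)
    have bV: "b p x = 0" if "x \<notin> V p" for p x using that by (simp add: b_def)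
    have bpos: "0 < b p x" if "p \<in> F" "x \<in> V p" for p x
    proof -
      have "bounded (V p)" "open (V p)" using V F(1) that by auto
      \<comment> \<open>The reason why the neighbourhoods are required to be bounded:
        \<open>infdist x {} = 0\<close>, so with an empty complement \<open>b p\<close> would vanish
        identically.\<close>
      then have "V p \<noteq> UNIV" using not_bounded_UNIV by metis
      then have "- V p \<noteq> {}" by auto
      then show ?thesis unfolding b_def using \<open>open (V p)\<close> that
        by (intro infdist_pos_not_in_closed) (auto simp: closed_def)
    qed
    have den: "0 < den x" for x
    proof (cases "x \<in> closure \<Omega>")
      case True
      then obtain p where p: "p \<in> F" "x \<in> V p" using F(3) by blast
      have "0 < b p x" using bpos p by blast
      also have "\<dots> \<le> (\<Sum>p\<in>F. b p x)" using p(1) F(2) b0 by (intro member_le_sum) auto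
      finally show ?thesis unfolding den_def using infdist_nonneg[of x "closure \<Omega>"] by linarith
    next
      case False2: False
      then have "0 < infdist x (closure \<Omega>)" using False by (intro infdist_pos_not_in_closed) auto
      moreover have "0 \<le> (\<Sum>p\<in>F. b p x)" using b0 by (intro sum_nonneg) auto
      ultimately show ?thesis by (simp add: den_def)
    qed
    define \<psi>p where "\<psi>p p x = \<psi> x * (b p x / den x)" for p x
    have cont: "continuous_on UNIV (\<psi>p p)" for p
      unfolding \<psi>p_def den_def b_def using \<psi>(1) den unfolding den_def b_def
      by (intro continuous_intros continuous_on_infdist) (auto simp: less_imp_neq[symmetric])
    have al: "almost_limit \<delta> \<epsilon> (\<psi>p p)" if "p \<in> F" for p
    proof (rule VL[OF subsetD[OF F(1) that] cont])
      show "\<forall>x. 0 \<le> \<psi>p p x" using \<psi>(2) b0 den by (simp add: \<psi>p_def less_imp_le)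
      show "\<forall>x. x \<notin> V p \<longrightarrow> \<psi>p p x = 0" by (simp add: \<psi>p_def bV)
    qed
    then obtain l where l: "\<And>p. p \<in> F \<Longrightarrow> layer \<delta> (\<psi>p p) \<longlonglongrightarrow> l p"
      "\<And>p. p \<in> F \<Longrightarrow> \<bar>l p - (LINT x|surface_measure. bdry (\<psi>p p) x)\<bar> \<le> \<epsilon> * (LINT x|surface_measure. bdry (\<psi>p p) x)"
      and int: "\<And>p. p \<in> F \<Longrightarrow> integrable surface_measure (bdry (\<psi>p p))"
      unfolding almost_limit_def by metis
    have part: "(\<Sum>p\<in>F. \<psi>p p x) = \<psi> x" if "x \<in> closure \<Omega>" for x
    proof -
      have "(\<Sum>p\<in>F. \<psi>p p x) = \<psi> x * ((\<Sum>p\<in>F. b p x) / den x)"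
        by (simp add: \<psi>p_def sum_distrib_left sum_divide_distrib)
      also have "(\<Sum>p\<in>F. b p x) / den x = 1" using den[of x] that by (simp add: den_def)
      finally show ?thesis by simp
    qed
    have bd: "bdry \<psi> = (\<lambda>x. \<Sum>p\<in>F. bdry (\<psi>p p) x)"
    proof -
      have "bdry \<psi> = bdry (\<lambda>x. \<Sum>p\<in>F. \<psi>p p x)" by (rule bdry_cong) (simp add: part)
      then show ?thesis by (simp add: bdry_def sum_divide_distrib sum_distrib_left fun_eq_iff)
    qed
    have ly: "layer \<delta> \<psi> = (\<lambda>k. \<Sum>p\<in>F. layer \<delta> (\<psi>p p) k)"
    proof
      fix k
      have "layer \<delta> \<psi> k = layer \<delta> (\<lambda>x. \<Sum>p\<in>F. \<psi>p p x) k" by (rule fun_cong[OF layer_cong]) (simp add: part)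
      also have "\<dots> = (LINT x|lborel. (\<Sum>p\<in>F. indicator \<Omega> x *\<^sub>R (level_kernel (\<delta> k) (f x) * \<psi>p p x)))"
        by (simp add: layer_def sum_distrib_left)
      also have "\<dots> = (\<Sum>p\<in>F. layer \<delta> (\<psi>p p) k)"
        unfolding layer_def
        using layer_integrable[OF \<delta>(1), of "\<psi>p _"] cont
        by (intro Bochner_Integration.integral_sum) (auto intro: continuous_on_subset)
      finally show "layer \<delta> \<psi> k = (\<Sum>p\<in>F. layer \<delta> (\<psi>p p) k)" .
    qed
    have S: "(LINT x|surface_measure. bdry \<psi> x) = (\<Sum>p\<in>F. LINT x|surface_measure. bdry (\<psi>p p) x)"
      unfolding bd using int by (intro Bochner_Integration.integral_sum)
    have "integrable surface_measure (bdry \<psi>)"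
      unfolding bd using int by (intro Bochner_Integration.integrable_sum)
    moreover have "layer \<delta> \<psi> \<longlonglongrightarrow> (\<Sum>p\<in>F. l p)"
      unfolding ly using l(1) by (intro tendsto_sum)
    moreover have "\<bar>(\<Sum>p\<in>F. l p) - (LINT x|surface_measure. bdry \<psi> x)\<bar> \<le> \<epsilon> * (LINT x|surface_measure. bdry \<psi> x)"
      unfolding S sum_subtractf[symmetric] sum_distrib_left
      by (intro order_trans[OF sum_abs] sum_mono l(2))
    ultimately show ?thesis unfolding almost_limit_def by blast
  qed
  let ?S = "LINT x|surface_measure. bdry \<psi> x"
  show "integrable surface_measure (bdry \<psi>)" using main[of 1] by (simp add: almost_limit_def)
  obtain l where l: "layer \<delta> \<psi> \<longlonglongrightarrow> l" using main[of 1] by (auto simp: almost_limit_def)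
  have le: "\<bar>l - ?S\<bar> \<le> \<epsilon> * ?S" if "\<epsilon> > 0" for \<epsilon>
    using main[OF that] l LIMSEQ_unique unfolding almost_limit_def by metis
  have "l = ?S"
  proof (rule ccontr)
    assume "l \<noteq> ?S"
    then have "0 < ?S" using le[of 1] by linarith
    have "\<bar>l - ?S\<bar> \<le> (\<bar>l - ?S\<bar> / (2 * ?S)) * ?S" using \<open>l \<noteq> ?S\<close> \<open>0 < ?S\<close> by (intro le) simp
    also have "\<dots> = \<bar>l - ?S\<bar> / 2" using \<open>0 < ?S\<close> by simp
    finally show False using \<open>l \<noteq> ?S\<close> by simp
  qed
  then show "layer \<delta> \<psi> \<longlonglongrightarrow> ?S" using l by simp
qed

text \<open>Tietze's theorem extends \<open>\<psi>\<close> from the closure to the whole space,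
  where the partition of unity is formed; positive and negative parts reduce to the nonnegative
  case.\<close>

lemma layer_limit_real:
  assumes dim: "DIM('a) = DIM('b::euclidean_space) + 1"
    and \<psi>: "continuous_on (closure \<Omega>) \<psi>" and \<delta>: "\<And>k. \<delta> k > 0" "\<delta> \<longlonglongrightarrow> 0"
  shows "integrable surface_measure (bdry \<psi>)" "layer \<delta> \<psi> \<longlonglongrightarrow> (LINT x|surface_measure. bdry \<psi> x)"
proof -
  have "compact (\<psi> ` closure \<Omega>)" using \<psi> compact_closure_\<Omega> by (rule compact_continuous_image)
  then have "bounded (\<psi> ` closure \<Omega>)" by (rule compact_imp_bounded)
  then obtain B where B: "0 < B" "\<forall>y\<in>\<psi> ` closure \<Omega>. norm y \<le> B" unfolding bounded_pos by metis
  obtain \<psi>' where \<psi>': "continuous_on UNIV \<psi>'" "\<And>x. x \<in> closure \<Omega> \<Longrightarrow> \<psi>' x = \<psi> x"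
    by (rule Tietze[OF \<psi>, of UNIV B]) (use B in auto)
  define u v where "u x = max (\<psi>' x) 0" and "v x = max (- \<psi>' x) 0" for x
  have u: "continuous_on UNIV u" "\<And>x. 0 \<le> u x" and v: "continuous_on UNIV v" "\<And>x. 0 \<le> v x"
    unfolding u_def v_def using \<psi>'(1) by (auto intro!: continuous_intros)
  have uv: "\<psi> x = u x - v x" if "x \<in> closure \<Omega>" for x using \<psi>'(2)[OF that] by (auto simp: u_def v_def max_def)
  have bd: "bdry \<psi> = (\<lambda>x. bdry u x - bdry v x)"
  proof -
    have "bdry \<psi> = bdry (\<lambda>x. u x - v x)" by (rule bdry_cong) (rule uv)
    then show ?thesis by (simp add: bdry_def diff_divide_distrib right_diff_distrib fun_eq_iff)
  qed
  have ly: "layer \<delta> \<psi> = (\<lambda>k. layer \<delta> u k - layer \<delta> v k)"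
  proof
    fix k
    have "layer \<delta> \<psi> k = layer \<delta> (\<lambda>x. u x - v x) k" by (rule fun_cong[OF layer_cong]) (rule uv)
    also have "\<dots> = (LINT x|lborel. indicator \<Omega> x *\<^sub>R (level_kernel (\<delta> k) (f x) * u x) - indicator \<Omega> x *\<^sub>R (level_kernel (\<delta> k) (f x) * v x))"
      by (simp add: layer_def right_diff_distrib)
    also have "\<dots> = layer \<delta> u k - layer \<delta> v k"
      unfolding layer_def
      using layer_integrable[OF \<delta>(1), of u] layer_integrable[OF \<delta>(1), of v] u(1) v(1)
      by (intro Bochner_Integration.integral_diff) (auto intro: continuous_on_subset)
    finally show "layer \<delta> \<psi> k = layer \<delta> u k - layer \<delta> v k" .
  qed
  note U = layer_limit_nonneg[OF dim u \<delta>] and V = layer_limit_nonneg[OF dim v \<delta>]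
  show "integrable surface_measure (bdry \<psi>)" unfolding bd by (intro Bochner_Integration.integrable_diff U V)
  have "(LINT x|surface_measure. bdry \<psi> x) = (LINT x|surface_measure. bdry u x) - (LINT x|surface_measure. bdry v x)"
    unfolding bd by (intro Bochner_Integration.integral_diff U V)
  then show "layer \<delta> \<psi> \<longlonglongrightarrow> (LINT x|surface_measure. bdry \<psi> x)"
    unfolding ly using tendsto_diff[OF U(2) V(2)] by simp
qed

theorem layer_limit:
  fixes \<psi> :: "'a \<Rightarrow> complex"
  assumes dim: "DIM('a) = DIM('b::euclidean_space) + 1"
    and \<psi>: "continuous_on (closure \<Omega>) \<psi>" and \<delta>: "\<And>k. \<delta> k > 0" "\<delta> \<longlonglongrightarrow> 0"
  shows "(\<lambda>k. LINT x:\<Omega>|lborel. level_kernel (\<delta> k) (f x) *\<^sub>R \<psi> x) \<longlonglongrightarrow> (LINT x:frontier \<Omega>|surface_measure. \<psi> x / of_real (norm (G x)))"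
proof -
  have R: "continuous_on (closure \<Omega>) (\<lambda>x. Re (\<psi> x))" and I: "continuous_on (closure \<Omega>) (\<lambda>x. Im (\<psi> x))"
    using \<psi> by (auto intro: continuous_intros)
  note R' = layer_limit_real[OF dim R \<delta>] and I' = layer_limit_real[OF dim I \<delta>]
  let ?h = "\<lambda>x. indicator (frontier \<Omega>) x *\<^sub>R (\<psi> x / of_real (norm (G x)))"
  have eq: "?h = (\<lambda>x. complex_of_real (bdry (\<lambda>x. Re (\<psi> x)) x) + \<i> * complex_of_real (bdry (\<lambda>x. Im (\<psi> x)) x))"
    by (auto simp: fun_eq_iff bdry_def complex_eq_iff indicator_def)
  have h: "integrable surface_measure ?h"
    unfolding eq using R'(1) I'(1) by auto
  have Re: "Re (LINT x|surface_measure. ?h x) = (LINT x|surface_measure. bdry (\<lambda>x. Re (\<psi> x)) x)"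
    and Im: "Im (LINT x|surface_measure. ?h x) = (LINT x|surface_measure. bdry (\<lambda>x. Im (\<psi> x)) x)"
    using integral_Re[OF h] integral_Im[OF h] by (simp_all add: bdry_def)
  note g = layer_integrable[OF \<delta>(1) \<psi>]
  have Re': "Re (LINT x:\<Omega>|lborel. level_kernel (\<delta> k) (f x) *\<^sub>R \<psi> x) = layer \<delta> (\<lambda>x. Re (\<psi> x)) k"
    and Im': "Im (LINT x:\<Omega>|lborel. level_kernel (\<delta> k) (f x) *\<^sub>R \<psi> x) = layer \<delta> (\<lambda>x. Im (\<psi> x)) k" for k
    using integral_Re[OF g[of k]] integral_Im[OF g[of k]] by (simp_all add: layer_def set_lebesgue_integral_def mult.assoc)
  show ?thesis
    unfolding tendsto_complex_iff Re' Im' set_lebesgue_integral_def[of surface_measure] Re Im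
    using R'(2) I'(2) by simp
qed

end

section \<open>Principal minors and bordered determinants\<close>

lemma det_on_transpose:
  assumes "finite S"
  shows "det_on S M = (\<Sum>p \<in> {p. p permutes S}. of_int (sign p) * (\<Prod>i\<in>S. M (p i) i))"
proof -
  have "det_on S M = (\<Sum>p \<in> {p. p permutes S}. of_int (sign (inv p)) * (\<Prod>i\<in>S. M i (inv p i)))"
    unfolding det_on_def by (rule sum_permutations_inverse)
  also have "\<dots> = (\<Sum>p \<in> {p. p permutes S}. of_int (sign p) * (\<Prod>i\<in>S. M (p i) i))"
  proof (rule sum.cong[OF refl])
    fix p assume "p \<in> {p. p permutes S}"
    then have p: "p permutes S" by simp
    have "(\<Prod>i\<in>S. M i (inv p i)) = (\<Prod>i\<in>S. M (p i) (inv p (p i)))"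
      using prod.permute[OF p, of "\<lambda>i. M i (inv p i)"] by (simp add: o_def)
    also have "\<dots> = (\<Prod>i\<in>S. M (p i) i)" using permutes_inverses(2)[OF p] by simp
    finally show "of_int (sign (inv p)) * (\<Prod>i\<in>S. M i (inv p i)) = of_int (sign p) * (\<Prod>i\<in>S. M (p i) i)"
      using sign_inverse[OF permutes_imp_permutation[OF assms p]] by simp
  qed
  finally show ?thesis .
qed

lemma det_on_image:
  assumes S: "finite S" and h: "inj_on h S"
  shows "det_on (h ` S) N = det_on S (\<lambda>i j. N (h i) (h j))"
proof -
  have bij: "bij_betw (map_permutation S h) {p. p permutes S} {p. p permutes (h ` S)}"
  proof -
    let ?g = "inv_into S h"
    have b: "bij_betw h S (h ` S)" using h by (rule inj_on_imp_bij_betw)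
    have g: "inj_on ?g (h ` S)" "?g ` h ` S = S" using h by (auto simp: inj_on_inv_into)
    show ?thesis
    proof (rule bij_betwI[where g = "map_permutation (h ` S) ?g"])
      show "map_permutation S h \<in> {p. p permutes S} \<rightarrow> {p. p permutes h ` S}"
        using map_permutation_permutes[OF b] by auto
      show "map_permutation (h ` S) ?g \<in> {p. p permutes h ` S} \<rightarrow> {p. p permutes S}"
        using map_permutation_permutes[OF bij_betw_inv_into[OF b]] by auto
      show "map_permutation (h ` S) ?g (map_permutation S h p) = p" if "p \<in> {p. p permutes S}" for p
        using that h by (intro map_permutation_compose_inv) (auto simp: b)
      show "map_permutation S h (map_permutation (h ` S) ?g p) = p" if "p \<in> {p. p permutes h ` S}" for p
        using that h bij_betw_inv_into[OF b] by (intro map_permutation_compose_inv) (auto simp: f_inv_into_f)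
    qed
  qed
  have "det_on (h ` S) N = (\<Sum>p\<in>{p. p permutes S}. of_int (sign (map_permutation S h p)) * (\<Prod>i\<in>h ` S. N i (map_permutation S h p i)))"
    unfolding det_on_def by (rule sum.reindex_bij_betw[OF bij, symmetric])
  also have "\<dots> = det_on S (\<lambda>i j. N (h i) (h j))"
    unfolding det_on_def
  proof (rule sum.cong[OF refl])
    fix p assume "p \<in> {p. p permutes S}"
    then have p: "p permutes S" by simp
    have "(\<Prod>i\<in>h ` S. N i (map_permutation S h p i)) = (\<Prod>i\<in>S. N (h i) (h (p i)))"
      using h by (subst prod.reindex) (auto simp: map_permutation_apply)
    then show "of_int (sign (map_permutation S h p)) * (\<Prod>i\<in>h ` S. N i (map_permutation S h p i))
      = of_int (sign p) * (\<Prod>i\<in>S. N (h i) (h (p i)))"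
      using sign_map_permutation[OF h p S] by simp
  qed
  finally show ?thesis .
qed

text \<open>Every permutation of \<open>insert a S\<close> is a transposition of \<open>a\<close>
  and some \<open>b\<close> after a permutation \<open>p\<close> of \<open>S\<close>. For
  \<open>b = a\<close> the zero corner kills the term. Otherwise \<open>b = p k\<close> for a unique
  \<open>k\<close>; then \<open>a\<close> goes to \<open>p k\<close> and \<open>k\<close> to
  \<open>a\<close>, and the sign is reversed. The inner sum has the form produced by integration by
  parts in column \<open>k\<close>.\<close>

lemma det_on_bordered:
  assumes S: "finite S" "a \<notin> S" and N0: "N a a = 0"
  shows "det_on (insert a S) N = - (\<Sum>k\<in>S. N a k * (\<Sum>p \<in> {p. p permutes S}. of_int (sign p) * (N (p k) a * (\<Prod>i\<in>S - {k}. N (p i) i))))"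
proof -
  let ?P = "{p. p permutes S}"
  define t where "t q = of_int (sign q) * (\<Prod>i\<in>insert a S. N (q i) i)" for q
  have swap_term: "t (Transposition.transpose a (p k) \<circ> p) = - (N a k * (of_int (sign p) * (N (p k) a * (\<Prod>i\<in>S - {k}. N (p i) i))))"
    if p: "p permutes S" and k: "k \<in> S" for p k
  proof -
    let ?q = "Transposition.transpose a (p k) \<circ> p"
    have pk: "p k \<in> S" using permutes_in_image[OF p] k by simp
    then have ne: "a \<noteq> p k" using S by auto
    have "sign ?q = - sign p"
      using sign_compose[OF permutation_swap_id permutes_imp_permutation[OF S(1) p], of a "p k"] ne by (simp add: sign_swap_id)
    moreover have "?q a = p k" using permutes_not_in[OF p S(2)] by simp
    moreover have "?q k = a" by simp
    moreover have "?q i = p i" if "i \<in> S - {k}" for i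
    proof -
      have "p i \<noteq> p k" using permutes_inj[OF p] that by (auto dest: injD)
      moreover have "p i \<noteq> a" using permutes_in_image[OF p, of i] that S(2) by auto
      ultimately show ?thesis by (simp add: Transposition.transpose_def)
    qed
    then have "(\<Prod>i\<in>S - {k}. N (?q i) i) = (\<Prod>i\<in>S - {k}. N (p i) i)" by (intro prod.cong) auto
    moreover have "(\<Prod>i\<in>insert a S. N (?q i) i) = N (?q a) a * (N (?q k) k * (\<Prod>i\<in>S - {k}. N (?q i) i))"
      using S k by (simp add: prod.remove[of S k])
    ultimately show ?thesis unfolding t_def by simp
  qed
  have zero: "t p = 0" if "p permutes S" for p
    using N0 S permutes_not_in[OF that S(2)] by (simp add: t_def)
  have "det_on (insert a S) N = (\<Sum>q\<in>{q. q permutes (insert a S)}. t q)"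
    unfolding t_def using S by (intro det_on_transpose) simp
  also have "\<dots> = (\<Sum>b\<in>insert a S. \<Sum>p\<in>?P. t (Transposition.transpose a b \<circ> p))"
    by (rule sum_over_permutations_insert[OF S])
  also have "\<dots> = (\<Sum>b\<in>S. \<Sum>p\<in>?P. t (Transposition.transpose a b \<circ> p))"
    using S zero by simp
  also have "\<dots> = (\<Sum>p\<in>?P. \<Sum>b\<in>S. t (Transposition.transpose a b \<circ> p))" by (rule sum.swap)
  also have "\<dots> = (\<Sum>p\<in>?P. \<Sum>k\<in>S. t (Transposition.transpose a (p k) \<circ> p))"
  proof (rule sum.cong[OF refl])
    fix p assume "p \<in> ?P"
    then have "p permutes S" by simp
    from sum.permute[OF this, of "\<lambda>b. t (Transposition.transpose a b \<circ> p)"]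
    show "(\<Sum>b\<in>S. t (Transposition.transpose a b \<circ> p)) = (\<Sum>k\<in>S. t (Transposition.transpose a (p k) \<circ> p))" by (simp add: o_def)
  qed
  also have "\<dots> = (\<Sum>p\<in>?P. \<Sum>k\<in>S. - (N a k * (of_int (sign p) * (N (p k) a * (\<Prod>i\<in>S - {k}. N (p i) i)))))"
    using swap_term by (intro sum.cong) auto
  also have "\<dots> = - (\<Sum>k\<in>S. N a k * (\<Sum>p\<in>?P. of_int (sign p) * (N (p k) a * (\<Prod>i\<in>S - {k}. N (p i) i))))"
    by (subst sum.swap) (simp add: sum_negf sum_distrib_left)
  finally show ?thesis .
qed

section \<open>Symmetric functions of the eigenvalues as sums of principal minors\<close>

text \<open>In each factor of the Leibniz formula either the entry of -A or the diagonal
  \<open>t\<close> is chosen, and \<open>T\<close> collects the rows of the first kind. The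
  remaining rows contribute only if \<open>p\<close> fixes them, that is, if \<open>p\<close>
  permutes \<open>T\<close>.\<close>

lemma det_mat_minus_expand:
  fixes A :: "complex^'n^'n::finite"
  shows "det (mat t - A) = (\<Sum>T\<in>UNIV. t ^ (CARD('n) - card T) * ((- 1) ^ card T * det_on T (\<lambda>i j. A $ i $ j)))"
proof -
  let ?d = "\<lambda>p i. if p i = i then t else 0"
  have "det (mat t - A) = (\<Sum>p\<in>{p. p permutes UNIV}. of_int (sign p) * (\<Prod>i\<in>UNIV. - A $ i $ p i + ?d p i))"
    unfolding det_def by (intro sum.cong refl arg_cong2[of _ _ _ _ "(*)"] prod.cong) (auto simp: mat_def)
  also have "\<dots> = (\<Sum>p\<in>{p. p permutes UNIV}. \<Sum>T\<in>UNIV. of_int (sign p) * ((\<Prod>i\<in>T. - A $ i $ p i) * (\<Prod>i\<in>UNIV - T. ?d p i)))"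
    by (subst prod_add) (auto simp: sum_distrib_left)
  also have "\<dots> = (\<Sum>T\<in>UNIV. \<Sum>p\<in>{p. p permutes UNIV}. of_int (sign p) * ((\<Prod>i\<in>T. - A $ i $ p i) * (\<Prod>i\<in>UNIV - T. ?d p i)))"
    by (rule sum.swap)
  also have "\<dots> = (\<Sum>T\<in>UNIV. t ^ (CARD('n) - card T) * ((- 1) ^ card T * det_on T (\<lambda>i j. A $ i $ j)))"
  proof (rule sum.cong[OF refl])
    fix T :: "'n set"
    have "(\<Sum>p\<in>{p. p permutes UNIV}. of_int (sign p) * ((\<Prod>i\<in>T. - A $ i $ p i) * (\<Prod>i\<in>UNIV - T. ?d p i)))
      = (\<Sum>p\<in>{p. p permutes T}. of_int (sign p) * ((\<Prod>i\<in>T. - A $ i $ p i) * (\<Prod>i\<in>UNIV - T. ?d p i)))"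
    proof (rule sum.mono_neutral_right)
      show "finite {p. p permutes (UNIV :: 'n set)}" by (intro finite_permutations) simp
      show "{p. p permutes T} \<subseteq> {p. p permutes UNIV}" using permutes_subset by blast
      show "\<forall>p\<in>{p. p permutes UNIV} - {p. p permutes T}. of_int (sign p) * ((\<Prod>i\<in>T. - A $ i $ p i) * (\<Prod>i\<in>UNIV - T. ?d p i)) = 0"
      proof
        fix p assume p: "p \<in> {p. p permutes (UNIV::'n set)} - {p. p permutes T}"
        then have "\<exists>i. i \<notin> T \<and> p i \<noteq> i" using permutes_superset[of p UNIV T] by auto
        then obtain i where i: "i \<in> UNIV - T" "p i \<noteq> i" by blast
        have "(\<Prod>i\<in>UNIV - T. ?d p i) = 0" using i by (intro prod_zero bexI[of _ i]) auto
        then show "of_int (sign p) * ((\<Prod>i\<in>T. - A $ i $ p i) * (\<Prod>i\<in>UNIV - T. ?d p i)) = 0" by simp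
      qed
    qed
    also have "\<dots> = (\<Sum>p\<in>{p. p permutes T}. t ^ (CARD('n) - card T) * ((- 1) ^ card T * (of_int (sign p) * (\<Prod>i\<in>T. A $ i $ p i))))"
    proof (rule sum.cong[OF refl])
      fix p assume "p \<in> {p. p permutes T}"
      then have "(\<Prod>i\<in>UNIV - T. ?d p i) = (\<Prod>i\<in>UNIV - T. t)" by (intro prod.cong) (auto simp: permutes_not_in)
      also have "\<dots> = t ^ (CARD('n) - card T)" by (simp add: card_Diff_subset)
      finally show "of_int (sign p) * ((\<Prod>i\<in>T. - A $ i $ p i) * (\<Prod>i\<in>UNIV - T. ?d p i))
        = t ^ (CARD('n) - card T) * ((- 1) ^ card T * (of_int (sign p) * (\<Prod>i\<in>T. A $ i $ p i)))"
        by (simp add: prod_uminus mult_ac)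
    qed
    also have "\<dots> = t ^ (CARD('n) - card T) * ((- 1) ^ card T * det_on T (\<lambda>i j. A $ i $ j))"
      by (simp add: det_on_def sum_distrib_left)
    finally show "(\<Sum>p\<in>{p. p permutes UNIV}. of_int (sign p) * ((\<Prod>i\<in>T. - A $ i $ p i) * (\<Prod>i\<in>UNIV - T. ?d p i)))
      = t ^ (CARD('n) - card T) * ((- 1) ^ card T * det_on T (\<lambda>i j. A $ i $ j))" .
  qed
  finally show ?thesis .
qed

lemma sum_by_card:
  fixes g :: "'n::finite set \<Rightarrow> complex"
  shows "(\<Sum>T\<in>UNIV. t ^ (CARD('n) - card T) * g T) = (\<Sum>i\<le>CARD('n). (\<Sum>T | card T = CARD('n) - i. g T) * t ^ i)"
proof -
  have c: "card T \<le> CARD('n)" for T :: "'n set" by (intro card_mono) auto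
  have "(\<Sum>T\<in>UNIV. t ^ (CARD('n) - card T) * g T)
      = (\<Sum>i\<le>CARD('n). \<Sum>T\<in>{T \<in> UNIV. CARD('n) - card T = i}. t ^ (CARD('n) - card T) * g T)"
    by (rule sum.group[symmetric]) auto
  also have "\<dots> = (\<Sum>i\<le>CARD('n). (\<Sum>T | card T = CARD('n) - i. g T) * t ^ i)"
  proof (rule sum.cong[OF refl])
    fix i assume "i \<in> {..CARD('n)}"
    then have "{T \<in> UNIV. CARD('n) - card T = i} = {T :: 'n set. card T = CARD('n) - i}"
      using c by (auto simp: le_diff_conv2)
    then have eq: "{T \<in> UNIV. CARD('n) - card T = i} = {T :: 'n set. card T = CARD('n) - i}" .
    show "(\<Sum>T\<in>{T \<in> UNIV. CARD('n) - card T = i}. t ^ (CARD('n) - card T) * g T) = (\<Sum>T | card T = CARD('n) - i. g T) * t ^ i"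
      unfolding eq sum_distrib_right using \<open>i \<in> _\<close> by (intro sum.cong) (auto simp: mult.commute)
  qed
  finally show ?thesis .
qed

text \<open>The fundamental theorem of algebra, with the roots indexed by \<open>'n\<close> in place
  of numbers. It guarantees that the choice in \<open>sigma_eig\<close> has a witness.\<close>

lemma monic_poly_roots_ex:
  fixes c :: "nat \<Rightarrow> complex"
  assumes "c CARD('n::finite) = 1"
  shows "\<exists>ev :: 'n \<Rightarrow> complex. \<forall>t. (\<Sum>i\<le>CARD('n). c i * t ^ i) = (\<Prod>i\<in>UNIV. t - ev i)"
proof -
  let ?N = "CARD('n)"
  define p where "p = (\<Sum>i\<le>?N. monom (c i) i)"
  have cf: "coeff p k = (if k \<le> ?N then c k else 0)" for k
    unfolding p_def by (simp add: coeff_sum coeff_monom)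
  have deg: "degree p = ?N"
    using cf assms by (intro antisym degree_le le_degree) auto
  have lc: "lead_coeff p = 1" using cf assms deg by simp
  obtain root where "smult (lead_coeff p) (\<Prod>i<degree p. [:- root i, 1:]) = p"
    using complex_poly_decompose'[of p] by metis
  then have root: "p = (\<Prod>i<?N. [:- root i, 1:])" using deg lc by simp
  obtain b :: "nat \<Rightarrow> 'n" where b: "bij_betw b {..<?N} UNIV"
    using finite_same_card_bij[of "{..<?N}" "UNIV :: 'n set"] by auto
  define ev where "ev i = root (inv_into {..<?N} b i)" for i
  have "(\<Sum>i\<le>?N. c i * t ^ i) = (\<Prod>i\<in>UNIV. t - ev i)" for t
  proof -
    have "(\<Sum>i\<le>?N. c i * t ^ i) = poly p t" unfolding p_def by (simp add: poly_sum poly_monom)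
    also have "\<dots> = (\<Prod>k<?N. t - root k)" by (subst root) (simp add: poly_prod)
    also have "\<dots> = (\<Prod>k<?N. t - ev (b k))"
      using b by (intro prod.cong) (auto simp: ev_def bij_betw_def inv_into_f_f)
    also have "\<dots> = (\<Prod>i\<in>UNIV. t - ev i)" by (rule prod.reindex_bij_betw[OF b])
    finally show ?thesis .
  qed
  then show ?thesis by blast
qed

text \<open>Up to the sign (-1)^m both sides are the coefficient of t^(N - m) in the characteristic
  polynomial, N being the size of the matrix: once from the expansion into minors, once from Vieta's
  formula. For m > N both sums are empty.\<close>

theorem sigma_eig_eq_sum_minors:
  fixes A :: "complex^'n^'n::finite"
  shows "sigma_eig m A = (\<Sum>S | card S = m. det_on S (\<lambda>i j. A $ i $ j))"
proof -
  let ?N = "CARD('n)"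
  define D where "D T = (- 1) ^ card T * det_on T (\<lambda>i j. A $ i $ j)" for T
  define c where "c i = (\<Sum>T | card T = ?N - i. D T)" for i
  have det: "det (mat t - A) = (\<Sum>i\<le>?N. c i * t ^ i)" for t
    unfolding det_mat_minus_expand c_def D_def by (rule sum_by_card)
  have "c ?N = 1" by (simp add: c_def D_def det_on_def)
  define ev where "ev = (SOME ev :: 'n \<Rightarrow> complex. \<forall>t. det (mat t - A) = (\<Prod>i\<in>UNIV. t - ev i))"
  have ev: "det (mat t - A) = (\<Prod>i\<in>UNIV. t - ev i)" for t
    using someI_ex[OF monic_poly_roots_ex[where 'n = 'n and c = c, OF \<open>c ?N = 1\<close>, folded det]] unfolding ev_def by blast
  define d where "d i = (\<Sum>T | card T = ?N - i. (- 1) ^ card T * (\<Prod>i\<in>T. ev i))" for i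
  have "(\<Prod>i\<in>UNIV. t - ev i) = (\<Sum>i\<le>?N. d i * t ^ i)" for t
  proof -
    have "(\<Prod>i\<in>UNIV. t - ev i) = (\<Prod>i\<in>UNIV. - ev i + t)" by simp
    also have "\<dots> = (\<Sum>T\<in>UNIV. t ^ (?N - card T) * ((- 1) ^ card T * (\<Prod>i\<in>T. ev i)))"
      by (subst prod_add) (auto simp: prod_uminus card_Diff_subset mult_ac)
    also have "\<dots> = (\<Sum>i\<le>?N. d i * t ^ i)" unfolding d_def by (rule sum_by_card)
    finally show ?thesis .
  qed
  then have "\<forall>t. (\<Sum>i\<le>?N. c i * t ^ i) = (\<Sum>i\<le>?N. d i * t ^ i)" using ev det by simp
  then have cd: "c i = d i" if "i \<le> ?N" for i using that unfolding polyfun_eq_coeffs by blast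
  have *: "(\<Sum>S | card S = m. (\<Prod>i\<in>S. ev i)) = (\<Sum>S | card S = m. det_on S (\<lambda>i j. A $ i $ j))"
  proof (cases "m \<le> ?N")
    case True
    then have "c (?N - m) = d (?N - m)" by (intro cd) simp
    then have "(\<Sum>T | card T = m. (- 1) ^ m * det_on T (\<lambda>i j. A $ i $ j)) = (\<Sum>T | card T = m. (- 1) ^ m * (\<Prod>i\<in>T. ev i))"
      using True by (simp add: c_def d_def D_def)
    then show ?thesis by (simp add: sum_distrib_left[symmetric])
  next
    case False
    then have "{S :: 'n set. card S = m} = {}" using card_mono[of "UNIV :: 'n set"] by fastforce
    then show ?thesis by simp
  qed
  then show ?thesis unfolding sigma_eig_def ev_def[symmetric] Let_def .
qed

section \<open>Integration by parts for determinants of first derivatives\<close>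

definition cc :: "('a::euclidean_space \<Rightarrow> complex) \<Rightarrow> bool" where
  "cc u \<longleftrightarrow> continuous_on UNIV u \<and> (\<exists>K. compact K \<and> (\<forall>x. x \<notin> K \<longrightarrow> u x = 0))"

definition dird :: "'a::euclidean_space \<Rightarrow> ('a \<Rightarrow> complex) \<Rightarrow> 'a \<Rightarrow> complex" where
  "dird e u x = vector_derivative (\<lambda>t. u (x + t *\<^sub>R e)) (at 0)"

definition has_dird :: "'a::euclidean_space \<Rightarrow> ('a \<Rightarrow> complex) \<Rightarrow> ('a \<Rightarrow> complex) \<Rightarrow> bool" where
  "has_dird e u u' \<longleftrightarrow> (\<forall>x. ((\<lambda>t. u (x + t *\<^sub>R e)) has_vector_derivative u' x) (at 0))"

text \<open>Compactly supported C^1 functions, described by derivatives along lines. Products,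
  convolutions and integrals over translates are then treated by calculus in one real
  variable.\<close>

definition cc1 :: "('a::euclidean_space \<Rightarrow> complex) \<Rightarrow> bool" where
  "cc1 u \<longleftrightarrow> cc u \<and> (\<forall>e. has_dird e u (dird e u) \<and> cc (dird e u))"

lemma has_dird_unique: "has_dird e u u' \<Longrightarrow> dird e u = u'"
  unfolding has_dird_def dird_def by (auto simp: fun_eq_iff intro: vector_derivative_at)

lemma cc1I:
  assumes "cc u" "\<And>e. has_dird e u (u' e)" "\<And>e. cc (u' e)"
  shows "cc1 u"
  unfolding cc1_def using assms has_dird_unique[OF assms(2)] by simp

lemma cc1D: "cc1 u \<Longrightarrow> cc u" "cc1 u \<Longrightarrow> has_dird e u (dird e u)" "cc1 u \<Longrightarrow> cc (dird e u)"
  unfolding cc1_def by auto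

lemma has_dird_at:
  assumes "has_dird e u u'"
  shows "((\<lambda>t. u (x + t *\<^sub>R e)) has_vector_derivative u' (x + s *\<^sub>R e)) (at s)"
proof -
  have "((\<lambda>t. u ((x + s *\<^sub>R e) + t *\<^sub>R e)) has_vector_derivative u' (x + s *\<^sub>R e)) (at (s - s))"
    using assms by (simp add: has_dird_def)
  moreover have "((\<lambda>t. t - s) has_vector_derivative 1) (at s)" by (auto intro!: derivative_eq_intros)
  ultimately have "((\<lambda>t. u ((x + s *\<^sub>R e) + t *\<^sub>R e)) \<circ> (\<lambda>t. t - s) has_vector_derivative 1 *\<^sub>R u' (x + s *\<^sub>R e)) (at s)"
    by (intro vector_diff_chain_at)
  then show ?thesis by (simp add: o_def algebra_simps)
qed

lemma cc_continuous: "cc u \<Longrightarrow> continuous_on A u"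
  unfolding cc_def using continuous_on_subset by blast

lemma cc_bounded:
  assumes "cc u"
  obtains B where "0 < B" "\<And>x. norm (u x) \<le> B"
proof -
  obtain K where K: "compact K" "\<And>x. x \<notin> K \<Longrightarrow> u x = 0" using assms unfolding cc_def by metis
  have "compact (u ` K)" using cc_continuous[OF assms] K(1) by (rule compact_continuous_image)
  from compact_imp_bounded[OF this] obtain B where B: "0 < B" "\<forall>y\<in>u ` K. norm y \<le> B" unfolding bounded_pos by metis
  have "norm (u x) \<le> B" for x using B K(2)[of x] by (cases "x \<in> K") auto
  then show ?thesis using B(1) that by blast
qed

lemma cc_support:
  assumes "cc u"
  obtains K where "compact K" "\<And>x. x \<notin> K \<Longrightarrow> u x = 0"
  using assms unfolding cc_def by metis

lemma cc_measurable: "cc u \<Longrightarrow> u \<in> borel_measurable borel"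
  using cc_continuous by (intro borel_measurable_continuous_onI)

lemma cc_integrable:
  fixes u :: "'a::euclidean_space \<Rightarrow> complex"
  assumes "cc u"
  shows "integrable lborel u"
proof -
  obtain K where K: "compact K" "\<And>x. x \<notin> K \<Longrightarrow> u x = 0" using cc_support[OF assms] by metis
  have "integrable lborel (\<lambda>x. indicator K x *\<^sub>R u x)"
    using cc_continuous[OF assms] K(1) by (intro borel_integrable_compact)
  also have "(\<lambda>x. indicator K x *\<^sub>R u x) = u" using K(2) by (auto simp: indicator_def fun_eq_iff)
  finally show ?thesis .
qed

lemma cc_mult_left:
  assumes "continuous_on UNIV v" "cc u"
  shows "cc (\<lambda>x. v x * u x)"
proof -
  obtain K where "compact K" "\<And>x. x \<notin> K \<Longrightarrow> u x = 0" using cc_support[OF assms(2)] by metis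
  then show ?thesis unfolding cc_def using assms(1) cc_continuous[OF assms(2)] by (auto intro!: continuous_intros)
qed

lemma cc_mult_right: "cc u \<Longrightarrow> continuous_on UNIV v \<Longrightarrow> cc (\<lambda>x. u x * v x)"
  using cc_mult_left[of v u] by (simp add: mult.commute)

lemma cc_add:
  assumes "cc u" "cc v"
  shows "cc (\<lambda>x. u x + v x)"
proof -
  obtain K where K: "compact K" "\<And>x. x \<notin> K \<Longrightarrow> u x = 0" using cc_support[OF assms(1)] by metis
  obtain L where L: "compact L" "\<And>x. x \<notin> L \<Longrightarrow> v x = 0" using cc_support[OF assms(2)] by metis
  have "compact (K \<union> L)" "\<And>x. x \<notin> K \<union> L \<Longrightarrow> u x + v x = 0" using K L by auto
  then show ?thesis unfolding cc_def using cc_continuous[OF assms(1)] cc_continuous[OF assms(2)]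
    by (auto intro!: continuous_intros)
qed

lemma cc_uminus: "cc u \<Longrightarrow> cc (\<lambda>x. - u x)"
  using cc_mult_left[of "\<lambda>_. -1" u] by simp

lemma cc_translate:
  assumes "cc u"
  shows "cc (\<lambda>y. u (y + x))"
proof -
  obtain L where L: "compact L" "\<And>x. x \<notin> L \<Longrightarrow> u x = 0" using cc_support[OF assms] by metis
  have "compact ((\<lambda>y. y - x) ` L)" using L(1) by (intro compact_continuous_image continuous_intros)
  moreover have "y \<in> (\<lambda>y. y - x) ` L" if "y + x \<in> L" for y using that by (auto simp: image_iff intro!: bexI[of _ "y + x"])
  ultimately show ?thesis unfolding cc_def using L(2)
    by (auto intro!: exI[of _ "(\<lambda>y. y - x) ` L"] continuous_intros continuous_on_compose2[OF cc_continuous[OF assms, of UNIV]])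
qed

lemma cc1_mult:
  assumes "cc1 u" "cc1 v"
  shows "cc1 (\<lambda>x. u x * v x)" "dird e (\<lambda>x. u x * v x) = (\<lambda>x. dird e u x * v x + u x * dird e v x)"
proof -
  have h: "has_dird e (\<lambda>x. u x * v x) (\<lambda>x. dird e u x * v x + u x * dird e v x)" for e
    unfolding has_dird_def
  proof
    fix x
    have "((\<lambda>t. u (x + t *\<^sub>R e)) has_vector_derivative dird e u x) (at 0)" "((\<lambda>t. v (x + t *\<^sub>R e)) has_vector_derivative dird e v x) (at 0)"
      using assms unfolding cc1_def has_dird_def by auto
    from has_vector_derivative_mult[OF this]
    show "((\<lambda>t. u (x + t *\<^sub>R e) * v (x + t *\<^sub>R e)) has_vector_derivative dird e u x * v x + u x * dird e v x) (at 0)"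
      by (simp add: add.commute)
  qed
  show "cc1 (\<lambda>x. u x * v x)"
    using assms by (intro cc1I[OF _ h] cc_add cc_mult_right) (auto simp: cc1D cc_continuous)
  show "dird e (\<lambda>x. u x * v x) = (\<lambda>x. dird e u x * v x + u x * dird e v x)"
    by (rule has_dird_unique[OF h])
qed

lemma cc1_add:
  assumes "cc1 u" "cc1 v"
  shows "cc1 (\<lambda>x. u x + v x)" "dird e (\<lambda>x. u x + v x) = (\<lambda>x. dird e u x + dird e v x)"
proof -
  have h: "has_dird e (\<lambda>x. u x + v x) (\<lambda>x. dird e u x + dird e v x)" for e
    using assms unfolding has_dird_def cc1_def by (auto intro!: has_vector_derivative_add)
  show "cc1 (\<lambda>x. u x + v x)"
    using assms by (intro cc1I[OF _ h] cc_add) (auto simp: cc1D)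
  show "dird e (\<lambda>x. u x + v x) = (\<lambda>x. dird e u x + dird e v x)"
    by (rule has_dird_unique[OF h])
qed

lemma cc1_cmult:
  assumes "cc1 u"
  shows "cc1 (\<lambda>x. c * u x)" "dird e (\<lambda>x. c * u x) = (\<lambda>x. c * dird e u x)"
proof -
  have h: "has_dird e (\<lambda>x. c * u x) (\<lambda>x. c * dird e u x)" for e
    using assms unfolding has_dird_def cc1_def by (auto intro!: has_vector_derivative_mult_right)
  show "cc1 (\<lambda>x. c * u x)"
    using assms by (intro cc1I[OF _ h] cc_mult_left) (auto simp: cc1D)
  show "dird e (\<lambda>x. c * u x) = (\<lambda>x. c * dird e u x)"
    by (rule has_dird_unique[OF h])
qed

lemma cc1_prod:
  assumes "finite A" "A \<noteq> {}" "\<And>i. i \<in> A \<Longrightarrow> cc1 (u i)"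
  shows "cc1 (\<lambda>x. \<Prod>i\<in>A. u i x) \<and> (\<forall>e. dird e (\<lambda>x. \<Prod>i\<in>A. u i x) = (\<lambda>x. \<Sum>i\<in>A. dird e (u i) x * (\<Prod>j\<in>A - {i}. u j x)))"
  using assms
proof (induction rule: finite_ne_induct)
  case (singleton i)
  then show ?case by simp
next
  case (insert i A)
  have p: "(\<lambda>x. \<Prod>i\<in>insert i A. u i x) = (\<lambda>x. u i x * (\<Prod>i\<in>A. u i x))" using insert by simp
  have A: "cc1 (\<lambda>x. \<Prod>i\<in>A. u i x)" and DA: "\<And>e. dird e (\<lambda>x. \<Prod>i\<in>A. u i x) = (\<lambda>x. \<Sum>i\<in>A. dird e (u i) x * (\<Prod>j\<in>A - {i}. u j x))"
    using insert by auto
  have i: "cc1 (u i)" using insert by simp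
  show ?case
  proof (intro conjI allI)
    show "cc1 (\<lambda>x. \<Prod>i\<in>insert i A. u i x)" unfolding p by (rule cc1_mult[OF i A])
    fix e
    show "dird e (\<lambda>x. \<Prod>i\<in>insert i A. u i x) = (\<lambda>x. \<Sum>k\<in>insert i A. dird e (u k) x * (\<Prod>j\<in>insert i A - {k}. u j x))"
    proof
      fix x
      have "(\<Sum>k\<in>A. dird e (u k) x * (\<Prod>j\<in>insert i A - {k}. u j x)) = (\<Sum>k\<in>A. u i x * (dird e (u k) x * (\<Prod>j\<in>A - {k}. u j x)))"
      proof (rule sum.cong[OF refl])
        fix k assume k: "k \<in> A"
        then have "insert i A - {k} = insert i (A - {k})" using insert.hyps by auto
        then have "(\<Prod>j\<in>insert i A - {k}. u j x) = u i x * (\<Prod>j\<in>A - {k}. u j x)" using insert.hyps by simp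
        then show "dird e (u k) x * (\<Prod>j\<in>insert i A - {k}. u j x) = u i x * (dird e (u k) x * (\<Prod>j\<in>A - {k}. u j x))" by (simp only: mult_ac)
      qed
      moreover have "insert i A - {i} = A" using insert.hyps by auto
      ultimately show "dird e (\<lambda>x. \<Prod>i\<in>insert i A. u i x) x = (\<Sum>k\<in>insert i A. dird e (u k) x * (\<Prod>j\<in>insert i A - {k}. u j x))"
        unfolding p cc1_mult(2)[OF i A] DA using insert.hyps by (simp add: sum_distrib_left)
    qed
  qed
qed

lemma cc1_increment_bound:
  assumes u: "cc1 u" and B: "\<And>x. norm (dird e u x) \<le> B"
  shows "norm (u (x + h *\<^sub>R e) - u x) \<le> B * \<bar>h\<bar>"
proof -
  have "norm (u (x + h *\<^sub>R e) - u (x + 0 *\<^sub>R e)) \<le> B * norm (h - 0)"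
  proof (rule differentiable_bound[of UNIV "\<lambda>t. u (x + t *\<^sub>R e)" "\<lambda>t h. h *\<^sub>R dird e u (x + t *\<^sub>R e)"])
    show "((\<lambda>t. u (x + t *\<^sub>R e)) has_derivative (\<lambda>h. h *\<^sub>R dird e u (x + t *\<^sub>R e))) (at t within UNIV)" for t
      using has_dird_at[OF cc1D(2)[OF u], of x e t] by (simp add: has_vector_derivative_def)
    show "onorm (\<lambda>h. h *\<^sub>R dird e u (x + t *\<^sub>R e)) \<le> B" for t
      using mult_right_mono[OF B[of "x + t *\<^sub>R e"] abs_ge_zero] by (intro onorm_le) (simp add: mult.commute)
  qed auto
  then show ?thesis by simp
qed

section \<open>Differentiation under the integral sign\<close>

lemma has_vector_derivative_iff_quotient:
  fixes F :: "real \<Rightarrow> 'b::real_normed_vector"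
  shows "(F has_vector_derivative D) (at 0) \<longleftrightarrow> ((\<lambda>h. (F h - F 0) /\<^sub>R h) \<longlongrightarrow> D) (at 0)"
proof -
  have eq: "norm (F (0 + h) - F 0 - h *\<^sub>R D) / norm h = norm ((F h - F 0) /\<^sub>R h - D)" if "h \<noteq> 0" for h :: real
  proof -
    have "(F h - F 0) /\<^sub>R h - D = (F h - F 0 - h *\<^sub>R D) /\<^sub>R h" using that by (simp add: scaleR_diff_right)
    then show ?thesis by (simp add: divide_inverse_commute)
  qed
  have "(F has_vector_derivative D) (at 0) \<longleftrightarrow> ((\<lambda>h. norm (F (0 + h) - F 0 - h *\<^sub>R D) / norm h) \<longlongrightarrow> 0) (at 0)"
    unfolding has_vector_derivative_def has_derivative_at by (simp add: bounded_linear_scaleR_left)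
  also have "\<dots> \<longleftrightarrow> ((\<lambda>h. norm ((F h - F 0) /\<^sub>R h - D)) \<longlongrightarrow> 0) (at 0)"
    by (rule LIM_equal) (use eq in blast)
  also have "\<dots> \<longleftrightarrow> ((\<lambda>h. (F h - F 0) /\<^sub>R h) \<longlongrightarrow> D) (at 0)"
    by (simp only: tendsto_norm_zero_iff LIM_zero_iff)
  finally show ?thesis .
qed

text \<open>Difference quotients along sequences are what dominated convergence can handle. The
  restriction to steps of size at most 1 keeps the supports of all translates in one compact
  set.\<close>

lemma has_vector_derivative_sequentially:
  fixes F :: "real \<Rightarrow> 'b::real_normed_vector"
  assumes "\<And>h. (\<And>n. h n \<noteq> 0) \<Longrightarrow> (\<And>n. \<bar>h n\<bar> \<le> 1) \<Longrightarrow> h \<longlonglongrightarrow> 0 \<Longrightarrow> (\<lambda>n. (F (h n) - F 0) /\<^sub>R h n) \<longlonglongrightarrow> D"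
  shows "(F has_vector_derivative D) (at 0)"
  unfolding has_vector_derivative_iff_quotient tendsto_at_iff_sequentially
proof (intro allI impI)
  fix X assume X: "\<forall>n. X n \<in> UNIV - {0::real}" "X \<longlonglongrightarrow> 0"
  have "\<forall>\<^sub>F n in sequentially. norm (X n) < 1" using X(2) by (intro order_tendstoD[OF tendsto_norm_zero]) auto
  then obtain N where N: "\<And>n. n \<ge> N \<Longrightarrow> norm (X n) < 1" unfolding eventually_sequentially by metis
  have "(\<lambda>n. (F (X (n + N)) - F 0) /\<^sub>R X (n + N)) \<longlonglongrightarrow> D"
  proof (rule assms)
    show "X (n + N) \<noteq> 0" for n using X(1) by simp
    show "\<bar>X (n + N)\<bar> \<le> 1" for n using N[of "n + N"] by simp
    show "(\<lambda>n. X (n + N)) \<longlonglongrightarrow> 0" using X(2) by (rule LIMSEQ_ignore_initial_segment)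
  qed
  then show "((\<lambda>h. (F h - F 0) /\<^sub>R h) \<circ> X) \<longlonglongrightarrow> D"
    unfolding o_def by (rule LIMSEQ_offset)
qed

text \<open>By the mean value bound the difference quotients are dominated by
  \<open>B * norm (w y)\<close> on \<open>K'\<close>, a compact set outside which all translates by
  steps of size at most 1 vanish. With \<open>w = 1\<close> this yields
  \<open>integral_dird_zero\<close>, with a kernel the derivative of a convolution.\<close>

lemma integral_dird:
  fixes u w :: "'a::euclidean_space \<Rightarrow> complex"
  assumes u: "cc1 u" and w: "continuous_on UNIV w"
  shows "((\<lambda>t. LINT y|lborel. u (y + x + t *\<^sub>R e) * w y) has_vector_derivative (LINT y|lborel. dird e u (y + x) * w y)) (at 0)"
proof (rule has_vector_derivative_sequentially)
  fix h :: "nat \<Rightarrow> real"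
  assume h: "\<And>n. h n \<noteq> 0" "\<And>n. \<bar>h n\<bar> \<le> 1" "h \<longlonglongrightarrow> 0"
  obtain B where B: "0 < B" "\<And>x. norm (dird e u x) \<le> B" using cc_bounded[OF cc1D(3)[OF u]] by metis
  obtain K where K: "compact K" "\<And>x. x \<notin> K \<Longrightarrow> u x = 0" using cc_support[OF cc1D(1)[OF u]] by metis
  define K' where "K' = (\<lambda>(k, t). k - (x + t *\<^sub>R e)) ` (K \<times> {-1..1})"
  have K': "compact K'"
    unfolding K'_def using K(1)
    by (intro compact_continuous_image compact_Times) (auto simp: case_prod_beta intro!: continuous_intros)
  have z: "u (y + x + t *\<^sub>R e) = 0" if "y \<notin> K'" "\<bar>t\<bar> \<le> 1" for y t
  proof (rule K(2), rule notI)
    assume "y + x + t *\<^sub>R e \<in> K"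
    then have "y \<in> K'" unfolding K'_def using that(2) by (intro image_eqI[of _ _ "(y + x + t *\<^sub>R e, t)"]) (auto simp: abs_le_iff)
    then show False using that by blast
  qed
  have cu: "continuous_on UNIV u" by (rule cc_continuous[OF cc1D(1)[OF u]])
  have ccF: "cc (\<lambda>y. u (y + x + t *\<^sub>R e) * w y)" if "\<bar>t\<bar> \<le> 1" for t
    unfolding cc_def using z[OF _ that] K' w
    by (auto intro!: exI[of _ K'] continuous_intros continuous_on_compose2[OF cu])
  define s where "s n y = (u (y + x + h n *\<^sub>R e) * w y - u (y + x) * w y) /\<^sub>R h n" for n y
  have ccs: "cc (s n)" for n
  proof -
    have "cc (\<lambda>y. complex_of_real (inverse (h n)) * (u (y + x + h n *\<^sub>R e) * w y + - (u (y + x + 0 *\<^sub>R e) * w y)))"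
      by (intro cc_mult_left cc_add cc_uminus ccF) (use h in auto)
    then show ?thesis by (simp add: s_def[abs_def] scaleR_conv_of_real)
  qed
  have "(\<lambda>n. LINT y|lborel. s n y) \<longlonglongrightarrow> (LINT y|lborel. dird e u (y + x) * w y)"
  proof (rule integral_dominated_convergence[where w = "\<lambda>y. indicator K' y *\<^sub>R (B * norm (w y))"])
    have "cc (\<lambda>y. dird e u (y + x) * w y)" by (rule cc_mult_right[OF cc_translate[OF cc1D(3)[OF u]] w])
    then show "(\<lambda>y. dird e u (y + x) * w y) \<in> borel_measurable lborel" using cc_measurable by simp
    show "s n \<in> borel_measurable lborel" for n using cc_measurable[OF ccs] by simp
    show "integrable lborel (\<lambda>y. indicator K' y *\<^sub>R (B * norm (w y)))"
      using K' w by (intro borel_integrable_compact continuous_intros) (auto intro: continuous_on_subset)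
    show "AE y in lborel. (\<lambda>n. s n y) \<longlonglongrightarrow> dird e u (y + x) * w y"
    proof (rule AE_I2)
      fix y
      have "((\<lambda>t. u ((y + x) + t *\<^sub>R e)) has_vector_derivative dird e u (y + x)) (at 0)"
        using cc1D(2)[OF u] unfolding has_dird_def by blast
      then have "((\<lambda>t. (u (y + x + t *\<^sub>R e) - u (y + x)) /\<^sub>R t) \<longlongrightarrow> dird e u (y + x)) (at 0)"
        unfolding has_vector_derivative_iff_quotient by simp
      then have "(\<lambda>n. (u (y + x + h n *\<^sub>R e) - u (y + x)) /\<^sub>R h n) \<longlonglongrightarrow> dird e u (y + x)"
        using h unfolding tendsto_at_iff_sequentially by (auto simp: o_def)
      from tendsto_mult[OF this tendsto_const[of "w y"]]
      show "(\<lambda>n. s n y) \<longlonglongrightarrow> dird e u (y + x) * w y"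
        by (simp add: s_def left_diff_distrib)
    qed
    show "AE y in lborel. norm (s n y) \<le> indicator K' y *\<^sub>R (B * norm (w y))" for n
    proof (rule AE_I2)
      fix y
      show "norm (s n y) \<le> indicator K' y *\<^sub>R (B * norm (w y))"
      proof (cases "y \<in> K'")
        case True
        have "norm (u (y + x + h n *\<^sub>R e) - u (y + x)) \<le> B * \<bar>h n\<bar>" by (rule cc1_increment_bound[OF u B(2)])
        then have "norm (u (y + x + h n *\<^sub>R e) - u (y + x)) / \<bar>h n\<bar> \<le> B" using h(1)[of n] by (simp add: divide_le_eq)
        moreover have "norm (s n y) = norm (u (y + x + h n *\<^sub>R e) - u (y + x)) / \<bar>h n\<bar> * norm (w y)"
          unfolding s_def left_diff_distrib[symmetric] by (simp add: norm_mult divide_inverse_commute)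
        ultimately have "norm (s n y) \<le> B * norm (w y)" by (simp only: mult_right_mono norm_ge_zero)
        then show ?thesis using True by simp
      next
        case False
        then show ?thesis using z[OF False h(2)[of n]] z[OF False, of 0] by (simp add: s_def)
      qed
    qed
  qed
  moreover have "(LINT y|lborel. s n y) = ((LINT y|lborel. u (y + x + h n *\<^sub>R e) * w y) - (LINT y|lborel. u (y + x + 0 *\<^sub>R e) * w y)) /\<^sub>R h n" for n
  proof -
    have "(LINT y|lborel. s n y) = (LINT y|lborel. u (y + x + h n *\<^sub>R e) * w y - u (y + x + 0 *\<^sub>R e) * w y) /\<^sub>R h n"
      by (simp add: s_def)
    also have "(LINT y|lborel. u (y + x + h n *\<^sub>R e) * w y - u (y + x + 0 *\<^sub>R e) * w y)
      = (LINT y|lborel. u (y + x + h n *\<^sub>R e) * w y) - (LINT y|lborel. u (y + x + 0 *\<^sub>R e) * w y)"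
      by (intro Bochner_Integration.integral_diff cc_integrable ccF) (use h in auto)
    finally show ?thesis .
  qed
  ultimately show "(\<lambda>n. ((LINT y|lborel. u (y + x + h n *\<^sub>R e) * w y) - (LINT y|lborel. u (y + x + 0 *\<^sub>R e) * w y)) /\<^sub>R h n) \<longlonglongrightarrow> (LINT y|lborel. dird e u (y + x) * w y)"
    by simp
qed

lemma integral_translation:
  fixes g :: "'a::euclidean_space \<Rightarrow> complex"
  assumes "g \<in> borel_measurable borel"
  shows "(LINT y|lborel. g (y + c)) = (LINT y|lborel. g y)"
proof -
  have "(LINT y|lborel. g y) = (LINT y|distr lborel borel ((+) c). g y)" by (simp only: lborel_distr_plus)
  also have "\<dots> = (LINT y|lborel. g (c + y))" using assms by (intro integral_distr) auto
  finally show ?thesis by (simp add: add.commute)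
qed

text \<open>The integral of a translate does not depend on the translation, and the derivative of
  this constant is the integral of the directional derivative.\<close>

lemma integral_dird_zero:
  fixes u :: "'a::euclidean_space \<Rightarrow> complex"
  assumes u: "cc1 u"
  shows "(LINT y|lborel. dird e u y) = 0"
proof -
  have "(LINT y|lborel. u (y + 0 + t *\<^sub>R e) * 1) = (LINT y|lborel. u y)" for t
    using integral_translation[OF cc_measurable[OF cc1D(1)[OF u]], of "t *\<^sub>R e"] by simp
  then have "((\<lambda>t::real. LINT y|lborel. u y) has_vector_derivative (LINT y|lborel. dird e u (y + 0) * 1)) (at 0)"
    using integral_dird[OF u continuous_on_const[of UNIV 1], of 0 e] by simp
  moreover have "((\<lambda>t::real. LINT y|lborel. u y) has_vector_derivative 0) (at 0)" by (rule has_vector_derivative_const)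
  ultimately have "(LINT y|lborel. dird e u (y + 0) * 1) = 0" by (rule vector_derivative_unique_at)
  then show ?thesis by simp
qed


section \<open>Mollification\<close>

text \<open>Convolution with the reflection of \<open>w\<close>. Differentiation in \<open>x\<close>
  falls directly on \<open>v\<close>; moved to \<open>w\<close> by a translation it acquires a minus
  sign.\<close>

definition conv :: "('a::euclidean_space \<Rightarrow> complex) \<Rightarrow> ('a \<Rightarrow> complex) \<Rightarrow> 'a \<Rightarrow> complex" where
  "conv v w x = (LINT y|lborel. v (y + x) * w y)"

lemma conv_integrable: "cc v \<Longrightarrow> cc w \<Longrightarrow> integrable lborel (\<lambda>y. v (y + x) * w y)"
  by (intro cc_integrable cc_mult_left continuous_on_compose2[OF cc_continuous[of v UNIV]] continuous_intros) auto

lemma conv_alt: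
  assumes "cc v" "cc w"
  shows "conv v w x = (LINT y|lborel. w (y + (- x)) * v y)"
proof -
  have "(\<lambda>y. v (y + x) * w y) \<in> borel_measurable borel"
    using borel_measurable_integrable[OF conv_integrable[OF assms, of x]] by simp
  from integral_translation[OF this, of "- x"] show ?thesis by (simp add: conv_def mult.commute)
qed

lemma cc_conv:
  assumes v: "cc v" and w: "cc w"
  shows "cc (conv v w)"
proof -
  obtain K where K: "compact K" "\<And>x. x \<notin> K \<Longrightarrow> v x = 0" using cc_support[OF v] by metis
  obtain L where L: "compact L" "\<And>x. x \<notin> L \<Longrightarrow> w x = 0" using cc_support[OF w] by metis
  obtain B where B: "0 < B" "\<And>x. norm (v x) \<le> B" using cc_bounded[OF v] by metis
  define M where "M = (\<lambda>(a, b). a - b) ` (K \<times> L)"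
  have "compact M" unfolding M_def using K L
    by (intro compact_continuous_image compact_Times) (auto simp: case_prod_beta intro!: continuous_intros)
  moreover have "conv v w x = 0" if "x \<notin> M" for x
  proof -
    have z: "v (y + x) * w y = 0" for y
    proof (rule ccontr)
      assume "v (y + x) * w y \<noteq> 0"
      then have "y + x \<in> K" "y \<in> L" using K(2) L(2) by auto
      then have "x \<in> M" unfolding M_def by (intro image_eqI[of _ _ "(y + x, y)"]) auto
      then show False using that by blast
    qed
    show ?thesis by (simp only: conv_def z integral_zero)
  qed
  moreover have "continuous (at x) (conv v w)" for x
    unfolding continuous_at_sequentially
  proof (intro allI impI)
    fix X assume X: "X \<longlonglongrightarrow> x"
    have "(\<lambda>n. LINT y|lborel. v (y + X n) * w y) \<longlonglongrightarrow> (LINT y|lborel. v (y + x) * w y)"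
    proof (rule integral_dominated_convergence[where w = "\<lambda>y. B * norm (w y)"])
      show "AE y in lborel. (\<lambda>n. v (y + X n) * w y) \<longlonglongrightarrow> v (y + x) * w y"
      proof (rule AE_I2)
        fix y
        have "(\<lambda>n. v (y + X n)) \<longlonglongrightarrow> v (y + x)"
          using cc_continuous[OF v, of UNIV] X by (intro continuous_on_tendsto_compose[of UNIV v] tendsto_intros) auto
        then show "(\<lambda>n. v (y + X n) * w y) \<longlonglongrightarrow> v (y + x) * w y" by (intro tendsto_intros)
      qed
      show "AE y in lborel. norm (v (y + X n) * w y) \<le> B * norm (w y)" for n
        unfolding norm_mult using B(2) by (intro AE_I2 mult_right_mono) auto
      show "integrable lborel (\<lambda>y. B * norm (w y))" using cc_integrable[OF w] by auto
    qed (use borel_measurable_integrable[OF conv_integrable[OF v w]] in blast)+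
    then show "(conv v w \<circ> X) \<longlonglongrightarrow> conv v w x" by (simp add: o_def conv_def)
  qed
  ultimately show ?thesis unfolding cc_def using continuous_at_imp_continuous_on by blast
qed

lemma has_dird_conv_left:
  assumes "cc1 v" "cc w"
  shows "has_dird e (conv v w) (conv (dird e v) w)"
  unfolding has_dird_def conv_def
  using integral_dird[OF assms(1) cc_continuous[OF assms(2)], of _ e] by (simp add: add.assoc)

lemma has_dird_uminus:
  assumes "has_dird e u u'"
  shows "has_dird (- e) u (\<lambda>x. - u' x)"
  unfolding has_dird_def
proof
  fix x
  have 1: "((\<lambda>t. u (x + t *\<^sub>R e)) has_vector_derivative u' x) (at (- 0))" using assms by (simp add: has_dird_def)
  have 2: "(uminus has_vector_derivative (- 1 :: real)) (at 0)" by (auto intro!: derivative_eq_intros)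
  from vector_diff_chain_at[OF 2 1]
  show "((\<lambda>t. u (x + t *\<^sub>R - e)) has_vector_derivative - u' x) (at 0)" by (simp add: o_def)
qed

lemma has_dird_conv_right:
  assumes v: "cc v" and w: "cc1 w"
  shows "has_dird e (conv v w) (\<lambda>x. - conv v (dird e w) x)"
  unfolding has_dird_def
proof
  fix x
  have neg: "dird (- e) w = (\<lambda>x. - dird e w x)" by (rule has_dird_unique[OF has_dird_uminus[OF cc1D(2)[OF w]]])
  have eq: "conv v w (x + t *\<^sub>R e) = (LINT y|lborel. w (y + (- x) + t *\<^sub>R (- e)) * v y)" for t
    unfolding conv_alt[OF v cc1D(1)[OF w]] by (simp add: algebra_simps)
  have "((\<lambda>t. LINT y|lborel. w (y + (- x) + t *\<^sub>R (- e)) * v y) has_vector_derivative (LINT y|lborel. dird (- e) w (y + (- x)) * v y)) (at 0)"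
    by (rule integral_dird[OF w cc_continuous[OF v]])
  also have "(LINT y|lborel. dird (- e) w (y + (- x)) * v y) = - conv v (dird e w) x"
    unfolding conv_alt[OF v cc1D(3)[OF w]] neg by simp
  finally show "((\<lambda>t. conv v w (x + t *\<^sub>R e)) has_vector_derivative - conv v (dird e w) x) (at 0)"
    unfolding eq .
qed

lemma cc1_conv: "cc v \<Longrightarrow> cc1 w \<Longrightarrow> cc1 (conv v w)"
  by (rule cc1I[OF _ has_dird_conv_right]) (auto intro: cc_conv cc_uminus cc1D)

text \<open>A substitute for the symmetry of second derivatives, as \<open>v\<close> has only first
  ones. One derivative is put on the kernel: both sides equal
  \<open>- conv (dird e v) (dird e' w)\<close>, the right one because
  \<open>conv (dird e' v) w\<close> is \<open>- conv v (dird e' w)\<close>.\<close>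

lemma dird_conv_commute:
  assumes v: "cc1 v" and w: "cc1 w"
  shows "dird e' (conv (dird e v) w) = dird e (conv (dird e' v) w)"
proof -
  have 1: "dird e' (conv (dird e v) w) = (\<lambda>x. - conv (dird e v) (dird e' w) x)"
    by (rule has_dird_unique[OF has_dird_conv_right[OF cc1D(3)[OF v] w]])
  have "dird e (conv v (dird e' w)) = conv (dird e v) (dird e' w)"
    by (rule has_dird_unique[OF has_dird_conv_left[OF v cc1D(3)[OF w]]])
  moreover have "has_dird e (conv v (dird e' w)) (conv (dird e v) (dird e' w))"
    by (rule has_dird_conv_left[OF v cc1D(3)[OF w]])
  ultimately have "has_dird e (\<lambda>x. - conv v (dird e' w) x) (\<lambda>x. - conv (dird e v) (dird e' w) x)"
    unfolding has_dird_def by (auto intro: has_vector_derivative_minus)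
  moreover have "(\<lambda>x. - conv v (dird e' w) x) = conv (dird e' v) w"
    using has_dird_unique[OF has_dird_conv_right[OF cc1D(1)[OF v] w, of e']]
      has_dird_unique[OF has_dird_conv_left[OF v cc1D(1)[OF w], of e']] by simp
  ultimately show ?thesis using 1 has_dird_unique by metis
qed

text \<open>The square makes the bump C^1 across the sphere of radius \<open>r\<close>, with an
  explicit derivative; one derivative is all that is ever shifted onto the kernel.\<close>

definition kern0 :: "real \<Rightarrow> 'a::euclidean_space \<Rightarrow> real" where
  "kern0 r x = (max 0 (r\<^sup>2 - x \<bullet> x))\<^sup>2"

definition kern :: "real \<Rightarrow> 'a::euclidean_space \<Rightarrow> complex" where
  "kern r x = complex_of_real (kern0 r x / (LINT y|lborel. kern0 r (y::'a)))"

lemma kern0_zero: "0 < r \<Longrightarrow> r \<le> norm x \<Longrightarrow> kern0 r x = 0"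
  by (simp add: kern0_def dot_square_norm power_mono)

lemma cc1_kern0:
  assumes r: "r > 0"
  shows "cc1 (\<lambda>x::'a::euclidean_space. complex_of_real (kern0 r x))"
proof (rule cc1I)
  have z: "kern0 r x = 0" "max 0 (r\<^sup>2 - x \<bullet> x) = 0" if "x \<notin> cball 0 r" for x :: 'a
    using that r by (auto simp: kern0_def dot_square_norm power_mono)
  show "cc (\<lambda>x::'a. complex_of_real (kern0 r x))"
    unfolding cc_def
  proof (intro conjI exI[of _ "cball 0 r"])
    show "continuous_on UNIV (\<lambda>x::'a. complex_of_real (kern0 r x))" unfolding kern0_def by (intro continuous_intros)
  qed (use z in auto)
  fix e :: 'a
  show "cc (\<lambda>x. complex_of_real (2 * max 0 (r\<^sup>2 - x \<bullet> x) * (- 2 * (x \<bullet> e))))"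
    unfolding cc_def
  proof (intro conjI exI[of _ "cball 0 r"])
    show "continuous_on UNIV (\<lambda>x. complex_of_real (2 * max 0 (r\<^sup>2 - x \<bullet> x) * (- 2 * (x \<bullet> e))))" by (intro continuous_intros)
  qed (use z in auto)
  show "has_dird e (\<lambda>x. complex_of_real (kern0 r x)) (\<lambda>x. complex_of_real (2 * max 0 (r\<^sup>2 - x \<bullet> x) * (- 2 * (x \<bullet> e))))"
    unfolding has_dird_def
  proof
    fix x
    have q: "r\<^sup>2 - (x + t *\<^sub>R e) \<bullet> (x + t *\<^sub>R e) = r\<^sup>2 - x \<bullet> x - 2 * t * (x \<bullet> e) - t\<^sup>2 * (e \<bullet> e)" for t
      by (simp add: inner_simps inner_commute power2_eq_square algebra_simps)
    have "((\<lambda>t. r\<^sup>2 - (x + t *\<^sub>R e) \<bullet> (x + t *\<^sub>R e)) has_real_derivative - 2 * (x \<bullet> e)) (at 0)"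
      unfolding q by (auto intro!: derivative_eq_intros)
    from DERIV_chain2[OF DERIV_max_0_square this]
    have "((\<lambda>t. kern0 r (x + t *\<^sub>R e)) has_real_derivative 2 * max 0 (r\<^sup>2 - x \<bullet> x) * (- 2 * (x \<bullet> e))) (at 0)"
      by (simp add: kern0_def)
    then show "((\<lambda>t. complex_of_real (kern0 r (x + t *\<^sub>R e))) has_vector_derivative complex_of_real (2 * max 0 (r\<^sup>2 - x \<bullet> x) * (- 2 * (x \<bullet> e)))) (at 0)"
      by (intro has_vector_derivative_of_real) (simp add: has_real_derivative_iff_has_vector_derivative)
  qed
qed

lemma kern0_integral_pos:
  assumes r: "r > 0"
  shows "integrable lborel (kern0 r :: 'a::euclidean_space \<Rightarrow> real)" "0 < (LINT y|lborel. kern0 r (y::'a))"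
proof -
  have "integrable lborel (\<lambda>x::'a. complex_of_real (kern0 r x))" using cc_integrable[OF cc1D(1)[OF cc1_kern0[OF r]]] .
  then show int: "integrable lborel (kern0 r :: 'a \<Rightarrow> real)" by (simp add: complex_of_real_integrable_eq)
  define c where "c = (r\<^sup>2 - (r / 2)\<^sup>2)\<^sup>2"
  have "r\<^sup>2 - (r / 2)\<^sup>2 = 3 / 4 * r\<^sup>2" by (simp add: power2_eq_square field_simps)
  then have rp: "0 < r\<^sup>2 - (r / 2)\<^sup>2" using r by simp
  then have c: "0 < c" by (simp add: c_def)
  have le: "indicator (ball 0 (r / 2)) x *\<^sub>R c \<le> kern0 r x" for x :: 'a
  proof (cases "x \<in> ball 0 (r / 2)")
    case True
    then have "x \<bullet> x \<le> (r / 2)\<^sup>2" by (simp add: dot_square_norm power_mono)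
    then have "c \<le> (max 0 (r\<^sup>2 - x \<bullet> x))\<^sup>2" unfolding c_def using rp by (intro power_mono) auto
    then show ?thesis using True by (simp add: kern0_def)
  qed (simp add: kern0_def)
  have fin: "emeasure lborel (ball (0::'a) (r / 2)) < \<infinity>" by (rule emeasure_lborel_ball_finite)
  have "(LINT x|lborel. indicator (ball (0::'a) (r / 2)) x *\<^sub>R c) \<le> (LINT x|lborel. kern0 r (x::'a))"
    using fin int le by (intro integral_mono integrable_scaleR_left integrable_real_indicator) auto
  moreover have "(LINT x|lborel. indicator (ball (0::'a) (r / 2)) x *\<^sub>R c) = measure lborel (ball (0::'a) (r / 2)) * c"
    using fin by simp
  moreover have "0 < measure lborel (ball (0::'a) (r / 2))" using r content_ball_gt_0_iff by simp
  ultimately show "0 < (LINT y|lborel. kern0 r (y::'a))" using c by (smt (verit) mult_pos_pos)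
qed

lemma cc1_kern: "r > 0 \<Longrightarrow> cc1 (kern r :: 'a::euclidean_space \<Rightarrow> complex)"
  using cc1_cmult(1)[OF cc1_kern0, of r "complex_of_real (1 / (LINT y|lborel. kern0 r (y::'a)))"]
  by (simp add: kern_def[abs_def])

lemma kern_norm:
  assumes "r > 0"
  shows "integrable lborel (\<lambda>x::'a::euclidean_space. norm (kern r x))" "(LINT x|lborel. norm (kern r (x::'a))) = 1" "(LINT x|lborel. kern r (x::'a)) = 1"
proof -
  let ?I = "LINT y|lborel. kern0 r (y::'a)"
  note p = kern0_integral_pos[OF assms, where 'a = 'a]
  have n: "norm (kern r x) = kern0 r x / ?I" for x :: 'a
    using p(2) by (simp add: kern_def kern0_def norm_divide norm_power)
  show "integrable lborel (\<lambda>x::'a. norm (kern r x))" unfolding n using p(1) by simp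
  show "(LINT x|lborel. norm (kern r (x::'a))) = 1" unfolding n using p by simp
  show "(LINT x|lborel. kern r (x::'a)) = 1" unfolding kern_def using p by (simp add: integral_complex_of_real)
qed

lemma norm_conv_kern_le:
  fixes v :: "'a::euclidean_space \<Rightarrow> complex"
  assumes v: "cc v" "\<And>x. norm (v x) \<le> B" and r: "r > 0"
  shows "norm (conv v (kern r) x) \<le> B"
proof -
  note k = kern_norm[OF r, where 'a = 'a]
  have "norm (conv v (kern r) x) \<le> (LINT y|lborel. B * norm (kern r (y::'a)))"
    unfolding conv_def
    using v(2) by (intro Bochner_Integration.integral_norm_bound_integral conv_integrable v cc1D(1)[OF cc1_kern[OF r]] integrable_mult_right k)
      (auto simp: norm_mult intro!: mult_right_mono)
  then show ?thesis using k(2) by simp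
qed

lemma conv_kern_tendsto:
  fixes v :: "'a::euclidean_space \<Rightarrow> complex"
  assumes v: "cc v" and r: "\<And>n. r n > 0" "r \<longlonglongrightarrow> 0"
  shows "(\<lambda>n. conv v (kern (r n)) x) \<longlonglongrightarrow> v x"
proof (rule LIMSEQ_I)
  fix \<epsilon> :: real assume \<epsilon>: "0 < \<epsilon>"
  have "isCont v x" using cc_continuous[OF v, of UNIV] by (simp add: continuous_on_eq_continuous_at)
  then obtain d where d: "d > 0" "\<And>y. dist y x < d \<Longrightarrow> dist (v y) (v x) < \<epsilon> / 2"
    unfolding continuous_at_eps_delta using \<epsilon> by (metis half_gt_zero)
  have "\<forall>\<^sub>F n in sequentially. r n < d" using d r by (intro order_tendstoD) auto
  then obtain N where N: "\<And>n. n \<ge> N \<Longrightarrow> r n < d" unfolding eventually_sequentially by metis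
  have "norm (conv v (kern (r n)) x - v x) < \<epsilon>" if n: "n \<ge> N" for n
  proof -
    note k = kern_norm[OF r(1)[of n], where 'a = 'a]
    have ck: "cc (kern (r n) :: 'a \<Rightarrow> complex)" by (rule cc1D(1)[OF cc1_kern[OF r(1)]])
    have i1: "integrable lborel (\<lambda>y. v (y + x) * kern (r n) y)" by (rule conv_integrable[OF v ck])
    have i2: "integrable lborel (\<lambda>y::'a. v x * kern (r n) y)" using cc_integrable[OF ck] by (rule integrable_mult_right)
    have "conv v (kern (r n)) x - v x = (LINT y|lborel. v (y + x) * kern (r n) y) - (LINT y|lborel. v x * kern (r n) (y::'a))"
      using k(3) by (simp add: conv_def)
    also have "\<dots> = (LINT y|lborel. v (y + x) * kern (r n) y - v x * kern (r n) y)"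
      by (rule Bochner_Integration.integral_diff[symmetric, OF i1 i2])
    also have "norm \<dots> \<le> (LINT y|lborel. \<epsilon> / 2 * norm (kern (r n) (y::'a)))"
    proof (rule Bochner_Integration.integral_norm_bound_integral)
      show "integrable lborel (\<lambda>y. v (y + x) * kern (r n) y - v x * kern (r n) y)" by (rule Bochner_Integration.integrable_diff[OF i1 i2])
      show "integrable lborel (\<lambda>y::'a. \<epsilon> / 2 * norm (kern (r n) y))" using k(1) by (rule integrable_mult_right)
      fix y :: 'a
      show "norm (v (y + x) * kern (r n) y - v x * kern (r n) y) \<le> \<epsilon> / 2 * norm (kern (r n) y)"
      proof (cases "norm y < r n")
        case True
        then have "dist (y + x) x < d" using N[OF n] by (simp add: dist_norm)
        then have "norm (v (y + x) - v x) \<le> \<epsilon> / 2" using d(2)[of "y + x"] by (simp add: dist_norm)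
        then show ?thesis unfolding left_diff_distrib[symmetric] norm_mult by (rule mult_right_mono) simp
      next
        case False
        then have "kern (r n) y = 0" using kern0_zero[OF r(1), of n y] by (simp add: kern_def)
        then show ?thesis by simp
      qed
    qed
    also have "\<dots> = \<epsilon> / 2" using k(2) by simp
    finally show ?thesis using \<epsilon> by simp
  qed
  then show "\<exists>N. \<forall>n\<ge>N. norm (conv v (kern (r n)) x - v x) < \<epsilon>" by blast
qed


section \<open>Wirtinger derivatives and divergence-free cofactors\<close>

text \<open>For the directions \<open>axis k 1\<close> and \<open>axis k \<i>\<close> this is the
  operator d/dz_k. It is written as a sum of multiples to fit the closure rules for
  \<open>cc\<close> and \<open>cc1\<close>.\<close>

definition wirt :: "'a::euclidean_space \<times> 'a \<Rightarrow> ('a \<Rightarrow> complex) \<Rightarrow> 'a \<Rightarrow> complex" where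
  "wirt d u x = (1 / 2) * (dird (fst d) u x + - \<i> * dird (snd d) u x)"

lemma cc_wirt: "cc1 u \<Longrightarrow> cc (wirt d u)"
  unfolding wirt_def[abs_def] by (intro cc_mult_left cc_add continuous_on_const cc1D(3))

lemma integral_wirt_zero: "cc1 u \<Longrightarrow> (LINT x|lborel. wirt d u x) = 0"
  unfolding wirt_def
  by (subst integral_mult_right_zero, subst Bochner_Integration.integral_add)
    (auto simp: integral_dird_zero intro!: cc_integrable cc_mult_left cc1D(3))

lemma wirt_prod:
  assumes "finite A" "A \<noteq> {}" "\<And>i. i \<in> A \<Longrightarrow> cc1 (u i)"
  shows "wirt d (\<lambda>x. \<Prod>i\<in>A. u i x) x = (\<Sum>i\<in>A. wirt d (u i) x * (\<Prod>j\<in>A - {i}. u j x))"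
  using cc1_prod[of A u, OF assms]
  by (simp add: wirt_def sum_distrib_left sum.distrib[symmetric] algebra_simps)

lemma conv_wirt:
  assumes v: "cc1 v" and w: "cc1 w"
  shows "conv (wirt d v) w x = (1 / 2) * (conv (dird (fst d) v) w x + - \<i> * conv (dird (snd d) v) w x)"
proof -
  note i = conv_integrable[OF cc1D(3)[OF v] cc1D(1)[OF w]]
  have "conv (wirt d v) w x = (LINT y|lborel. (1 / 2) * (dird (fst d) v (y + x) * w y + - \<i> * (dird (snd d) v (y + x) * w y)))"
    unfolding conv_def wirt_def by (simp add: algebra_simps)
  also have "\<dots> = (1 / 2) * ((LINT y|lborel. dird (fst d) v (y + x) * w y) + (LINT y|lborel. - \<i> * (dird (snd d) v (y + x) * w y)))"
    unfolding integral_mult_right_zero by (subst Bochner_Integration.integral_add[OF i integrable_mult_right[OF i]]) simp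
  finally show ?thesis unfolding conv_def integral_mult_right_zero .
qed

lemma wirt_conv_commute:
  assumes v: "cc1 v" and w: "cc1 w"
  shows "wirt d' (conv (wirt d v) w) x = wirt d (conv (wirt d' v) w) x"
proof -
  have c: "cc1 (conv (dird e v) w)" for e using v w by (intro cc1_conv cc1D(3))
  have eq: "conv (wirt d v) w = (\<lambda>x. (1 / 2) * (conv (dird (fst d) v) w x + - \<i> * conv (dird (snd d) v) w x))" for d
    using conv_wirt[OF v w] by (intro ext)
  have D: "dird e (conv (wirt d v) w) = (\<lambda>x. (1 / 2) * (dird e (conv (dird (fst d) v) w) x + - \<i> * dird e (conv (dird (snd d) v) w) x))" for e d
    unfolding eq cc1_cmult(2)[OF cc1_add(1)[OF c cc1_cmult(1)[OF c]]] cc1_add(2)[OF c cc1_cmult(1)[OF c]] cc1_cmult(2)[OF c] ..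
  show ?thesis unfolding wirt_def[of _ "conv _ _"] D
    by (simp only: dird_conv_commute[OF v w, of "fst d'" "fst d"] dird_conv_commute[OF v w, of "fst d'" "snd d"]
         dird_conv_commute[OF v w, of "snd d'" "fst d"] dird_conv_commute[OF v w, of "snd d'" "snd d"]) (simp add: algebra_simps)
qed

text \<open>Expanding the divergence of u times the cofactors, the terms with a second derivative of
  column c cancel in pairs under composition with the transposition of b and c.\<close>

lemma integral_det_commuting_zero:
  fixes d :: "'i \<Rightarrow> 'a::euclidean_space \<times> 'a" and H :: "'i \<Rightarrow> 'i \<Rightarrow> 'a \<Rightarrow> complex"
  assumes S: "finite S" "b \<in> S" and u: "cc1 u" and H: "\<And>i c. cc1 (H i c)"
    and comm: "\<And>i j c x. wirt (d i) (H j c) x = wirt (d j) (H i c) x"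
  shows "(LINT x|lborel. (\<Sum>p\<in>{p. p permutes S}. of_int (sign p) * (wirt (d (p b)) u x * (\<Prod>c\<in>S - {b}. H (p c) c x)))) = 0"
proof -
  let ?P = "{p. p permutes S}"
  \<comment> \<open>The test function occupies column \<open>b\<close>. Differentiating the product
    of all columns in the direction \<open>d (p b)\<close> gives the integrand of the claim plus one
    term \<open>R c p\<close> for each other column.\<close>
  define h where "h p c = (if c = b then u else H (p c) c)" for p c
  have h: "cc1 (h p c)" for p c using u H by (simp add: h_def)
  define R where "R c p x = wirt (d (p b)) (H (p c) c) x * (u x * (\<Prod>k\<in>S - {b} - {c}. H (p k) k x))" for c p x
  have expand: "wirt (d (p b)) (\<lambda>x. \<Prod>c\<in>S. h p c x) x = wirt (d (p b)) u x * (\<Prod>c\<in>S - {b}. H (p c) c x) + (\<Sum>c\<in>S - {b}. R c p x)" for p x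
  proof -
    have "wirt (d (p b)) (\<lambda>x. \<Prod>c\<in>S. h p c x) x = (\<Sum>c\<in>S. wirt (d (p b)) (h p c) x * (\<Prod>k\<in>S - {c}. h p k x))"
      using S h by (intro wirt_prod) auto
    also have "\<dots> = wirt (d (p b)) (h p b) x * (\<Prod>k\<in>S - {b}. h p k x) + (\<Sum>c\<in>S - {b}. wirt (d (p b)) (h p c) x * (\<Prod>k\<in>S - {c}. h p k x))"
      by (rule sum.remove[OF S])
    also have "(\<Prod>k\<in>S - {b}. h p k x) = (\<Prod>c\<in>S - {b}. H (p c) c x)"
      by (intro prod.cong) (auto simp: h_def)
    also have "(\<Sum>c\<in>S - {b}. wirt (d (p b)) (h p c) x * (\<Prod>k\<in>S - {c}. h p k x)) = (\<Sum>c\<in>S - {b}. R c p x)"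
    proof (rule sum.cong[OF refl])
      fix c assume c: "c \<in> S - {b}"
      have "(\<Prod>k\<in>S - {c}. h p k x) = h p b x * (\<Prod>k\<in>S - {c} - {b}. h p k x)"
        using S c by (intro prod.remove) auto
      also have "(\<Prod>k\<in>S - {c} - {b}. h p k x) = (\<Prod>k\<in>S - {b} - {c}. H (p k) k x)"
        by (intro prod.cong) (auto simp: h_def)
      finally show "wirt (d (p b)) (h p c) x * (\<Prod>k\<in>S - {c}. h p k x) = R c p x" using c by (simp add: R_def h_def)
    qed
    finally show ?thesis by (simp add: h_def)
  qed
  have cancel: "(\<Sum>p\<in>?P. of_int (sign p) * R c p x) = 0" if c: "c \<in> S - {b}" for c x
  proof -
    let ?t = "Transposition.transpose b c"
    have t: "?t permutes S" using c S by (intro permutes_swap_id) auto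
    have R': "R c (p \<circ> ?t) x = R c p x" for p
    proof -
      have "(\<Prod>k\<in>S - {b} - {c}. H ((p \<circ> ?t) k) k x) = (\<Prod>k\<in>S - {b} - {c}. H (p k) k x)"
        by (intro prod.cong) (auto simp: Transposition.transpose_def)
      then show ?thesis using comm[of "p c" "p b" c x] by (simp add: R_def)
    qed
    have "(\<Sum>p\<in>?P. of_int (sign p) * R c p x) = (\<Sum>p\<in>?P. of_int (sign (p \<circ> ?t)) * R c (p \<circ> ?t) x)"
      by (rule sum_permutations_compose_right[OF t])
    also have "\<dots> = (\<Sum>p\<in>?P. - (of_int (sign p) * R c p x))"
    proof (rule sum.cong[OF refl])
      fix p assume "p \<in> ?P"
      then have "permutation p" using permutes_imp_permutation[OF S(1)] by blast
      then have "sign (p \<circ> ?t) = - sign p"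
        using sign_compose[OF _ permutation_swap_id, of p b c] c by (auto simp: sign_swap_id)
      then show "of_int (sign (p \<circ> ?t)) * R c (p \<circ> ?t) x = - (of_int (sign p) * R c p x)" by (simp add: R')
    qed
    finally show ?thesis by (simp add: sum_negf)
  qed
  have "(\<Sum>p\<in>?P. of_int (sign p) * (wirt (d (p b)) u x * (\<Prod>c\<in>S - {b}. H (p c) c x)))
      = (\<Sum>p\<in>?P. of_int (sign p) * wirt (d (p b)) (\<lambda>x. \<Prod>c\<in>S. h p c x) x)" for x
  proof -
    have "(\<Sum>p\<in>?P. of_int (sign p) * wirt (d (p b)) (\<lambda>x. \<Prod>c\<in>S. h p c x) x)
      = (\<Sum>p\<in>?P. of_int (sign p) * (wirt (d (p b)) u x * (\<Prod>c\<in>S - {b}. H (p c) c x))) + (\<Sum>p\<in>?P. \<Sum>c\<in>S - {b}. of_int (sign p) * R c p x)"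
      unfolding expand distrib_left sum.distrib by (simp add: sum_distrib_left)
    also have "(\<Sum>p\<in>?P. \<Sum>c\<in>S - {b}. of_int (sign p) * R c p x) = (\<Sum>c\<in>S - {b}. \<Sum>p\<in>?P. of_int (sign p) * R c p x)" by (rule sum.swap)
    also have "\<dots> = 0" using cancel by simp
    finally show ?thesis by simp
  qed
  then have "(LINT x|lborel. (\<Sum>p\<in>?P. of_int (sign p) * (wirt (d (p b)) u x * (\<Prod>c\<in>S - {b}. H (p c) c x))))
     = (LINT x|lborel. (\<Sum>p\<in>?P. of_int (sign p) * wirt (d (p b)) (\<lambda>x. \<Prod>c\<in>S. h p c x) x))" by simp
  also have "\<dots> = (\<Sum>p\<in>?P. LINT x|lborel. of_int (sign p) * wirt (d (p b)) (\<lambda>x. \<Prod>c\<in>S. h p c x) x)"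
    using cc1_prod[of S "h _"] S h
    by (intro Bochner_Integration.integral_sum integrable_mult_right cc_integrable cc_wirt) auto
  also have "\<dots> = 0"
    using cc1_prod[of S "h _"] S h by (intro sum.neutral ballI) (subst integral_mult_right_zero, subst integral_wirt_zero, auto)
  finally show ?thesis .
qed

text \<open>The columns other than \<open>b\<close> are mollified, which makes the derivatives of
  their entries exist and commute; column \<open>b\<close> is left alone, since \<open>u b\<close>
  acts as the test function and is differentiated once. The mollification is removed by dominated
  convergence.\<close>

theorem integral_det_wirt_zero:
  fixes d :: "'i \<Rightarrow> 'a::euclidean_space \<times> 'a" and u :: "'i \<Rightarrow> 'a \<Rightarrow> complex"
  assumes S: "finite S" "b \<in> S" and u: "\<And>i. cc1 (u i)"
  shows "(LINT x|lborel. (\<Sum>p\<in>{p. p permutes S}. of_int (sign p) * (wirt (d (p b)) (u b) x * (\<Prod>c\<in>S - {b}. wirt (d (p c)) (u c) x)))) = 0"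
proof -
  let ?P = "{p. p permutes S}"
  define r where "r n = inverse (real (Suc n))" for n
  have r: "\<And>n. r n > 0" "r \<longlonglongrightarrow> 0" unfolding r_def using LIMSEQ_inverse_real_of_nat by auto
  define H where "H n i c = conv (wirt (d i) (u c)) (kern (r n))" for n i c
  have H: "cc1 (H n i c)" for n i c unfolding H_def using u r by (intro cc1_conv cc_wirt cc1_kern)
  have comm: "wirt (d i) (H n j c) x = wirt (d j) (H n i c) x" for n i j c x
    unfolding H_def by (rule wirt_conv_commute[OF u cc1_kern[OF r(1)]])
  define F where "F n x = (\<Sum>p\<in>?P. of_int (sign p) * (wirt (d (p b)) (u b) x * (\<Prod>c\<in>S - {b}. H n (p c) c x)))" for n x
  have Z: "(LINT x|lborel. F n x) = 0" for n
    unfolding F_def by (rule integral_det_commuting_zero[OF S u H comm])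
  have "\<exists>B. 0 < B \<and> (\<forall>x. norm (wirt (d i) (u c) x) \<le> B)" for i c
    using cc_bounded[OF cc_wirt[OF u]] by metis
  then obtain B where B: "\<And>i c. 0 < B i c" "\<And>i c x. norm (wirt (d i) (u c) x) \<le> B i c" by metis
  \<comment> \<open>A bound independent of \<open>n\<close>: averaging against a probability density
    does not increase the supremum norm.\<close>
  have HB: "norm (H n i c x) \<le> B i c" for n i c x
    unfolding H_def by (rule norm_conv_kern_le[OF cc_wirt[OF u] B(2) r(1)])
  define w where "w x = (\<Sum>p\<in>?P. norm (wirt (d (p b)) (u b) x) * (\<Prod>c\<in>S - {b}. B (p c) c))" for x
  have "(\<lambda>n. LINT x|lborel. F n x) \<longlonglongrightarrow> (LINT x|lborel. (\<Sum>p\<in>?P. of_int (sign p) * (wirt (d (p b)) (u b) x * (\<Prod>c\<in>S - {b}. wirt (d (p c)) (u c) x))))"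
  proof (rule integral_dominated_convergence[where w = w])
    have m: "wirt e (u i) \<in> borel_measurable lborel" for e i using cc_measurable[OF cc_wirt[OF u]] by simp
    show "(\<lambda>x. \<Sum>p\<in>?P. of_int (sign p) * (wirt (d (p b)) (u b) x * (\<Prod>c\<in>S - {b}. wirt (d (p c)) (u c) x))) \<in> borel_measurable lborel"
      by (intro borel_measurable_sum borel_measurable_times borel_measurable_prod borel_measurable_const m)
    have mH: "H n i c \<in> borel_measurable lborel" for n i c using cc_measurable[OF cc1D(1)[OF H]] by simp
    show "F n \<in> borel_measurable lborel" for n
      unfolding F_def[abs_def] by (intro borel_measurable_sum borel_measurable_times borel_measurable_prod borel_measurable_const m mH)
    show "integrable lborel w"
      unfolding w_def[abs_def] by (intro Bochner_Integration.integrable_sum integrable_mult_left integrable_norm cc_integrable cc_wirt u)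
    show "AE x in lborel. (\<lambda>n. F n x) \<longlonglongrightarrow> (\<Sum>p\<in>?P. of_int (sign p) * (wirt (d (p b)) (u b) x * (\<Prod>c\<in>S - {b}. wirt (d (p c)) (u c) x)))"
      unfolding F_def H_def by (intro AE_I2 tendsto_intros tendsto_sum tendsto_prod conv_kern_tendsto cc_wirt u r)
    show "AE x in lborel. norm (F n x) \<le> w x" for n
    proof (rule AE_I2)
      fix x
      have "norm (F n x) \<le> (\<Sum>p\<in>?P. norm (of_int (sign p) * (wirt (d (p b)) (u b) x * (\<Prod>c\<in>S - {b}. H n (p c) c x))))"
        unfolding F_def by (rule norm_sum)
      also have "\<dots> \<le> w x"
        unfolding w_def
      proof (rule sum_mono)
        fix p
        have "(\<Prod>c\<in>S - {b}. norm (H n (p c) c x)) \<le> (\<Prod>c\<in>S - {b}. B (p c) c)" using HB by (intro prod_mono) auto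
        moreover have "norm (of_int (sign p) :: complex) = 1" by (simp add: sign_def)
        ultimately show "norm (of_int (sign p) * (wirt (d (p b)) (u b) x * (\<Prod>c\<in>S - {b}. H n (p c) c x)))
          \<le> norm (wirt (d (p b)) (u b) x) * (\<Prod>c\<in>S - {b}. B (p c) c)"
          unfolding norm_mult prod_norm[symmetric] by (simp add: mult_left_mono)
      qed
      finally show "norm (F n x) \<le> w x" .
    qed
  qed
  from LIMSEQ_unique[OF tendsto_const this[unfolded Z]] show ?thesis by simp
qed

section \<open>The integral formula\<close>

context C1_domain
begin

section \<open>Cutoffs supported inside the domain\<close>

definition cutoff :: "real \<Rightarrow> ('a \<Rightarrow> complex) \<Rightarrow> 'a \<Rightarrow> complex" where
  "cutoff \<delta> w x = (if x \<in> \<Omega> then complex_of_real (level_cut \<delta> (f x)) * w x else 0)"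

lemma compact_sublevel:
  assumes "\<delta> > 0"
  shows "compact {x \<in> closure \<Omega>. f x \<le> - \<delta>}" "{x \<in> closure \<Omega>. f x \<le> - \<delta>} \<subseteq> \<Omega>"
proof -
  have "closed {x \<in> closure \<Omega>. f x \<le> - \<delta>}"
    using continuous_closed_preimage[OF continuous_on_subset[OF continuous_on_f closure_U], of "{..- \<delta>}"]
    by (simp add: vimage_def Int_def)
  then have "compact (closure \<Omega> \<inter> {x \<in> closure \<Omega>. f x \<le> - \<delta>})" using compact_closure_\<Omega> by (rule compact_Int_closed[rotated])
  moreover have "closure \<Omega> \<inter> {x \<in> closure \<Omega>. f x \<le> - \<delta>} = {x \<in> closure \<Omega>. f x \<le> - \<delta>}" by auto
  ultimately show "compact {x \<in> closure \<Omega>. f x \<le> - \<delta>}" by simp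
  show "{x \<in> closure \<Omega>. f x \<le> - \<delta>} \<subseteq> \<Omega>" using assms closure_U sublevel by auto
qed

text \<open>The domain and the complement of the compact set where \<open>f\<close> is at most
  -delta are open and cover the space. The extension is continuous on the first by assumption and
  zero on the second.\<close>

lemma cc_extend_zero:
  fixes h :: "'a \<Rightarrow> complex"
  assumes \<delta>: "\<delta> > 0" and h: "continuous_on \<Omega> h" "\<And>x. x \<in> \<Omega> \<Longrightarrow> f x > - \<delta> \<Longrightarrow> h x = 0"
  shows "cc (\<lambda>x. if x \<in> \<Omega> then h x else 0)" (is "cc ?h")
proof -
  define K where "K = {x \<in> closure \<Omega>. f x \<le> - \<delta>}"
  have K: "compact K" "K \<subseteq> \<Omega>" unfolding K_def by (rule compact_sublevel[OF \<delta>])+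
  have z: "?h x = 0" if "x \<notin> K" for x
    using that h(2)[of x] closure_subset[of \<Omega>] by (auto simp: K_def not_le)
  have "continuous_on \<Omega> ?h" by (rule continuous_on_eq[OF h(1)]) simp
  moreover have "continuous_on (- K) ?h" by (rule continuous_on_eq[OF continuous_on_const[of _ 0]]) (use z in auto)
  ultimately have "continuous_on (\<Omega> \<union> - K) ?h"
    using open_\<Omega> compact_imp_closed[OF K(1)] by (intro continuous_on_open_Un) (auto simp: open_Compl)
  moreover have "\<Omega> \<union> - K = UNIV" using K(2) by auto
  ultimately have c: "continuous_on UNIV ?h" by simp
  show ?thesis unfolding cc_def using c K(1) z by metis
qed

lemma cc1_cutoff:
  assumes \<delta>: "\<delta> > 0"
    and w: "continuous_on U w" "\<And>e. continuous_on U (w' e)"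
      "\<And>x e. x \<in> U \<Longrightarrow> ((\<lambda>t. w (x + t *\<^sub>R e)) has_vector_derivative w' e x) (at 0)"
  shows "cc1 (cutoff \<delta> w)"
    and "dird e (cutoff \<delta> w) = (\<lambda>x. if x \<in> \<Omega> then complex_of_real (- level_kernel \<delta> (f x) * (G x \<bullet> e)) * w x + complex_of_real (level_cut \<delta> (f x)) * w' e x else 0)"
proof -
  let ?d = "\<lambda>e x. complex_of_real (- level_kernel \<delta> (f x) * (G x \<bullet> e)) * w x + complex_of_real (level_cut \<delta> (f x)) * w' e x"
  have cont: "continuous_on \<Omega> f" "continuous_on \<Omega> w" "\<And>e. continuous_on \<Omega> (w' e)" "continuous_on \<Omega> G"
    using \<Omega>_subset_U continuous_on_f w contG by (auto intro: continuous_on_subset)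
  have ck: "continuous_on \<Omega> (\<lambda>x. level_kernel \<delta> (f x))" "continuous_on \<Omega> (\<lambda>x. level_cut \<delta> (f x))"
    using continuous_on_compose2[OF continuous_on_level_kernel[OF \<delta>, of UNIV] cont(1)] continuous_on_compose2[OF continuous_on_level_cut[OF \<delta>, of UNIV] cont(1)] by auto
  have c0: "cc (cutoff \<delta> w)"
    unfolding cutoff_def[abs_def] using cont ck level_cut_zero[OF \<delta>] by (intro cc_extend_zero[OF \<delta>] continuous_intros) auto
  have c1: "cc (\<lambda>x. if x \<in> \<Omega> then ?d e x else 0)" for e
    using cont ck level_cut_zero[OF \<delta>] level_kernel_zero[OF \<delta>] by (intro cc_extend_zero[OF \<delta>] continuous_intros) auto
  have D: "has_dird e (cutoff \<delta> w) (\<lambda>x. if x \<in> \<Omega> then ?d e x else 0)" for e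
    unfolding has_dird_def
  proof
    fix x
    have line: "continuous_on UNIV (\<lambda>t. x + t *\<^sub>R e)" by (intro continuous_intros)
    show "((\<lambda>t. cutoff \<delta> w (x + t *\<^sub>R e)) has_vector_derivative (if x \<in> \<Omega> then ?d e x else 0)) (at 0)"
    proof (cases "x \<in> \<Omega>")
      case True
      then have xU: "x \<in> U" using \<Omega>_subset_U by blast
      have "((\<lambda>t. x + t *\<^sub>R e) has_derivative (\<lambda>h. h *\<^sub>R e)) (at 0)" by (auto intro!: derivative_eq_intros)
      from has_derivative_compose[OF this, of f "\<lambda>h. G x \<bullet> h"] deriv[OF xU]
      have "((\<lambda>t. f (x + t *\<^sub>R e)) has_derivative (\<lambda>h. G x \<bullet> (h *\<^sub>R e))) (at 0)" by simp
      then have fl: "((\<lambda>t. f (x + t *\<^sub>R e)) has_real_derivative G x \<bullet> e) (at 0)"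
        by (simp add: has_field_derivative_def mult.commute[of _ "G x \<bullet> e"])
      have "((\<lambda>t. level_cut \<delta> (f (x + t *\<^sub>R e))) has_real_derivative - level_kernel \<delta> (f x) * (G x \<bullet> e)) (at 0)"
        using DERIV_chain2[OF DERIV_level_cut[OF \<delta>] fl] by simp
      then have "((\<lambda>t. complex_of_real (level_cut \<delta> (f (x + t *\<^sub>R e)))) has_vector_derivative complex_of_real (- level_kernel \<delta> (f x) * (G x \<bullet> e))) (at 0)"
        by (intro has_vector_derivative_of_real) (simp add: has_real_derivative_iff_has_vector_derivative)
      from has_vector_derivative_mult[OF this w(3)[OF xU, of e]]
      have "((\<lambda>t. complex_of_real (level_cut \<delta> (f (x + t *\<^sub>R e))) * w (x + t *\<^sub>R e)) has_vector_derivative ?d e x) (at 0)"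
        by (simp add: add.commute)
      moreover have "open ((\<lambda>t. x + t *\<^sub>R e) -` \<Omega>)" using open_\<Omega> line by (rule open_vimage)
      ultimately have "((\<lambda>t. cutoff \<delta> w (x + t *\<^sub>R e)) has_vector_derivative ?d e x) (at 0)"
        by (rule has_vector_derivative_transform_within_open) (use True in \<open>auto simp: cutoff_def\<close>)
      then show ?thesis using True by simp
    next
      case False
      \<comment> \<open>A point outside the domain has a neighbourhood missing the compact set
        \<open>K\<close>, and there the cutoff is identically zero.\<close>
      define K where "K = {x \<in> closure \<Omega>. f x \<le> - \<delta>}"
      have K: "compact K" "K \<subseteq> \<Omega>" unfolding K_def by (rule compact_sublevel[OF \<delta>])+
      have z: "cutoff \<delta> w x = 0" if "x \<notin> K" for x
        using that level_cut_zero[OF \<delta>, of "f x"] closure_subset[of \<Omega>] by (auto simp: K_def cutoff_def)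
      have "open ((\<lambda>t. x + t *\<^sub>R e) -` (- K))" using compact_imp_closed[OF K(1)] line by (intro open_vimage) (auto simp: open_Compl)
      then have "((\<lambda>t. cutoff \<delta> w (x + t *\<^sub>R e)) has_vector_derivative 0) (at 0)"
        by (rule has_vector_derivative_transform_within_open[OF has_vector_derivative_const[of "0::complex"]]) (use False K(2) z in auto)
      then show ?thesis using False by simp
    qed
  qed
  show "cc1 (cutoff \<delta> w)" by (rule cc1I[OF c0 D c1])
  show "dird e (cutoff \<delta> w) = (\<lambda>x. if x \<in> \<Omega> then ?d e x else 0)" by (rule has_dird_unique[OF D])
qed

end

section \<open>Complex derivatives of the defining function\<close>

locale C2_complex_domain =
  fixes \<Omega> U :: "(complex^'n::finite) set" and f :: "complex^'n \<Rightarrow> real"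
    and Df :: "complex^'n \<Rightarrow> ((complex^'n) \<Rightarrow>\<^sub>L real)" and D2f :: "complex^'n \<Rightarrow> ((complex^'n) \<Rightarrow>\<^sub>L ((complex^'n) \<Rightarrow>\<^sub>L real))"
  assumes bounded_\<Omega>: "bounded \<Omega>" and open_\<Omega>: "open \<Omega>" and open_U: "open U" and closure_U: "closure \<Omega> \<subseteq> U"
    and Df: "\<And>x. x \<in> U \<Longrightarrow> (f has_derivative blinfun_apply (Df x)) (at x)"
    and D2f: "\<And>x. x \<in> U \<Longrightarrow> (Df has_derivative blinfun_apply (D2f x)) (at x)"
    and contD2f: "continuous_on U D2f"
    and sublevel: "\<Omega> = {x\<in>U. f x < 0}" and level: "frontier \<Omega> = {x\<in>U. f x = 0}"
    and regular: "\<And>x. x \<in> frontier \<Omega> \<Longrightarrow> frechet_derivative f (at x) \<noteq> (\<lambda>_. 0)"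
begin

definition grad :: "complex^'n \<Rightarrow> complex^'n" where
  "grad x = (\<Sum>b\<in>Basis. Df x b *\<^sub>R b)"

lemma grad_inner: "grad x \<bullet> h = Df x h"
proof -
  have "Df x h = Df x (\<Sum>b\<in>Basis. (h \<bullet> b) *\<^sub>R b)" by (simp only: euclidean_representation)
  also have "\<dots> = (\<Sum>b\<in>Basis. (h \<bullet> b) * Df x b)" by (simp add: blinfun.sum_right blinfun.scaleR_right)
  also have "\<dots> = grad x \<bullet> h"
    unfolding grad_def inner_sum_left inner_scaleR_left by (intro sum.cong) (auto simp: inner_commute)
  finally show ?thesis by simp
qed

lemma continuous_on_Df: "continuous_on U Df"
  using D2f has_derivative_continuous by (intro continuous_at_imp_continuous_on) blast

sublocale C1_domain \<Omega> U f grad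
proof (rule C1_domain.intro)
  show "continuous_on U grad"
    unfolding grad_def[abs_def] by (intro continuous_intros continuous_on_Df)
  show "(f has_derivative (\<lambda>h. grad x \<bullet> h)) (at x)" if "x \<in> U" for x
    unfolding grad_inner using Df[OF that] .
  show "grad x \<noteq> 0" if x: "x \<in> frontier \<Omega>" for x
  proof
    assume "grad x = 0"
    then have "blinfun_apply (Df x) = (\<lambda>_. 0)" using grad_inner[of x] by (auto simp: fun_eq_iff)
    moreover have "x \<in> U" using x level by blast
    ultimately show False using regular[OF x] frechet_derivative_at[OF Df] by metis
  qed
qed (use bounded_\<Omega> open_\<Omega> open_U closure_U sublevel level in auto)

text \<open>f_kbar as an expression in \<open>Df\<close>. Continuity and differentiability can be
  read off from it, which is not so for \<open>fzbar\<close>, built from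
  \<open>frechet_derivative\<close>; the two agree on \<open>U\<close>.\<close>

definition fb :: "'n \<Rightarrow> complex^'n \<Rightarrow> complex" where
  "fb k x = (complex_of_real (Df x (axis k 1)) + \<i> * complex_of_real (Df x (axis k \<i>))) / 2"

definition dfb :: "'n \<Rightarrow> complex^'n \<Rightarrow> complex^'n \<Rightarrow> complex" where
  "dfb k h x = (complex_of_real (D2f x h (axis k 1)) + \<i> * complex_of_real (D2f x h (axis k \<i>))) / 2"

lemma of_real_derivative:
  assumes "x \<in> U"
  shows "dpart (\<lambda>w. complex_of_real (f w)) v x = complex_of_real (Df x v)"
proof -
  have "((\<lambda>w. complex_of_real (f w)) has_derivative (\<lambda>h. complex_of_real (Df x h))) (at x)"
    using bounded_linear.has_derivative[OF bounded_linear_of_real Df[OF assms]] .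
  from frechet_derivative_at[OF this] show ?thesis unfolding dpart_def by (metis)
qed

lemma fzbar_eq: "x \<in> U \<Longrightarrow> fzbar f k x = fb k x"
  by (simp add: fzbar_def wzbar_def of_real_derivative fb_def)

lemma fz_eq: "x \<in> U \<Longrightarrow> fz f k x = cnj (fb k x)"
  by (simp add: fz_def wz_def of_real_derivative fb_def)

lemma fb_derivative:
  assumes "x \<in> U"
  shows "(fb k has_derivative (\<lambda>h. dfb k h x)) (at x)"
proof -
  have d: "((\<lambda>x. Df x b) has_derivative (\<lambda>h. D2f x h b)) (at x)" for b
    using bounded_linear.has_derivative[OF blinfun.bounded_linear_left D2f[OF assms]] .
  have "((\<lambda>x. complex_of_real (Df x (axis k 1)) + \<i> * complex_of_real (Df x (axis k \<i>))) has_derivative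
      (\<lambda>h. complex_of_real (D2f x h (axis k 1)) + \<i> * complex_of_real (D2f x h (axis k \<i>)))) (at x)"
    by (intro has_derivative_add has_derivative_mult_right bounded_linear.has_derivative[OF bounded_linear_of_real] d)
  from bounded_linear.has_derivative[OF bounded_linear_divide[of 2] this]
  show ?thesis unfolding fb_def[abs_def] dfb_def .
qed

lemma fzzbar_eq:
  assumes "x \<in> U"
  shows "fzzbar f l k x = (dfb k (axis l 1) x - \<i> * dfb k (axis l \<i>) x) / 2"
proof -
  \<comment> \<open>The inner derivative agrees with \<open>fb k\<close> only on \<open>U\<close>;
    openness of \<open>U\<close> suffices to differentiate once more.\<close>
  have "((\<lambda>w. wzbar k (\<lambda>u. complex_of_real (f u)) w) has_derivative (\<lambda>h. dfb k h x)) (at x)"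
    by (rule has_derivative_transform_within_open[OF fb_derivative[OF assms] open_U assms])
       (simp add: fzbar_eq[symmetric] fzbar_def)
  from frechet_derivative_at[OF this] show ?thesis unfolding fzzbar_def wz_def dpart_def by metis
qed

lemma continuous_on_fb: "continuous_on U (fb k)"
  unfolding fb_def[abs_def] by (intro continuous_intros continuous_on_Df) auto

lemma continuous_on_dfb: "continuous_on U (dfb k h)"
  unfolding dfb_def[abs_def] by (intro continuous_intros contD2f) auto

lemma fb_line:
  assumes "x \<in> U"
  shows "((\<lambda>t. fb k (x + t *\<^sub>R e)) has_vector_derivative dfb k e x) (at 0)"
proof -
  have "((\<lambda>t. x + t *\<^sub>R e) has_derivative (\<lambda>h. h *\<^sub>R e)) (at 0)" by (auto intro!: derivative_eq_intros)
  from has_derivative_compose[OF this, of "fb k" "\<lambda>h. dfb k h x"] fb_derivative[OF assms]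
  have "((\<lambda>t. fb k (x + t *\<^sub>R e)) has_derivative (\<lambda>h. dfb k (h *\<^sub>R e) x)) (at 0)" by simp
  moreover have "dfb k (h *\<^sub>R e) x = h *\<^sub>R dfb k e x" for h
    unfolding dfb_def blinfun.scaleR_right blinfun.scaleR_left by (simp add: scaleR_conv_of_real algebra_simps)
  ultimately show ?thesis by (simp add: has_vector_derivative_def)
qed

definition dir :: "'n option \<Rightarrow> (complex^'n) \<times> (complex^'n)" where
  "dir l = (axis (the l) 1, axis (the l) \<i>)"

lemma cc1_cutoff_fb: "\<delta> > 0 \<Longrightarrow> cc1 (cutoff \<delta> (fb k))"
  using cc1_cutoff(1)[OF _ continuous_on_fb continuous_on_dfb fb_line] by blast

lemma dird_cutoff_fb:
  assumes "\<delta> > 0"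
  shows "dird e (cutoff \<delta> (fb k)) x = (if x \<in> \<Omega> then complex_of_real (- level_kernel \<delta> (f x) * (grad x \<bullet> e)) * fb k x
    + complex_of_real (level_cut \<delta> (f x)) * dfb k e x else 0)"
  using cc1_cutoff(2)[OF assms continuous_on_fb continuous_on_dfb fb_line, of e k] by (rule fun_cong)

text \<open>Product rule: the derivative of f_kbar is a Hessian entry, and the derivative of the
  cutoff is the kernel times -f_l. The resulting rank-one term f_l f_kbar carries the border of the
  Levi determinant.\<close>

lemma wirt_cutoff_fb:
  assumes \<delta>: "\<delta> > 0"
  shows "wirt (dir (Some l)) (cutoff \<delta> (fb k)) x =
    (if x \<in> \<Omega> then complex_of_real (level_cut \<delta> (f x)) * fzzbar f l k x - complex_of_real (level_kernel \<delta> (f x)) * (fz f l x * fb k x) else 0)"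
proof (cases "x \<in> \<Omega>")
  case True
  then have x: "x \<in> U" using \<Omega>_subset_U by blast
  show ?thesis
    unfolding wirt_def dird_cutoff_fb[OF \<delta>] fzzbar_eq[OF x] fz_eq[OF x]
    using True by (simp add: dir_def fb_def[of l] grad_inner field_simps)
next
  case False
  then show ?thesis unfolding wirt_def dird_cutoff_fb[OF \<delta>] by simp
qed

lemma bordered_simps [simp]:
  "bordered f x None None = 0" "bordered f x None (Some k) = fzbar f k x"
  "bordered f x (Some l) None = fz f l x" "bordered f x (Some l) (Some k) = fzzbar f l k x"
  by (simp_all add: bordered_def)

lemma continuous_on_bordered: "continuous_on U (\<lambda>x. bordered f x a b)"
proof -
  have "continuous_on U (\<lambda>x. (dfb k (axis l 1) x - \<i> * dfb k (axis l \<i>) x) / 2)" for l k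
    by (intro continuous_intros continuous_on_dfb) auto
  then have "continuous_on U (fzzbar f l k)" for l k by (rule continuous_on_eq) (simp add: fzzbar_eq)
  moreover have "continuous_on U (fzbar f k)" for k by (rule continuous_on_eq[OF continuous_on_fb]) (simp add: fzbar_eq)
  moreover have "continuous_on U (\<lambda>x. cnj (fb k x))" for k by (intro continuous_intros continuous_on_fb)
  then have "continuous_on U (fz f k)" for k by (rule continuous_on_eq) (simp add: fz_eq)
  ultimately show ?thesis by (cases a; cases b) (auto simp: bordered_def[abs_def])
qed

lemma continuous_on_det_on: "continuous_on U (\<lambda>x. det_on S (bordered f x))"
  unfolding det_on_def by (intro continuous_intros continuous_on_bordered)

lemma level_cut_integrable:
  assumes "\<delta> > 0" "continuous_on U (h :: _ \<Rightarrow> complex)"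
  shows "set_integrable lborel \<Omega> (\<lambda>x. level_cut \<delta> (f x) *\<^sub>R h x)" "set_integrable lborel \<Omega> (\<lambda>x. level_kernel \<delta> (f x) *\<^sub>R h x)" "set_integrable lborel \<Omega> h"
proof -
  have h: "continuous_on (closure \<Omega>) h" using assms(2) closure_U by (rule continuous_on_subset)
  have sub: "set_integrable lborel \<Omega> u" if "continuous_on (closure \<Omega>) u" for u :: "_ \<Rightarrow> complex"
  proof -
    have "set_integrable lborel (closure \<Omega>) u"
      unfolding set_integrable_def using that by (intro borel_integrable_compact compact_closure_\<Omega>)
    then show ?thesis by (rule set_integrable_subset) (use open_\<Omega> closure_subset in auto)
  qed
  show "set_integrable lborel \<Omega> h" by (rule sub[OF h])
  show "set_integrable lborel \<Omega> (\<lambda>x. level_kernel \<delta> (f x) *\<^sub>R h x)"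
    by (intro sub continuous_on_scaleR continuous_on_level_kernel_f assms(1) h)
  have "continuous_on (closure \<Omega>) (\<lambda>x. level_cut \<delta> (f x))"
    using continuous_on_compose2[OF continuous_on_level_cut[OF assms(1), of UNIV] continuous_on_subset[OF continuous_on_f closure_U]] by auto
  then show "set_integrable lborel \<Omega> (\<lambda>x. level_cut \<delta> (f x) *\<^sub>R h x)"
    by (intro sub continuous_on_scaleR h)
qed

section \<open>The identity at positive delta and its limit\<close>

text \<open>The vanishing integral for \<open>u\<close> splits along column \<open>b\<close>: the
  Hessian part of that column gives the minor times the cutoff, the rank-one part the kernel times
  the share of the bordered determinant that belongs to the border entry at
  \<open>b\<close>.\<close>

lemma minor_identity:
  assumes \<delta>: "\<delta> > 0" and b: "b \<in> I"
  defines "S \<equiv> Some ` I"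
  shows "(LINT x:\<Omega>|lborel. level_cut \<delta> (f x) *\<^sub>R det_on S (bordered f x)) =
    (LINT x:\<Omega>|lborel. level_kernel \<delta> (f x) *\<^sub>R (bordered f x None (Some b) *
      (\<Sum>p\<in>{p. p permutes S}. of_int (sign p) * (bordered f x (p (Some b)) None * (\<Prod>c\<in>S - {Some b}. bordered f x (p c) c)))))"
proof -
  let ?P = "{p. p permutes S}" and ?N = "bordered f"
  have S: "finite S" "Some b \<in> S" using b by (auto simp: S_def)
  txt \<open>The cutoff with parameter delta / 3 equals 1 wherever the one with parameter delta is nonzero.\<close>
  define u where "u c = cutoff (if c = Some b then \<delta> else \<delta> / 3) (fb (the c))" for c :: "'n option"
  have u: "cc1 (u c)" for c unfolding u_def using \<delta> by (intro cc1_cutoff_fb) auto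
  define C where "C x = (\<Sum>p\<in>?P. of_int (sign p) * (?N x (p (Some b)) None * (\<Prod>c\<in>S - {Some b}. ?N x (p c) c)))" for x
  have contC: "continuous_on U C" unfolding C_def[abs_def] by (intro continuous_intros continuous_on_bordered)
  have integrand: "(\<Sum>p\<in>?P. of_int (sign p) * (wirt (dir (p (Some b))) (u (Some b)) x * (\<Prod>c\<in>S - {Some b}. wirt (dir (p c)) (u c) x)))
    = indicator \<Omega> x *\<^sub>R (level_cut \<delta> (f x) *\<^sub>R det_on S (?N x) - level_kernel \<delta> (f x) *\<^sub>R (?N x None (Some b) * C x))" (is "?L = ?R") for x
  \<comment> \<open>Outside this set both the cutoff and the kernel with parameter
    \<open>\<delta>\<close> vanish, hence column \<open>b\<close>, and both sides are 0.\<close>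
  proof (cases "x \<in> \<Omega> \<and> f x \<le> - \<delta>")
    case True
    then have x: "x \<in> \<Omega>" "x \<in> U" using \<Omega>_subset_U by auto
    have inS: "\<exists>l. p c = Some l" if "p \<in> ?P" "c \<in> S" for p c
      using permutes_in_image[of p S c] that by (auto simp: S_def)
    have wc: "wirt (dir (p c)) (u c) x = ?N x (p c) c" if p: "p \<in> ?P" and c: "c \<in> S - {Some b}" for p c
    proof -
      obtain l where l: "p c = Some l" using inS[OF p, of c] c by blast
      moreover obtain k where "c = Some k" using c by (auto simp: S_def)
      ultimately have lk: "p c = Some l" "c = Some k" by auto
      \<comment> \<open>The threshold of this cutoff is 3 (delta/3) = delta, exactly where the one
        of column \<open>b\<close> begins to be nonzero.\<close>
      have "level_cut (\<delta> / 3) (f x) = 1" "level_kernel (\<delta> / 3) (f x) = 0"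
        using level_cut_one[of "\<delta> / 3" "f x"] level_kernel_zero[of "\<delta> / 3" "f x"] \<delta> True by auto
      then show ?thesis using lk c \<delta> x wirt_cutoff_fb[of "\<delta> / 3" l k x] by (simp add: u_def)
    qed
    have wb: "wirt (dir (p (Some b))) (u (Some b)) x = complex_of_real (level_cut \<delta> (f x)) * ?N x (p (Some b)) (Some b)
        - complex_of_real (level_kernel \<delta> (f x)) * (?N x (p (Some b)) None * ?N x None (Some b))" if p: "p \<in> ?P" for p
    proof -
      obtain l where "p (Some b) = Some l" using inS[OF p S(2)] by blast
      then show ?thesis using x wirt_cutoff_fb[OF \<delta>, of l b x] by (simp add: u_def fzbar_eq)
    qed
    have expand: "of_int (sign p) * (wirt (dir (p (Some b))) (u (Some b)) x * (\<Prod>c\<in>S - {Some b}. wirt (dir (p c)) (u c) x))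
      = complex_of_real (level_cut \<delta> (f x)) * (of_int (sign p) * (\<Prod>c\<in>S. ?N x (p c) c))
        - complex_of_real (level_kernel \<delta> (f x)) * (?N x None (Some b) * (of_int (sign p) * (?N x (p (Some b)) None * (\<Prod>c\<in>S - {Some b}. ?N x (p c) c))))"
      if "p \<in> ?P" for p
    proof -
      have "(\<Prod>c\<in>S - {Some b}. wirt (dir (p c)) (u c) x) = (\<Prod>c\<in>S - {Some b}. ?N x (p c) c)"
        using wc[OF that] by (intro prod.cong) auto
      then show ?thesis using prod.remove[OF S, of "\<lambda>c. ?N x (p c) c"] unfolding wb[OF that] by (simp add: algebra_simps)
    qed
    have "?L = (\<Sum>p\<in>?P. complex_of_real (level_cut \<delta> (f x)) * (of_int (sign p) * (\<Prod>c\<in>S. ?N x (p c) c))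
        - complex_of_real (level_kernel \<delta> (f x)) * (?N x None (Some b) * (of_int (sign p) * (?N x (p (Some b)) None * (\<Prod>c\<in>S - {Some b}. ?N x (p c) c)))))"
      by (rule sum.cong[OF refl expand])
    also have "\<dots> = complex_of_real (level_cut \<delta> (f x)) * det_on S (?N x) - complex_of_real (level_kernel \<delta> (f x)) * (?N x None (Some b) * C x)"
      unfolding sum_subtractf det_on_transpose[OF S(1)] C_def by (simp only: sum_distrib_left)
    also have "\<dots> = ?R" using x by (simp add: scaleR_conv_of_real)
    finally show ?thesis .
  next
    case False
    have wb: "wirt (dir (p (Some b))) (u (Some b)) x = 0" if "p \<in> ?P" for p
    proof -
      have "p (Some b) \<in> S" using permutes_in_image[of p S "Some b"] that S(2) by simp
      then obtain l where "p (Some b) = Some l" by (auto simp: S_def)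
      then show ?thesis using False wirt_cutoff_fb[OF \<delta>, of l b x] level_cut_zero[OF \<delta>, of "f x"] level_kernel_zero[OF \<delta>, of "f x"] by (auto simp: u_def)
    qed
    then have "?L = 0" by simp
    moreover have "?R = 0" using False level_cut_zero[OF \<delta>, of "f x"] level_kernel_zero[OF \<delta>, of "f x"] by (auto simp: indicator_def)
    ultimately show ?thesis by simp
  qed
  have cN: "continuous_on U (\<lambda>x. ?N x None (Some b) * C x)" by (intro continuous_intros continuous_on_bordered contC)
  note i1 = level_cut_integrable(1)[OF \<delta> continuous_on_det_on[of S]] and i2 = level_cut_integrable(2)[OF \<delta> cN]
  have "0 = (LINT x|lborel. (\<Sum>p\<in>?P. of_int (sign p) * (wirt (dir (p (Some b))) (u (Some b)) x * (\<Prod>c\<in>S - {Some b}. wirt (dir (p c)) (u c) x))))"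
    by (rule integral_det_wirt_zero[OF S u, symmetric])
  also have "\<dots> = (LINT x:\<Omega>|lborel. level_cut \<delta> (f x) *\<^sub>R det_on S (?N x) - level_kernel \<delta> (f x) *\<^sub>R (?N x None (Some b) * C x))"
    unfolding integrand set_lebesgue_integral_def ..
  also have "\<dots> = (LINT x:\<Omega>|lborel. level_cut \<delta> (f x) *\<^sub>R det_on S (?N x)) - (LINT x:\<Omega>|lborel. level_kernel \<delta> (f x) *\<^sub>R (?N x None (Some b) * C x))"
    by (rule set_integral_diff(2)[OF i1 i2])
  finally show ?thesis by (simp add: C_def)
qed

text \<open>Summation over the column \<open>b\<close> in \<open>I\<close>. The left side does not
  depend on \<open>b\<close>, which produces the factor \<open>card I\<close>; on the right the
  shares add up to the expansion of \<open>det_on_bordered\<close>.\<close>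

lemma minors_identity:
  assumes \<delta>: "\<delta> > 0"
  shows "of_nat (card I) * (LINT x:\<Omega>|lborel. level_cut \<delta> (f x) *\<^sub>R det_on I (\<lambda>l k. fzzbar f l k x)) =
    - (LINT x:\<Omega>|lborel. level_kernel \<delta> (f x) *\<^sub>R det_on (insert None (Some ` I)) (bordered f x))"
proof -
  let ?S = "Some ` I" and ?N = "bordered f"
  define C where "C b x = ?N x None (Some b) * (\<Sum>p\<in>{p. p permutes ?S}. of_int (sign p) * (?N x (p (Some b)) None * (\<Prod>c\<in>?S - {Some b}. ?N x (p c) c)))" for b x
  have contC: "continuous_on U (C b)" for b unfolding C_def[abs_def] by (intro continuous_intros continuous_on_bordered)
  have det: "det_on ?S (?N x) = det_on I (\<lambda>l k. fzzbar f l k x)" for x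
    by (subst det_on_image) auto
  have bord: "det_on (insert None ?S) (?N x) = - (\<Sum>b\<in>I. C b x)" for x
    by (subst det_on_bordered) (auto simp: C_def sum.reindex)
  have "of_nat (card I) * (LINT x:\<Omega>|lborel. level_cut \<delta> (f x) *\<^sub>R det_on I (\<lambda>l k. fzzbar f l k x))
      = (\<Sum>b\<in>I. LINT x:\<Omega>|lborel. level_cut \<delta> (f x) *\<^sub>R det_on ?S (?N x))" by (simp add: det)
  also have "\<dots> = (\<Sum>b\<in>I. LINT x:\<Omega>|lborel. level_kernel \<delta> (f x) *\<^sub>R C b x)"
    unfolding C_def by (intro sum.cong refl minor_identity \<delta>)
  also have "\<dots> = (LINT x:\<Omega>|lborel. (\<Sum>b\<in>I. level_kernel \<delta> (f x) *\<^sub>R C b x))"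
    unfolding set_lebesgue_integral_def scaleR_sum_right
    using level_cut_integrable(2)[OF \<delta> contC] unfolding set_integrable_def
    by (intro Bochner_Integration.integral_sum[symmetric])
  also have "\<dots> = - (LINT x:\<Omega>|lborel. level_kernel \<delta> (f x) *\<^sub>R det_on (insert None ?S) (?N x))"
    unfolding set_lebesgue_integral_def bord integral_minus[symmetric] by (simp add: scaleR_sum_right)
  finally show ?thesis .
qed

lemma level_cut_limit:
  assumes h: "continuous_on U (h :: _ \<Rightarrow> complex)" and \<delta>: "\<And>k. \<delta> k > 0" "\<delta> \<longlonglongrightarrow> 0"
  shows "(\<lambda>k. LINT x:\<Omega>|lborel. level_cut (\<delta> k) (f x) *\<^sub>R h x) \<longlonglongrightarrow> (LINT x:\<Omega>|lborel. h x)"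
  unfolding set_lebesgue_integral_def
proof (rule integral_dominated_convergence[where w = "\<lambda>x. norm (indicator \<Omega> x *\<^sub>R h x)"])
  have i: "integrable lborel (\<lambda>x. indicator \<Omega> x *\<^sub>R h x)" using level_cut_integrable(3)[OF \<delta>(1) h] by (simp add: set_integrable_def)
  show "(\<lambda>x. indicator \<Omega> x *\<^sub>R h x) \<in> borel_measurable lborel" using i by (rule borel_measurable_integrable)
  show "integrable lborel (\<lambda>x. norm (indicator \<Omega> x *\<^sub>R h x))" using i by (rule integrable_norm)
  show "(\<lambda>x. indicator \<Omega> x *\<^sub>R level_cut (\<delta> k) (f x) *\<^sub>R h x) \<in> borel_measurable lborel" for k
    using level_cut_integrable(1)[OF \<delta>(1) h] unfolding set_integrable_def by (rule borel_measurable_integrable)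
  show "AE x in lborel. norm (indicator \<Omega> x *\<^sub>R level_cut (\<delta> k) (f x) *\<^sub>R h x) \<le> norm (indicator \<Omega> x *\<^sub>R h x)" for k
  proof (rule AE_I2)
    fix x
    have "\<bar>level_cut (\<delta> k) (f x)\<bar> * norm (h x) \<le> 1 * norm (h x)"
      using level_cut_bounds[of "\<delta> k" "f x"] by (intro mult_right_mono) auto
    then show "norm (indicator \<Omega> x *\<^sub>R level_cut (\<delta> k) (f x) *\<^sub>R h x) \<le> norm (indicator \<Omega> x *\<^sub>R h x)"
      by (auto simp: indicator_def)
  qed
  show "AE x in lborel. (\<lambda>k. indicator \<Omega> x *\<^sub>R level_cut (\<delta> k) (f x) *\<^sub>R h x) \<longlonglongrightarrow> indicator \<Omega> x *\<^sub>R h x"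
  proof (rule AE_I2, cases)
    fix x assume x: "x \<in> \<Omega>"
    then have "0 < - f x / 3" using sublevel by auto
    then have "\<forall>\<^sub>F k in sequentially. \<delta> k < - f x / 3" using \<delta>(2) by (intro order_tendstoD)
    then have "\<forall>\<^sub>F k in sequentially. indicator \<Omega> x *\<^sub>R level_cut (\<delta> k) (f x) *\<^sub>R h x = indicator \<Omega> x *\<^sub>R h x"
    proof eventually_elim
      case (elim k)
      then have "level_cut (\<delta> k) (f x) = 1" using \<delta>(1) by (intro level_cut_one) auto
      then show ?case by simp
    qed
    then show "(\<lambda>k. indicator \<Omega> x *\<^sub>R level_cut (\<delta> k) (f x) *\<^sub>R h x) \<longlonglongrightarrow> indicator \<Omega> x *\<^sub>R h x" by (rule tendsto_eventually)
  qed simp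
qed

text \<open>Under the identification of C^n with R^(2n) the k-th complex coordinate of the real
  gradient is 2 f_kbar, and f_k has the same modulus as f_kbar.\<close>

lemma norm_partial_eq:
  assumes "x \<in> U"
  shows "norm_partial f x = norm (grad x) / 2"
proof -
  have G: "fb k x = grad x $ k / 2" for k
  proof -
    have "Df x (axis k 1) = Re (grad x $ k)" "Df x (axis k \<i>) = Im (grad x $ k)"
      unfolding grad_inner[symmetric] by (simp_all add: inner_axis inner_complex_def)
    then show ?thesis by (simp add: fb_def complex_eq_iff)
  qed
  have "norm_partial f x = sqrt (\<Sum>k\<in>UNIV. (norm (grad x $ k))\<^sup>2 / 2\<^sup>2)"
    unfolding norm_partial_def fz_eq[OF assms] G by (simp add: norm_divide power_divide)
  also have "\<dots> = sqrt (\<Sum>k\<in>UNIV. (norm (grad x $ k))\<^sup>2) / sqrt (2\<^sup>2)"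
    by (simp only: sum_divide_distrib[symmetric] real_sqrt_divide)
  also have "\<dots> = norm (grad x) / 2" by (simp add: norm_vec_def L2_set_def)
  finally show ?thesis .
qed

text \<open>\<open>'b\<close> is a Euclidean type of one dimension less, the model of the tangent
  hyperplanes in the charts. Both sides of the summed identity for minors converge, the left by
  dominated convergence and the right by \<open>layer_limit\<close>.\<close>

theorem integral_sigma_eq_boundary:
  assumes dim: "DIM(complex^'n) = DIM('b::euclidean_space) + 1" and m: "1 \<le> m"
  shows "(LINT x:\<Omega>|lborel. sigma_eig m (cplx_hessian f x)) =
    - (1 / of_nat m) * (LINT x:frontier \<Omega>|surface_measure.
        (\<Sum>I | card I = m. det_on (insert None (Some ` I)) (bordered f x)) / of_real (norm (grad x)))"
proof -
  let ?N = "bordered f"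
  define \<delta> where "\<delta> k = inverse (real (Suc k))" for k
  have \<delta>: "\<And>k. \<delta> k > 0" "\<delta> \<longlonglongrightarrow> 0" unfolding \<delta>_def using LIMSEQ_inverse_real_of_nat by auto
  define \<Psi> where "\<Psi> x = (\<Sum>I | card I = m. det_on (insert None (Some ` I)) (?N x))" for x
  define \<Sigma> where "\<Sigma> x = (\<Sum>I | card I = m. det_on I (\<lambda>l k. fzzbar f l k x))" for x
  have det: "det_on I (\<lambda>l k. fzzbar f l k x) = det_on (Some ` I) (?N x)" for I x
    by (subst det_on_image) auto
  have c1: "continuous_on U (\<lambda>x. det_on I (\<lambda>l k. fzzbar f l k x))" for I unfolding det by (rule continuous_on_det_on)
  have contS: "continuous_on U \<Sigma>" and contP: "continuous_on U \<Psi>"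
    unfolding \<Sigma>_def[abs_def] \<Psi>_def[abs_def] by (intro continuous_intros c1 continuous_on_det_on)+
  have eq: "of_nat m * (LINT x:\<Omega>|lborel. level_cut (\<delta> k) (f x) *\<^sub>R \<Sigma> x) = - (LINT x:\<Omega>|lborel. level_kernel (\<delta> k) (f x) *\<^sub>R \<Psi> x)" for k
  proof -
    have "(LINT x:\<Omega>|lborel. level_cut (\<delta> k) (f x) *\<^sub>R \<Sigma> x) = (\<Sum>I | card I = m. LINT x:\<Omega>|lborel. level_cut (\<delta> k) (f x) *\<^sub>R det_on I (\<lambda>l k. fzzbar f l k x))"
      unfolding set_lebesgue_integral_def \<Sigma>_def scaleR_sum_right
      using level_cut_integrable(1)[OF \<delta>(1) c1] unfolding set_integrable_def by (intro Bochner_Integration.integral_sum)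
    then have "of_nat m * (LINT x:\<Omega>|lborel. level_cut (\<delta> k) (f x) *\<^sub>R \<Sigma> x)
      = (\<Sum>I | card I = m. of_nat (card I) * (LINT x:\<Omega>|lborel. level_cut (\<delta> k) (f x) *\<^sub>R det_on I (\<lambda>l k. fzzbar f l k x)))"
      by (simp add: sum_distrib_left)
    also have "\<dots> = - (\<Sum>I | card I = m. LINT x:\<Omega>|lborel. level_kernel (\<delta> k) (f x) *\<^sub>R det_on (insert None (Some ` I)) (?N x))"
      unfolding minors_identity[OF \<delta>(1)] by (simp add: sum_negf)
    also have "(\<Sum>I | card I = m. LINT x:\<Omega>|lborel. level_kernel (\<delta> k) (f x) *\<^sub>R det_on (insert None (Some ` I)) (?N x)) = (LINT x:\<Omega>|lborel. level_kernel (\<delta> k) (f x) *\<^sub>R \<Psi> x)"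
      unfolding set_lebesgue_integral_def \<Psi>_def scaleR_sum_right
      using level_cut_integrable(2)[OF \<delta>(1) continuous_on_det_on] unfolding set_integrable_def by (intro Bochner_Integration.integral_sum[symmetric])
    finally show ?thesis .
  qed
  have "(\<lambda>k. of_nat m * (LINT x:\<Omega>|lborel. level_cut (\<delta> k) (f x) *\<^sub>R \<Sigma> x)) \<longlonglongrightarrow> of_nat m * (LINT x:\<Omega>|lborel. \<Sigma> x)"
    by (intro tendsto_intros level_cut_limit contS \<delta>)
  moreover have "(\<lambda>k. - (LINT x:\<Omega>|lborel. level_kernel (\<delta> k) (f x) *\<^sub>R \<Psi> x)) \<longlonglongrightarrow> - (LINT x:frontier \<Omega>|surface_measure. \<Psi> x / of_real (norm (grad x)))"
    by (intro tendsto_minus layer_limit[OF dim continuous_on_subset[OF contP closure_U] \<delta>])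
  ultimately have "of_nat m * (LINT x:\<Omega>|lborel. \<Sigma> x) = - (LINT x:frontier \<Omega>|surface_measure. \<Psi> x / of_real (norm (grad x)))"
    unfolding eq by (rule LIMSEQ_unique)
  then have "(LINT x:\<Omega>|lborel. \<Sigma> x) = - (1 / of_nat m) * (LINT x:frontier \<Omega>|surface_measure. \<Psi> x / of_real (norm (grad x)))"
    using m by (simp add: field_simps)
  moreover have "sigma_eig m (cplx_hessian f x) = \<Sigma> x" for x
  proof -
    have "(\<lambda>i k. cplx_hessian f x $ i $ k) = (\<lambda>l k. fzzbar f l k x)" by (simp add: cplx_hessian_def fun_eq_iff)
    then show ?thesis unfolding sigma_eig_eq_sum_minors \<Sigma>_def by simp
  qed
  ultimately show ?thesis by (simp add: \<Psi>_def)
qed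

end

text \<open>An index type for the real hyperplanes of C^n: their dimension 2n - 1 has to be that of a type.\<close>

typedef 'n hyperplane_index = "- {Inl undefined} :: ('n + 'n) set"
  by (rule exI[of _ "Inr undefined"]) simp

instance hyperplane_index :: (finite) finite
proof
  have "inj (Rep_hyperplane_index :: 'a hyperplane_index \<Rightarrow> 'a + 'a)" by (simp add: inj_def Rep_hyperplane_index_inject)
  moreover have "finite (range (Rep_hyperplane_index :: 'a hyperplane_index \<Rightarrow> 'a + 'a))" by (rule finite)
  ultimately show "finite (UNIV :: 'a hyperplane_index set)" by (rule finite_imageD[rotated])
qed

lemma DIM_hyperplane: "DIM(complex^'n::finite) = DIM(real^'n hyperplane_index) + 1"
proof -
  have "CARD('n hyperplane_index) = card (- {Inl undefined} :: ('n + 'n) set)"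
    using type_definition.card[OF type_definition_hyperplane_index] .
  also have "\<dots> = 2 * CARD('n) - 1" by (simp add: Compl_eq_Diff_UNIV card_Diff_singleton card_UNIV_sum)
  finally show ?thesis by simp
qed

theorem theorem2p2:
  fixes \<Omega> :: "(complex^'n::finite) set" and f :: "complex^'n \<Rightarrow> real" and j :: nat
  assumes "bounded \<Omega>" and "open \<Omega>" and "connected \<Omega>"
    and "C2_hypersurface (frontier \<Omega>)"
    and "defining_function \<Omega> f"
    and "1 \<le> j" and "j \<le> CARD('n) - 1"
  shows "(LINT x:\<Omega>|lborel. sigma_eig (j + 1) (cplx_hessian f x)) =
         of_nat (CARD('n) choose (j + 1)) * (1 / (2 * of_nat CARD('n))) *
         (LINT x:frontier \<Omega>|surface_measure. levi_curv j f x * complex_of_real (norm_partial f x ^ (j + 1)))"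
proof -
  obtain U where U: "open U" "closure \<Omega> \<subseteq> U" "C2_on U f" "\<Omega> = {z\<in>U. f z < 0}" "frontier \<Omega> = {z\<in>U. f z = 0}"
    "\<forall>z\<in>frontier \<Omega>. frechet_derivative f (at z) \<noteq> (\<lambda>_. 0)"
    using assms(5) unfolding defining_function_def by blast
  obtain Df D2f where D: "\<forall>x\<in>U. (f has_derivative blinfun_apply (Df x)) (at x)"
    "\<forall>x\<in>U. (Df has_derivative blinfun_apply (D2f x)) (at x)" "continuous_on U D2f"
    using U(3) unfolding C2_on_def by blast
  interpret C2_complex_domain \<Omega> U f Df D2f
    by (rule C2_complex_domain.intro) (use U D assms in auto)
  let ?n = "CARD('n) - 1"
  define \<Psi> where "\<Psi> x = (\<Sum>I | card I = j + 1. det_on (insert None (Some ` I)) (bordered f x))" for x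
  \<comment> \<open>The factor |df|^(j+1) cancels all but one of the j + 2 powers in the curvature,
    and 1/|df| = 2/|grad f| is the weight of the boundary integral.\<close>
  have levi: "levi_curv j f x * complex_of_real (norm_partial f x ^ (j + 1)) = - (2 / of_nat (?n choose j)) * (\<Psi> x / of_real (norm (grad x)))"
    if x: "x \<in> frontier \<Omega>" for x
  proof -
    have xU: "x \<in> U" using x level by blast
    have g: "norm (grad x) \<noteq> 0" using C1_domain.regular[OF C1_domain_axioms x] by simp
    define r where "r = complex_of_real (norm (grad x) / 2)"
    have r: "r \<noteq> 0" using g by (simp add: r_def)
    have "levi_curv j f x * complex_of_real (norm_partial f x ^ (j + 1)) = - (1 / of_nat (?n choose j)) * (1 / r ^ (j + 2)) * \<Psi> x * r ^ (j + 1)"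
      unfolding levi_curv_def norm_partial_eq[OF xU] \<Psi>_def r_def by simp
    also have "\<dots> = - (1 / of_nat (?n choose j)) * (\<Psi> x / r)" using r by (simp add: field_simps)
    also have "\<Psi> x / r = 2 * (\<Psi> x / of_real (norm (grad x)))" by (simp add: r_def)
    finally show ?thesis by simp
  qed
  have "(LINT x:frontier \<Omega>|surface_measure. levi_curv j f x * complex_of_real (norm_partial f x ^ (j + 1)))
      = (LINT x:frontier \<Omega>|surface_measure. - (2 / of_nat (?n choose j)) * (\<Psi> x / of_real (norm (grad x))))"
    unfolding set_lebesgue_integral_def using levi by (intro Bochner_Integration.integral_cong) (auto simp: indicator_def)
  also have "\<dots> = - (2 / of_nat (?n choose j)) * (LINT x:frontier \<Omega>|surface_measure. \<Psi> x / of_real (norm (grad x)))"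
    by (rule set_integral_mult_right)
  finally have R: "(LINT x:frontier \<Omega>|surface_measure. levi_curv j f x * complex_of_real (norm_partial f x ^ (j + 1)))
      = - (2 / of_nat (?n choose j)) * (LINT x:frontier \<Omega>|surface_measure. \<Psi> x / of_real (norm (grad x)))" .
  have L: "(LINT x:\<Omega>|lborel. sigma_eig (j + 1) (cplx_hessian f x)) =
    - (1 / of_nat (j + 1)) * (LINT x:frontier \<Omega>|surface_measure. \<Psi> x / of_real (norm (grad x)))"
    unfolding \<Psi>_def by (rule integral_sigma_eq_boundary[OF DIM_hyperplane]) simp
  have n: "Suc ?n = CARD('n)" using assms(6,7) by simp
  \<comment> \<open>The absorption identity converts the factor 1/(j+1), left over from the columns
    of the minors, into the normalisation of the curvature.\<close>
  have "(j + 1) * (CARD('n) choose (j + 1)) = CARD('n) * (?n choose j)"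
    using Suc_times_binomial[of j ?n] unfolding n by simp
  then have "of_nat (j + 1) * (of_nat (CARD('n) choose (j + 1)) :: complex) = of_nat CARD('n) * of_nat (?n choose j)"
    by (metis of_nat_mult)
  moreover have "(of_nat (?n choose j) :: complex) \<noteq> 0" using assms(7) by simp
  moreover have "(of_nat CARD('n) :: complex) \<noteq> 0" by simp
  moreover have "(of_nat (j + 1) :: complex) \<noteq> 0" using of_nat_neq_0 by (metis Suc_eq_plus1)
  ultimately have c: "of_nat (CARD('n) choose (j + 1)) * (1 / (2 * of_nat CARD('n))) * (2 / of_nat (?n choose j)) = (1 / of_nat (j + 1) :: complex)"
    by (simp add: divide_simps mult_ac)
  show ?thesis unfolding L R c[symmetric] by (simp only: mult_minus_left mult_minus_right mult.assoc)
qed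

end
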